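(* Suppose that $\boldsymbol\xi\sim P$ satisfies density-level regular variation with index $s$, that $(L_1,\dots,L_K)\in\mathcal H_1$ is regular, that $\mathcal J\in\mathfrak J$ is a nonempty subset of $[K]$ under consideration, and that the estimation-rate assumption (with exponents $m,\ell\in(0,1/2]$) and the second-order assumption (with exponent $\gamma>0$) hold. Let $W:\mathbb R^K\to\mathsf Y\subset\mathbb R^M$ be measurable, let $W_{u_n}(\boldsymbol z)=W\big(u_n^{-1}L_1(u_n\boldsymbol z),\dots,u_n^{-1}L_K(u_n\boldsymbol z)\big)$, and let $G_n=\Pi_n\circ W_{u_n}^{-1}$ and $\widehat G_n=\widehat\Pi_n\circ W_{u_n}^{-1}$ be the push-forward laws. Then for every such measurable stress summary $W_{u_n}:\mathcal E\to\mathsf Y$, $$\mathsf{TV}\big(\widehat G_n,G_n\big)=O_P\!\left(n^{-(1-q)(m\wedge\ell)}+n^{-q\gamma/s}\right),\qquad n\to\infty.$$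
   Context: Setting. $\|\cdot\|$ is the Euclidean norm on $\mathbb R^d$; $\mathcal E\subset\mathbb R^d$ is a closed cone; $\Theta_{\mathcal E}=\{\boldsymbol z\in\mathcal E:\|\boldsymbol z\|=1\}$; $B_r=\{\boldsymbol z:\|\boldsymbol z\|\le r\}$; $d\boldsymbol\phi$ is surface measure on $\Theta_{\mathcal E}$, so $d\boldsymbol z=r^{d-1}\,dr\,d\boldsymbol\phi$ for $\boldsymbol z=r\boldsymbol\phi$. $\boldsymbol\xi\sim P$ has density $f_{\boldsymbol\xi}$ supported on $\mathcal E$; $R=\|\boldsymbol\xi\|$, $\boldsymbol\Phi=\boldsymbol\xi/\|\boldsymbol\xi\|$. $[K]=\{1,\dots,K\}$. $\mathsf{TV}(P,Q)=\sup_B|P(B)-Q(B)|$. Density-level regular variation: $f_{\boldsymbol\xi}$ is continuous on $B_{r_0}^c\cap\mathcal E$ for some $r_0>0$, and there are $s>0$ and $\varphi^\star:\mathcal E\setminus\{\boldsymbol 0\}\to(0,\infty)$ with $t^{s+d}f_{\boldsymbol\xi}(t\boldsymbol z)\to\varphi^\star(\boldsymbol z)$ as $t\to\infty$, uniformly over compact subsets of $\mathcal E\setminus\{\boldsymbol 0\}$. Second-order assumption: moreover there is $\gamma>0$ with $\sup_{r>t,\ \boldsymbol\phi\in\Theta_{\mathcal E}}|r^{s+d}f_{\boldsymbol\xi}(r\boldsymbol\phi)-\varphi^\star(\boldsymbol\phi)|=O(t^{-\gamma})$ as $t\to\infty$. Loss systems: measurable functions $L_1,\dots,L_K:\mathcal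 E\to\mathbb R$ form an asymptotically homogeneous multi-loss system, $(L_1,\dots,L_K)\in\mathcal H_1$, if for each $j$ there is $L_j^\star:\mathcal E\to\mathbb R$ with $\{L_j^\star>0\}\ne\varnothing$ and $t^{-1}L_j(t\boldsymbol z_t)\to L_j^\star(\boldsymbol z)$ whenever $t\to\infty$ and $\boldsymbol z_t\to\boldsymbol z$ in $\mathcal E$. $\mathcal S(u;\mathcal J)=\{\boldsymbol z\in\mathcal E:L_j(\boldsymbol z)\ge u\ \forall j\in\mathcal J\}$, $\mathcal S^\star(\mathcal J)=\{\boldsymbol z\in\mathcal E:L_j^\star(\boldsymbol z)\ge1\ \forall j\in\mathcal J\}$. $\mathfrak J$ is the collection of nonempty subsets of $[K]$ under consideration; the system is regular if $\mathcal S^\star(\mathcal J)$ has nonzero Lebesgue measure for every $\mathcal J\in\mathfrak J$. Data and thresholds: $\boldsymbol\xi_1,\dots,\boldsymbol\xi_n$ are i.i.d. from $P$, $R_i=\|\boldsymbol\xi_i\|$, $R_{(k)}$ is the $k$th largest of $R_1,\dots,R_n$. Fix $q\in(0,1)$, $k_n=\lfloor n^{1-q}\rfloor$, $t_n=R_{(k_n)}$. Fix $r\ge1$ and let $u_n$ be the $(1-n^{-r})$-quantile of $R$ under $P$. For $t>0$, $\Phi^{(t)}$ denotes the conditional law of $\boldsymbol\Phi$ given $\{R>t\}$, with density $\varphi^{(t)}$ w.r.t. $d\boldsymbol\phi$; $\Phi^{(t_n)}$ is this law at $t=t_n$. Estimation-rate assumption: $\widehat s_{t_n}>0$ and a probability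 law $\widehat\Phi^{(t_n)}$ on $\Theta_{\mathcal E}$ with density $\widehat\varphi^{(t_n)}$ w.r.t. $d\boldsymbol\phi$ are estimators built from the observations with $R_i\ge t_n$ such that, for some $m,\ell\in(0,1/2]$, $|\widehat s_{t_n}-s|=O_P(k_n^{-m})$ and $\mathsf{TV}(\Phi^{(t_n)},\widehat\Phi^{(t_n)})=O_P(k_n^{-\ell})$. Data-driven SSGEN law $\widehat P_{\rm gen}^{(t_n)}$: the (data-dependent) law which on $\{\|\boldsymbol x\|>t_n\}$ has total mass $\widehat p_{t_n}=k_n/n$ and radial–angular density (w.r.t. $dr\,d\boldsymbol\phi$) $\widehat p_{t_n}\,\widehat s_{t_n}\,t_n^{\widehat s_{t_n}}\,r^{-(\widehat s_{t_n}+1)}\,\widehat\varphi^{(t_n)}(\boldsymbol\phi)$, $r>t_n$, the remaining mass (the body) being carried by $\{\|\boldsymbol x\|\le t_n\}$ (e.g. the empirical distribution of the data there). Stressed laws: $\Pi_n=\mathsf{Law}(u_n^{-1}\boldsymbol\xi\mid\boldsymbol\xi\in\mathcal S(u_n;\mathcal J))$ with $\boldsymbol\xi\sim P$, and (conditionally on the data) $\widehat\Pi_n=\mathsf{Law}(u_n^{-1}\widehat{\boldsymbol\xi}_n\mid\widehat{\boldsymbol\xi}_n\in\mathcal S(u_n;\mathcal J))$ with $\widehat{\boldsymbol\xi}_n\sim\widehat P_{\rm gen}^{(t_n)}$ (defined arbitrarily when the conditioning event has probability zero). *)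

theory Defs
  imports "HOL-Probability.Probability"
begin

text \<open>Fixed cone \<open>E\<close> in a Euclidean space of dimension \<open>d = DIM('a)\<close>; its unit directions are
  \<open>directions E\<close>.\<close>

definition directions :: "'a::euclidean_space set \<Rightarrow> 'a set" where
  "directions E = E \<inter> sphere 0 1"

text \<open>Surface measure on the directions of \<open>E\<close>: the area of a set \<open>A\<close> of unit vectors is \<open>d\<close> times
  the volume of the truncated cone of all \<open>z\<close> with \<open>0 < norm z \<le> 1\<close> and \<open>z / norm z \<in> A\<close>.
  This is the unique measure \<open>\<sigma>\<close> for which Lebesgue measure on \<open>E\<close> is \<open>r^(d-1) dr d\<sigma>\<close>
  in polar coordinates (for \<open>d = 1\<close> it is counting measure).\<close>

definition surface_measure :: "'a::euclidean_space set \<Rightarrow> 'a measure" where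
  "surface_measure E =
     scale_measure (of_nat DIM('a))
       (distr (restrict_space lborel (E \<inter> cball 0 1 - {0}))
              (restrict_space borel (directions E)) (\<lambda>z. z /\<^sub>R norm z))"

definition density_regularly_varying ::
    "'a::euclidean_space set \<Rightarrow> ('a \<Rightarrow> real) \<Rightarrow> real \<Rightarrow> ('a \<Rightarrow> real) \<Rightarrow> bool" where
  "density_regularly_varying E f s \<phi>s \<longleftrightarrow>
     0 < s \<and>
     (\<exists>r0>0. continuous_on (E - cball 0 r0) f) \<and>
     (\<forall>z\<in>E - {0}. 0 < \<phi>s z) \<and>
     (\<forall>C. compact C \<longrightarrow> C \<subseteq> E - {0} \<longrightarrow>
        uniform_limit C (\<lambda>t z. t powr (s + real DIM('a)) * f (t *\<^sub>R z)) \<phi>s at_top)"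

text \<open>The supremum is taken in the extended reals, since \<open>Sup\<close> on \<open>real\<close> is unspecified for
  unbounded sets.\<close>

definition second_order ::
    "'a::euclidean_space set \<Rightarrow> ('a \<Rightarrow> real) \<Rightarrow> real \<Rightarrow> ('a \<Rightarrow> real) \<Rightarrow> real \<Rightarrow> bool" where
  "second_order E f s \<phi>s \<gamma> \<longleftrightarrow>
     0 < \<gamma> \<and>
     (\<exists>C. \<forall>\<^sub>F t in at_top.
        (SUP (r, \<phi>) \<in> {t<..} \<times> directions E.
           ereal \<bar>r powr (s + real DIM('a)) * f (r *\<^sub>R \<phi>) - \<phi>s \<phi>\<bar>) \<le> ereal (C * t powr (- \<gamma>)))"

text \<open>Losses are functions on \<open>E\<close>: nothing is required of their values elsewhere.\<close>

definition asymp_homogeneous ::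
    "'a::euclidean_space set \<Rightarrow> ('k \<Rightarrow> 'a \<Rightarrow> real) \<Rightarrow> ('k \<Rightarrow> 'a \<Rightarrow> real) \<Rightarrow> bool" where
  "asymp_homogeneous E L Ls \<longleftrightarrow>
     (\<forall>j. L j \<in> borel_measurable (restrict_space borel E) \<and>
          (\<exists>z\<in>E. 0 < Ls j z) \<and>
          (\<forall>z\<in>E. \<forall>\<zeta>. (\<forall>t. \<zeta> t \<in> E) \<longrightarrow> (\<zeta> \<longlongrightarrow> z) at_top \<longrightarrow>
             ((\<lambda>t. L j (t *\<^sub>R \<zeta> t) / t) \<longlongrightarrow> Ls j z) at_top))"

definition stress_set ::
    "'a set \<Rightarrow> ('k \<Rightarrow> 'a \<Rightarrow> real) \<Rightarrow> real \<Rightarrow> 'k set \<Rightarrow> 'a set" where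
  "stress_set E L u J = {z \<in> E. \<forall>j\<in>J. u \<le> L j z}"

text \<open>The limiting stress set of the limit losses \<open>Ls\<close> is \<open>stress_set E Ls 1 J\<close>.\<close>

definition regular_system ::
    "'a::euclidean_space set \<Rightarrow> ('k \<Rightarrow> 'a \<Rightarrow> real) \<Rightarrow> 'k set set \<Rightarrow> bool" where
  "regular_system E Ls JJ \<longleftrightarrow> (\<forall>J\<in>JJ. emeasure lebesgue (stress_set E Ls 1 J) \<noteq> 0)"

definition tv_dist :: "'a measure \<Rightarrow> 'a measure \<Rightarrow> real" where
  "tv_dist P Q = (SUP B\<in>sets P. \<bar>measure P B - measure Q B\<bar>)"

text \<open>\<open>X = O_P(a)\<close>, in outer probability: \<open>measure\<close> is \<open>0\<close> on non-measurable sets, so the event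
  \<open>\<bar>X n\<bar> > C * a n\<close> is covered by a measurable set of small probability. For measurable
  \<open>X n\<close> this is the usual notion.\<close>

definition big_OP :: "'w measure \<Rightarrow> (nat \<Rightarrow> 'w \<Rightarrow> real) \<Rightarrow> (nat \<Rightarrow> real) \<Rightarrow> bool" where
  "big_OP M X a \<longleftrightarrow>
     (\<forall>\<epsilon>>0. \<exists>C. \<forall>\<^sub>F n in sequentially.
        \<exists>B\<in>sets M. {\<omega> \<in> space M. \<bar>X n \<omega>\<bar> > C * a n} \<subseteq> B \<and> measure M B \<le> \<epsilon>)"

definition quantile :: "real measure \<Rightarrow> real \<Rightarrow> real" where
  "quantile N p = Inf {x. p \<le> cdf N x}"

definition kth_largest :: "nat \<Rightarrow> real list \<Rightarrow> real" where
  "kth_largest k xs = rev (sort xs) ! (k - 1)"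

definition sample :: "(nat \<Rightarrow> 'w \<Rightarrow> 'a) \<Rightarrow> nat \<Rightarrow> 'w \<Rightarrow> 'a list" where
  "sample \<xi> n \<omega> = map (\<lambda>i. \<xi> i \<omega>) [1..<Suc n]"

definition exceedances :: "real \<Rightarrow> 'a::real_normed_vector list \<Rightarrow> 'a list" where
  "exceedances t xs = filter (\<lambda>x. t \<le> norm x) xs"

text \<open>Conditional law of \<open>x / norm x\<close> given \<open>norm x > t\<close>, for \<open>x\<close> distributed as \<open>P\<close> and \<open>P\<close>
  carried by \<open>E\<close>.\<close>

definition angular_law :: "'a::euclidean_space set \<Rightarrow> 'a measure \<Rightarrow> real \<Rightarrow> 'a measure" where
  "angular_law E P t =
     distr (restrict_space (uniform_measure P {x. t < norm x}) (E - {0}))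
           (restrict_space borel (directions E)) (\<lambda>x. x /\<^sub>R norm x)"

text \<open>The Pareto-angular tail with mass \<open>p\<close>, radial index \<open>\<alpha>\<close> and angular density \<open>g\<close>, given by its
  density with respect to \<open>dr d\<sigma>\<close> on \<open>r > t\<close> and mapped back to \<open>x = r \<phi>\<close>.\<close>

definition ssgen_tail ::
    "'a::euclidean_space set \<Rightarrow> real \<Rightarrow> real \<Rightarrow> real \<Rightarrow> ('a \<Rightarrow> real) \<Rightarrow> 'a measure" where
  "ssgen_tail E t p \<alpha> g =
     distr (density (lborel \<Otimes>\<^sub>M surface_measure E)
              (\<lambda>(r, \<phi>). ennreal (p * \<alpha> * t powr \<alpha> * r powr (- (\<alpha> + 1)) * g \<phi>) * indicator {t<..} r))
           borel (\<lambda>(r, \<phi>). r *\<^sub>R \<phi>)"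

text \<open>\<open>Q\<close> has this tail beyond radius \<open>t\<close>; the body, i.e. how the remaining mass is spread over
  \<open>norm x \<le> t\<close>, is left free.\<close>

definition ssgen_law ::
    "'a::euclidean_space set \<Rightarrow> real \<Rightarrow> real \<Rightarrow> real \<Rightarrow> ('a \<Rightarrow> real) \<Rightarrow> 'a measure \<Rightarrow> bool" where
  "ssgen_law E t p \<alpha> g Q \<longleftrightarrow>
     prob_space Q \<and> sets Q = sets borel \<and>
     (\<forall>A\<in>sets borel. A \<subseteq> {x. t < norm x} \<longrightarrow> emeasure Q A = emeasure (ssgen_tail E t p \<alpha> g) A)"

text \<open>Law on \<open>E\<close> of \<open>x / u\<close> given \<open>x \<in> S\<close>, for \<open>x\<close> distributed as \<open>P\<close> and \<open>S \<subseteq> E\<close>; it is \<open>N\<close> when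
  the conditioning event is null.\<close>

definition stressed_law ::
    "'a::euclidean_space set \<Rightarrow> 'a measure \<Rightarrow> real \<Rightarrow> 'a set \<Rightarrow> 'a measure \<Rightarrow> 'a measure" where
  "stressed_law E P u S N =
     (if emeasure P S \<noteq> 0
      then distr (restrict_space (uniform_measure P S) E) (restrict_space borel E) (\<lambda>x. x /\<^sub>R u)
      else N)"

definition stress_summary ::
    "(real ^ 'k \<Rightarrow> 'b) \<Rightarrow> ('k::finite \<Rightarrow> 'a::real_vector \<Rightarrow> real) \<Rightarrow> real \<Rightarrow> 'a \<Rightarrow> 'b" where
  "stress_summary W L u z = W (\<chi> j. L j (u *\<^sub>R z) / u)"

end

theory Submission imports Defs begin

text \<open>In polar coordinates, and after scaling by \<open>u n\<close>, the second-order condition says that beyond any radius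
  proportional to \<open>u n\<close> the law \<open>P\<close> is proportional, up to a relative error of order \<open>u n powr (- \<gamma>)\<close>, to a Pareto law
  of index \<open>s\<close> times the normalised angular limit. The generative tail is exactly a Pareto law times an
  angular law, so the two differ by the error in the index plus the angular error, the latter containing
  the bias of order \<open>t n powr (- \<gamma>)\<close> of the angular law at the intermediate threshold. Conditioning on the stress set
  costs only a constant: by continuous convergence of the losses at \<open>0\<close> the stress set lies beyond a radius
  proportional to \<open>u n\<close>, and by Fatou's lemma its probability is of the order of that of the whole region.
  The threshold \<open>t n\<close> is of order at least \<open>n powr (q / s)\<close> and below every multiple of \<open>u n\<close> with
  probability tending to \<open>1\<close>, by Chernoff and Markov bounds for the number of exceedances.\<close>

subsection \<open>Polar coordinates on a closed cone\<close>

text \<open>The comparison is made at the level \<open>a = \<delta> * u n\<close>, not at the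
  threshold. Beyond \<open>a\<close> a Pareto tail is again a Pareto tail, so the generated law
  there is a constant times a probability measure; the constant, which contains the estimated mass
  \<open>k n / n\<close> and the factor \<open>(t / a) powr \<alpha>\<close>, cancels in the
  conditional law. Hence the error of the tail mass never enters, and the index error enters as
  \<open>\<bar>\<alpha> - s\<bar> / s\<close>, without the logarithm of \<open>a / t\<close> that
  extrapolating the mass would cost. The stress set changes with n and is cut further by preimages
  under an arbitrary measurable map, so every estimate is uniform over Borel sets; this is also why
  the push-forward costs nothing. The estimators are not assumed measurable in the sample point, so
  probability is confined to four exceptional events; off their union the bound is a deterministic
  inequality. Since q < 1 <= r, the bias at the stress level is of no larger order than the bias at
  the threshold.\<close>

lemma nn_integral_lborel_scaleR:
  fixes h :: "'a::euclidean_space \<Rightarrow> ennreal"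
  assumes [measurable]: "h \<in> borel_measurable borel" and c: "0 < c"
  shows "(\<integral>\<^sup>+z. h z \<partial>lborel) = ennreal (c ^ DIM('a)) * (\<integral>\<^sup>+z. h (c *\<^sub>R z) \<partial>lborel)"
proof -
  have "(\<integral>\<^sup>+z. h z \<partial>lborel)
      = (\<integral>\<^sup>+z. h z \<partial>density (distr lborel borel (\<lambda>x. 0 + c *\<^sub>R x)) (\<lambda>_. ennreal (\<bar>c\<bar> ^ DIM('a))))"
    using lborel_affine[of c "0::'a"] c by simp
  also have "\<dots> = ennreal (c ^ DIM('a)) * (\<integral>\<^sup>+z. h (c *\<^sub>R z) \<partial>lborel)"
    using c by (simp add: nn_integral_density nn_integral_distr nn_integral_cmult)
  finally show ?thesis .
qed

locale closed_cone =
  fixes E :: "'a::euclidean_space set"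
  assumes closed_E: "closed E" and cone_E: "cone E"
begin

lemma borel_cone [measurable]: "E \<in> sets borel"
  using closed_E by (rule borel_closed)

lemma borel_directions [measurable]: "directions E \<in> sets borel"
  unfolding directions_def by (intro sets.Int borel_closed closed_E closed_sphere)

lemma scale_mem_cone: "0 \<le> c \<Longrightarrow> z \<in> E \<Longrightarrow> c *\<^sub>R z \<in> E"
  using cone_E unfolding cone_def by blast

lemma scale_mem_cone_iff: "0 < c \<Longrightarrow> c *\<^sub>R z \<in> E \<longleftrightarrow> z \<in> E"
  using scale_mem_cone[of c z] scale_mem_cone[of "inverse c" "c *\<^sub>R z"] by auto

lemma direction_mem: "z \<in> E \<Longrightarrow> z \<noteq> 0 \<Longrightarrow> z /\<^sub>R norm z \<in> directions E"
  unfolding directions_def by (auto intro!: scale_mem_cone)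

lemma sets_surface_measure [measurable_cong]:
  "sets (surface_measure E) = sets (restrict_space borel (directions E))"
  by (simp add: surface_measure_def)

lemma space_surface_measure: "space (surface_measure E) = directions E"
  using sets_eq_imp_space_eq[OF sets_surface_measure] by (simp add: space_restrict_space)

lemma measurable_direction:
  assumes "A \<in> sets borel" "A \<subseteq> E - {0}"
  shows "(\<lambda>z. z /\<^sub>R norm z) \<in> measurable (restrict_space borel A) (restrict_space borel (directions E))"
  using assms by (intro measurable_restrict_space3) (auto intro: direction_mem)

lemma emeasure_surface_measure:
  assumes "B \<in> sets (restrict_space borel (directions E))"
  shows "emeasure (surface_measure E) B
    = of_nat DIM('a) * emeasure lborel {z \<in> E - {0}. norm z \<le> 1 \<and> z /\<^sub>R norm z \<in> B}"
proof -
  have m: "(\<lambda>z. z /\<^sub>R norm z) \<in> measurable (restrict_space lborel (E \<inter> cball 0 1 - {0})) (restrict_space borel (directions E))"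
    using measurable_direction[of "E \<inter> cball 0 1 - {0}"]
    by (auto simp: measurable_def sets_restrict_space space_restrict_space)
  show ?thesis
    unfolding surface_measure_def emeasure_scale_measure
    by (subst emeasure_distr[OF m assms], subst emeasure_restrict_space)
       (auto simp: space_restrict_space intro!: arg_cong[of _ _ "\<lambda>A. _ * emeasure lborel A"])
qed

lemma finite_surface_measure: "finite_measure (surface_measure E)"
proof
  have "emeasure lborel {z \<in> E - {0}. norm z \<le> 1 \<and> z /\<^sub>R norm z \<in> directions E} \<le> emeasure lborel (cball (0::'a) 1)"
    by (rule emeasure_mono) auto
  also have "\<dots> < \<infinity>"
    by (rule emeasure_bounded_finite) simp
  finally show "emeasure (surface_measure E) (space (surface_measure E)) \<noteq> \<infinity>"
    unfolding space_surface_measure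
    by (subst emeasure_surface_measure) (auto simp: ennreal_mult_eq_top_iff sets_restrict_space_iff)
qed

sublocale S: finite_measure "surface_measure E"
  by (rule finite_surface_measure)

text \<open>A sector cut off at radius b is the dilate by b of the sector cut off at radius 1, so
  Lebesgue homogeneity supplies the d-th power of b; dividing by the dimension d undoes the
  normalisation in \<open>surface_measure\<close>.\<close>

lemma emeasure_truncated_cone:
  assumes B: "B \<in> sets (restrict_space borel (directions E))" and b: "0 < b"
  shows "emeasure lborel {z \<in> E - {0}. norm z \<le> b \<and> z /\<^sub>R norm z \<in> B}
    = ennreal (b ^ DIM('a) / real DIM('a)) * emeasure (surface_measure E) B"
proof -
  have B': "B \<in> sets borel" using B by (simp add: sets_restrict_space_iff)
  let ?A = "\<lambda>b. {z \<in> E - {0}. norm z \<le> b \<and> z /\<^sub>R norm z \<in> B}"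
  have A [measurable]: "?A b \<in> sets borel" for b
    using B' by measurable
  have cancel: "inverse b * x * b = x" for x
    using b by simp
  have "emeasure lborel (?A b) = (\<integral>\<^sup>+z. indicator (?A b) z \<partial>lborel)"
    using A[of b] by (simp only: nn_integral_indicator sets_lborel)
  also have "\<dots> = ennreal (b ^ DIM('a)) * (\<integral>\<^sup>+z. indicator (?A b) (b *\<^sub>R z) \<partial>lborel)"
    by (rule nn_integral_lborel_scaleR) (use b A[of b] in \<open>auto intro!: borel_measurable_indicator simp del: mem_Collect_eq\<close>)
  also have "(\<lambda>z. indicator (?A b) (b *\<^sub>R z) :: ennreal) = indicator (?A 1)"
    using b by (auto simp: indicator_def fun_eq_iff scale_mem_cone_iff cancel)
  also have "(\<integral>\<^sup>+z. indicator (?A 1) z \<partial>lborel) = emeasure lborel (?A 1)"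
    using A[of 1] by (simp only: nn_integral_indicator sets_lborel)
  also have "ennreal (b ^ DIM('a)) * \<dots> = ennreal (b ^ DIM('a) / real DIM('a)) * emeasure (surface_measure E) B"
    unfolding emeasure_surface_measure[OF B] mult.assoc[symmetric]
    using b by (simp add: ennreal_of_nat_eq_real_of_nat ennreal_mult[symmetric])
  finally show ?thesis .
qed

section \<open>Lebesgue measure on the cone as a product of radius and direction\<close>

definition radial_measure :: "real measure" where
  "radial_measure = density lborel (\<lambda>r. ennreal (r ^ (DIM('a) - 1)) * indicator {0<..} r)"

lemma sets_radial_measure [measurable_cong]: "sets radial_measure = sets borel"
  by (simp add: radial_measure_def)

lemma emeasure_radial_measure:
  assumes "0 < b" shows "emeasure radial_measure {..b} = ennreal (b ^ DIM('a) / real DIM('a))"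
proof -
  have "emeasure radial_measure {..b} = (\<integral>\<^sup>+r. ennreal (r ^ (DIM('a) - 1)) * indicator {0<..} r * indicator {..b} r \<partial>lborel)"
    unfolding radial_measure_def by (rule emeasure_density) auto
  also have "\<dots> = (\<integral>\<^sup>+r. ennreal (r ^ (DIM('a) - 1)) * indicator {0..b} r \<partial>lborel)"
    by (rule nn_integral_cong_AE, rule AE_mp[OF AE_lborel_singleton[of 0]])
       (auto simp: indicator_def)
  also have "\<dots> = ennreal (b ^ DIM('a) / real DIM('a) - 0 ^ DIM('a) / real DIM('a))"
  proof (rule nn_integral_FTC_Icc)
    fix x :: real assume x: "x \<in> {0..b}"
    show "((\<lambda>r. r ^ DIM('a) / real DIM('a)) has_real_derivative x ^ (DIM('a) - 1)) (at x)"
      by (auto intro!: derivative_eq_intros)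
    show "0 \<le> x ^ (DIM('a) - 1)" using x by simp
  qed (use assms in auto)
  finally show ?thesis by (simp add: power_0_left)
qed

text \<open>A product of sigma-finite measures is determined by its rectangles. With the angular set
  fixed, both sides are measures of the radial set alone, and these agree once they agree on
  half-lines: there one side integrates a power of r and the other is the volume of a truncated
  sector.\<close>

lemma polar_measure:
  "radial_measure \<Otimes>\<^sub>M surface_measure E
    = distr (restrict_space lborel (E - {0})) (borel \<Otimes>\<^sub>M restrict_space borel (directions E)) (\<lambda>z. (norm z, z /\<^sub>R norm z))"
    (is "_ = distr ?R ?N ?p")
proof -
  have d: "(\<lambda>z. z /\<^sub>R norm z) \<in> measurable ?R (restrict_space borel (directions E))"
    using measurable_direction[of "E - {0}"]
    by (auto simp: measurable_def sets_restrict_space space_restrict_space)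
  have nm: "norm \<in> measurable ?R borel"
    by (auto intro!: measurable_restrict_space1)
  have pm: "?p \<in> measurable ?R ?N"
    using d nm by simp
  have rad: "emeasure (distr ?R ?N ?p) (A \<times> B) = emeasure lborel {z \<in> E - {0}. norm z \<in> A \<and> z /\<^sub>R norm z \<in> B}"
    if "A \<in> sets borel" "B \<in> sets (restrict_space borel (directions E))" for A B
    using that by (subst emeasure_distr[OF pm], simp, subst emeasure_restrict_space)
       (auto simp: space_restrict_space intro!: arg_cong[of _ _ "emeasure lborel"])
  have sf: "sigma_finite_measure radial_measure"
    unfolding radial_measure_def
    by (subst sigma_finite_measure.sigma_finite_iff_density_finite[OF sigma_finite_lborel])
       (auto simp: ennreal_mult_eq_top_iff indicator_def)
  show ?thesis
  proof (rule pair_measure_eqI)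
    show "sigma_finite_measure radial_measure" by (rule sf)
    show "sigma_finite_measure (surface_measure E)" by unfold_locales
    show "sets (radial_measure \<Otimes>\<^sub>M surface_measure E) = sets (distr ?R ?N ?p)"
      by (simp add: sets_radial_measure sets_surface_measure cong: sets_pair_measure_cong)
    fix A B assume "A \<in> sets radial_measure" and B: "B \<in> sets (surface_measure E)"
    then have A: "A \<in> sets borel" by (simp add: sets_radial_measure)
    have B': "B \<in> sets (restrict_space borel (directions E))" using B by (simp add: sets_surface_measure)
    have Bb: "B \<in> sets borel" using B' by (simp add: sets_restrict_space_iff)
    \<comment> \<open>\<open>N1\<close> and \<open>N2\<close> are the two sides of the rectangle
      identity with B frozen, as measures in the radial set.\<close>
    define N1 where "N1 = density radial_measure (\<lambda>_. emeasure (surface_measure E) B)"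
    define C where "C = {z \<in> E - {0}. z /\<^sub>R norm z \<in> B}"
    have [measurable]: "C \<in> sets borel" unfolding C_def using Bb by measurable
    define N2 where "N2 = distr (density lborel (indicator C)) borel norm"
    have N1: "emeasure N1 X = emeasure radial_measure X * emeasure (surface_measure E) B" if "X \<in> sets borel" for X
      unfolding N1_def using that
      by (subst emeasure_density_const) (auto simp: sets_radial_measure mult.commute)
    have N2: "emeasure N2 X = emeasure lborel {z \<in> E - {0}. norm z \<in> X \<and> z /\<^sub>R norm z \<in> B}" if [measurable]: "X \<in> sets borel" for X
    proof -
      have "emeasure N2 X = emeasure lborel (C \<inter> norm -` X)"
        unfolding N2_def
        by (subst emeasure_distr, simp, simp, subst emeasure_restricted) (auto simp: measurable_sets_borel[OF borel_measurable_norm])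
      also have "C \<inter> norm -` X = {z \<in> E - {0}. norm z \<in> X \<and> z /\<^sub>R norm z \<in> B}"
        by (auto simp: C_def)
      finally show ?thesis .
    qed
    have "N1 = N2"
    proof (rule measure_eqI_generator_eq[where E="range atMost" and \<Omega>=UNIV and A="\<lambda>i. {..real i}"])
      show "Int_stable (range (atMost :: real \<Rightarrow> _))"
        by (auto simp: Int_stable_def)
      show "emeasure N1 X = emeasure N2 X" if X: "X \<in> range atMost" for X
      proof -
        from X obtain b where X: "X = {..b}" by auto
        show ?thesis
        proof (cases "0 < b")
          case True
          then show ?thesis
            unfolding X using emeasure_truncated_cone[OF B' True]
            by (simp add: N1 N2 emeasure_radial_measure)
        next
          case False
          have "emeasure radial_measure {..b} = 0"
            unfolding radial_measure_def using False
            by (subst emeasure_density) (auto intro!: nn_integral_zero' simp: indicator_def)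
          moreover have "{z \<in> E - {0}. norm z \<in> {..b} \<and> z /\<^sub>R norm z \<in> B} = {}"
            using False by (auto simp: not_less) (smt (verit) norm_le_zero_iff)
          ultimately show ?thesis unfolding X by (subst N1, simp, subst N2) (simp_all only: mult_zero_left emeasure_empty, simp)
        qed
      qed
      show "sets N1 = sigma_sets UNIV (range atMost)" "sets N2 = sigma_sets UNIV (range atMost)"
        by (simp_all add: N1_def N2_def sets_radial_measure borel_eq_atMost)
      show "(\<Union>i. {..real i}) = UNIV"
        using real_arch_simple by auto
      show "emeasure N1 {..real i} \<noteq> \<infinity>" for i
      proof -
        \<comment> \<open>\<open>emeasure_radial_measure\<close> needs a positive radius, so the
          case i = 0 is reached by enlarging to i + 1.\<close>
        have "emeasure N1 {..real i} \<le> emeasure N1 {..real i + 1}"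
          by (rule emeasure_mono) (auto simp: N1_def sets_radial_measure)
        also have "\<dots> < \<infinity>"
          using S.emeasure_finite[of B]
          by (auto simp: N1 emeasure_radial_measure ennreal_mult_less_top less_top[symmetric] ennreal_mult_eq_top_iff)
        finally show ?thesis by simp
      qed
    qed auto
    then have "emeasure N1 A = emeasure N2 A" by simp
    then show "emeasure radial_measure A * emeasure (surface_measure E) B = emeasure (distr ?R ?N ?p) (A \<times> B)"
      using rad[OF A B'] N1[OF A] N2[OF A] by simp
  qed
qed

lemma measurable_polar_map [measurable]:
  "(\<lambda>(r, \<phi>). r *\<^sub>R \<phi>) \<in> borel_measurable (borel \<Otimes>\<^sub>M restrict_space borel (directions E))"
proof -
  have "(\<lambda>\<phi>. \<phi>) \<in> borel_measurable (restrict_space borel (directions E))"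
    by (rule measurable_restrict_space1) simp
  then show ?thesis by measurable
qed

lemma nn_integral_polar:
  assumes [measurable]: "h \<in> borel_measurable borel"
  shows "(\<integral>\<^sup>+z. h z * indicator (E - {0}) z \<partial>lborel)
    = (\<integral>\<^sup>+(r, \<phi>). ennreal (r ^ (DIM('a) - 1)) * indicator {0<..} r * h (r *\<^sub>R \<phi>) \<partial>(lborel \<Otimes>\<^sub>M surface_measure E))"
proof -
  let ?R = "restrict_space lborel (E - {0})"
  have d: "(\<lambda>z. z /\<^sub>R norm z) \<in> measurable ?R (restrict_space borel (directions E))"
    using measurable_direction[of "E - {0}"]
    by (auto simp: measurable_def sets_restrict_space space_restrict_space)
  have nm: "norm \<in> measurable ?R borel"
    by (auto intro!: measurable_restrict_space1)
  have [measurable]: "(\<lambda>(r, \<phi>). r *\<^sub>R \<phi>) \<in> borel_measurable (lborel \<Otimes>\<^sub>M surface_measure E)"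
    using measurable_polar_map by (simp add: sets_surface_measure cong: measurable_cong_sets sets_pair_measure_cong)
  have "(\<integral>\<^sup>+z. h z * indicator (E - {0}) z \<partial>lborel) = (\<integral>\<^sup>+z. h z \<partial>?R)"
    by (subst nn_integral_restrict_space) auto
  also have "\<dots> = (\<integral>\<^sup>+z. h (norm z *\<^sub>R (z /\<^sub>R norm z)) \<partial>?R)"
    by (rule nn_integral_cong) (auto simp: space_restrict_space)
  also have "\<dots> = (\<integral>\<^sup>+(r, \<phi>). h (r *\<^sub>R \<phi>) \<partial>distr ?R (borel \<Otimes>\<^sub>M restrict_space borel (directions E)) (\<lambda>z. (norm z, z /\<^sub>R norm z)))"
    using d nm by (subst nn_integral_distr) (auto simp: case_prod_unfold)
  also have "\<dots> = (\<integral>\<^sup>+(r, \<phi>). h (r *\<^sub>R \<phi>) \<partial>(radial_measure \<Otimes>\<^sub>M surface_measure E))"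
    by (simp add: polar_measure)
  \<comment> \<open>The factor 1 is a density for the angular measure, inserted because
    \<open>pair_measure_density\<close> expects a density on both factors.\<close>
  also have "radial_measure \<Otimes>\<^sub>M surface_measure E
     = density (lborel \<Otimes>\<^sub>M surface_measure E) (\<lambda>(r, \<phi>). ennreal (r ^ (DIM('a) - 1)) * indicator {0<..} r * 1)"
    unfolding radial_measure_def
    apply (subst density_1[of "surface_measure E", symmetric])
    apply (subst pair_measure_density)
    using density_1[of "surface_measure E"] by (auto simp: S.sigma_finite_measure_axioms sigma_finite_lborel)
  also have "(\<integral>\<^sup>+(r, \<phi>). h (r *\<^sub>R \<phi>) \<partial>\<dots>)
     = (\<integral>\<^sup>+(r, \<phi>). ennreal (r ^ (DIM('a) - 1)) * indicator {0<..} r * h (r *\<^sub>R \<phi>) \<partial>(lborel \<Otimes>\<^sub>M surface_measure E))"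
    by (subst nn_integral_density) (auto simp: case_prod_unfold)
  finally show ?thesis .
qed

end

subsection \<open>Pareto-angular tails\<close>

lemma nn_integral_Pareto:
  fixes a \<alpha> :: real
  assumes "0 < a" "0 < \<alpha>"
  shows "(\<integral>\<^sup>+r. ennreal (\<alpha> * a powr \<alpha> * r powr (- (\<alpha> + 1))) * indicator {a<..} r \<partial>lborel) = 1"
proof -
  have "(\<integral>\<^sup>+r. ennreal (\<alpha> * a powr \<alpha> * r powr (- (\<alpha> + 1))) * indicator {a<..} r \<partial>lborel)
      = (\<integral>\<^sup>+r. ennreal (\<alpha> * a powr \<alpha> * r powr (- (\<alpha> + 1))) * indicator {a..} r \<partial>lborel)"
    by (rule nn_integral_cong_AE, rule AE_mp[OF AE_lborel_singleton[of a]])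
       (auto simp: indicator_def)
  also have "\<dots> = ennreal (0 - (- (a powr \<alpha> * a powr (- \<alpha>))))"
  proof (rule nn_integral_FTC_atLeast[where F="\<lambda>r. - (a powr \<alpha> * r powr (- \<alpha>))"])
    fix x :: real assume x: "a \<le> x"
    then show "((\<lambda>r. - (a powr \<alpha> * r powr (- \<alpha>))) has_real_derivative \<alpha> * a powr \<alpha> * x powr (- (\<alpha> + 1))) (at x)"
      using assms by (auto intro!: derivative_eq_intros)
    show "0 \<le> \<alpha> * a powr \<alpha> * x powr (- (\<alpha> + 1))"
      using assms by simp
  next
    have "((\<lambda>r. r powr (- \<alpha>)) \<longlongrightarrow> 0) at_top"
      using assms by (intro tendsto_neg_powr filterlim_ident) auto
    from tendsto_minus[OF tendsto_mult[OF tendsto_const[of "a powr \<alpha>"] this]]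
    show "((\<lambda>r. - (a powr \<alpha> * r powr (- \<alpha>))) \<longlongrightarrow> 0) at_top"
      by simp
  qed simp
  also have "a powr \<alpha> * a powr (- \<alpha>) = 1"
    using assms by (simp add: powr_minus field_simps)
  finally show ?thesis by simp
qed

text \<open>Beyond the common starting radius \<open>a / r\<close> is below 1, so its power with the
  larger exponent is the smaller one; only the prefactors \<alpha> and \<beta> work against
  domination.\<close>

lemma Pareto_density_mono:
  fixes a \<alpha> \<beta> r :: real
  assumes "0 < a" "a < r" "0 < \<alpha>" "\<alpha> \<le> \<beta>"
  shows "(\<alpha> / \<beta>) * (\<beta> * a powr \<beta> * r powr (- (\<beta> + 1))) \<le> \<alpha> * a powr \<alpha> * r powr (- (\<alpha> + 1))"
proof -
  have "(a / r) powr \<beta> \<le> (a / r) powr \<alpha>"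
    using assms by (intro powr_mono') auto
  then have "\<alpha> * ((a / r) powr \<beta> / r) \<le> \<alpha> * ((a / r) powr \<alpha> / r)"
    using assms by (intro mult_left_mono divide_right_mono) auto
  moreover have e: "r powr (- (x + 1)) = 1 / (r powr x * r)" for x
    unfolding powr_minus using assms by (simp add: powr_add field_simps)
  ultimately show ?thesis
    unfolding e using assms by (simp add: powr_divide field_simps)
qed

context closed_cone
begin

lemma measurable_polar_surface [measurable]:
  "(\<lambda>(r, \<phi>). r *\<^sub>R \<phi>) \<in> borel_measurable (lborel \<Otimes>\<^sub>M surface_measure E)"
  using measurable_polar_map
  by (simp add: sets_surface_measure cong: measurable_cong_sets sets_pair_measure_cong)

lemma ray_section_sets [measurable]:
  assumes "A \<in> sets borel"
  shows "{\<phi> \<in> directions E. r *\<^sub>R \<phi> \<in> A} \<in> sets (surface_measure E)"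
proof -
  have "(\<lambda>\<phi>. r *\<^sub>R \<phi>) \<in> borel_measurable (restrict_space borel (directions E))"
    by (rule measurable_restrict_space1) simp
  from measurable_sets[OF this assms] show ?thesis
    by (simp add: sets_surface_measure space_restrict_space vimage_def Int_def conj_commute)
qed

text \<open>The radial weight and the angular measure of the section along radius r are separated.
  Changes of the index then act on the weight alone and changes of the angular law on the sections
  alone. The form in \<open>emeasure\<close> also serves densities g that are not normalised, such
  as \<open>\<phi>s\<close>.\<close>

lemma emeasure_ssgen_tail:
  assumes A [measurable]: "A \<in> sets borel"
    and g: "g \<in> borel_measurable (restrict_space borel (directions E))"
    and "0 \<le> p" "0 \<le> \<alpha>"
  shows "emeasure (ssgen_tail E t p \<alpha> g) A
    = (\<integral>\<^sup>+r. ennreal (p * \<alpha> * t powr \<alpha> * r powr (- (\<alpha> + 1))) * indicator {t<..} r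
        * emeasure (density (surface_measure E) (\<lambda>\<phi>. ennreal (g \<phi>))) {\<phi> \<in> directions E. r *\<^sub>R \<phi> \<in> A} \<partial>lborel)"
proof -
  have [measurable]: "g \<in> borel_measurable (surface_measure E)"
    using g by (simp add: sets_surface_measure cong: measurable_cong_sets)
  have [measurable]: "(\<lambda>p. fst p *\<^sub>R snd p) \<in> borel_measurable (lborel \<Otimes>\<^sub>M surface_measure E)"
    using measurable_polar_surface by (simp add: case_prod_unfold)
  let ?h = "\<lambda>r. ennreal (p * \<alpha> * t powr \<alpha> * r powr (- (\<alpha> + 1))) * indicator {t<..} r"
  let ?N = "lborel \<Otimes>\<^sub>M surface_measure E"
  let ?w = "\<lambda>x. ennreal (p * \<alpha> * t powr \<alpha> * fst x powr (- (\<alpha> + 1)) * g (snd x)) * indicator {t<..} (fst x)"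
  let ?B = "(\<lambda>x. fst x *\<^sub>R snd x) -` A \<inter> space ?N"
  have [measurable]: "?B \<in> sets ?N" by measurable
  have "emeasure (ssgen_tail E t p \<alpha> g) A = emeasure (density ?N ?w) ?B"
    unfolding ssgen_tail_def case_prod_unfold by (subst emeasure_distr) simp_all
  also have "\<dots> = (\<integral>\<^sup>+x. ?w x * indicator ?B x \<partial>?N)"
    by (rule emeasure_density) measurable
  also have "\<dots> = (\<integral>\<^sup>+x. ?w x * indicator A (fst x *\<^sub>R snd x) \<partial>?N)"
    by (rule nn_integral_cong) (simp add: indicator_def)
  also have "\<dots> = (\<integral>\<^sup>+r. \<integral>\<^sup>+\<phi>. ennreal (p * \<alpha> * t powr \<alpha> * r powr (- (\<alpha> + 1)) * g \<phi>) * indicator {t<..} r * indicator A (r *\<^sub>R \<phi>) \<partial>surface_measure E \<partial>lborel)"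
    by (subst S.nn_integral_fst[symmetric]) auto
  also have "\<dots> = (\<integral>\<^sup>+r. ?h r * emeasure (density (surface_measure E) (\<lambda>\<phi>. ennreal (g \<phi>))) {\<phi> \<in> directions E. r *\<^sub>R \<phi> \<in> A} \<partial>lborel)"
  proof (rule nn_integral_cong)
    fix r :: real
    have "(\<integral>\<^sup>+\<phi>. ennreal (p * \<alpha> * t powr \<alpha> * r powr (- (\<alpha> + 1)) * g \<phi>) * indicator {t<..} r * indicator A (r *\<^sub>R \<phi>) \<partial>surface_measure E)
       = (\<integral>\<^sup>+\<phi>. ?h r * (ennreal (g \<phi>) * indicator {\<phi> \<in> directions E. r *\<^sub>R \<phi> \<in> A} \<phi>) \<partial>surface_measure E)"
      using assms by (intro nn_integral_cong)
        (auto simp: ennreal_mult' space_surface_measure split: split_indicator)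
    also have "\<dots> = ?h r * (\<integral>\<^sup>+\<phi>. ennreal (g \<phi>) * indicator {\<phi> \<in> directions E. r *\<^sub>R \<phi> \<in> A} \<phi> \<partial>surface_measure E)"
      by (rule nn_integral_cmult) measurable
    also have "(\<integral>\<^sup>+\<phi>. ennreal (g \<phi>) * indicator {\<phi> \<in> directions E. r *\<^sub>R \<phi> \<in> A} \<phi> \<partial>surface_measure E)
       = emeasure (density (surface_measure E) (\<lambda>\<phi>. ennreal (g \<phi>))) {\<phi> \<in> directions E. r *\<^sub>R \<phi> \<in> A}"
      by (subst emeasure_density) auto
    finally show "(\<integral>\<^sup>+\<phi>. ennreal (p * \<alpha> * t powr \<alpha> * r powr (- (\<alpha> + 1)) * g \<phi>) * indicator {t<..} r * indicator A (r *\<^sub>R \<phi>) \<partial>surface_measure E)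
      = ?h r * emeasure (density (surface_measure E) (\<lambda>\<phi>. ennreal (g \<phi>))) {\<phi> \<in> directions E. r *\<^sub>R \<phi> \<in> A}" .
  qed
  finally show ?thesis .
qed

lemma measurable_ray_section_emeasure:
  assumes A [measurable]: "A \<in> sets borel"
    and g: "g \<in> borel_measurable (restrict_space borel (directions E))"
  shows "(\<lambda>r. emeasure (density (surface_measure E) (\<lambda>\<phi>. ennreal (g \<phi>))) {\<phi> \<in> directions E. r *\<^sub>R \<phi> \<in> A}) \<in> borel_measurable borel"
proof -
  have [measurable]: "g \<in> borel_measurable (surface_measure E)"
    using g by (simp add: sets_surface_measure cong: measurable_cong_sets)
  have [measurable]: "(\<lambda>p. fst p *\<^sub>R snd p) \<in> borel_measurable (borel \<Otimes>\<^sub>M surface_measure E)"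
    using measurable_polar_surface by (simp add: case_prod_unfold cong: measurable_cong_sets sets_pair_measure_cong)
  have "(\<lambda>r. \<integral>\<^sup>+\<phi>. ennreal (g \<phi>) * indicator A (r *\<^sub>R \<phi>) \<partial>surface_measure E) \<in> borel_measurable borel"
    by (rule S.borel_measurable_nn_integral) (simp add: case_prod_unfold)
  also have "(\<lambda>r. \<integral>\<^sup>+\<phi>. ennreal (g \<phi>) * indicator A (r *\<^sub>R \<phi>) \<partial>surface_measure E)
    = (\<lambda>r. emeasure (density (surface_measure E) (\<lambda>\<phi>. ennreal (g \<phi>))) {\<phi> \<in> directions E. r *\<^sub>R \<phi> \<in> A})"
    by (subst emeasure_density)
       (auto simp: space_surface_measure split: split_indicator intro!: ext nn_integral_cong)
  finally show ?thesis .
qed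

lemma sets_ssgen_tail [simp]: "sets (ssgen_tail E t p \<alpha> g) = sets borel"
  by (simp add: ssgen_tail_def)

lemma prob_space_ssgen_tail:
  assumes "g \<in> borel_measurable (restrict_space borel (directions E))"
    and "prob_space (density (surface_measure E) (\<lambda>\<phi>. ennreal (g \<phi>)))" "0 < \<alpha>" "0 < a"
  shows "prob_space (ssgen_tail E a 1 \<alpha> g)"
proof
  interpret G: prob_space "density (surface_measure E) (\<lambda>\<phi>. ennreal (g \<phi>))" by fact
  have 1: "emeasure (density (surface_measure E) (\<lambda>\<phi>. ennreal (g \<phi>))) (directions E) = 1"
    using G.emeasure_space_1 by (simp add: space_surface_measure)
  show "emeasure (ssgen_tail E a 1 \<alpha> g) (space (ssgen_tail E a 1 \<alpha> g)) = 1"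
    using assms emeasure_ssgen_tail[OF _ assms(1), of UNIV 1 \<alpha> a] nn_integral_Pareto[of a \<alpha>]
    by (simp add: sets_eq_imp_space_eq[OF sets_ssgen_tail] 1)
qed

text \<open>Self-similarity of the Pareto law: restricted beyond \<open>a\<close>, the tail started
  at t is the tail started at \<open>a\<close> times the mass
  \<open>p * (t / a) powr \<alpha>\<close> that it has left there. A conditional law does not see
  this factor.\<close>

lemma ssgen_tail_rescale:
  assumes A: "A \<in> sets borel" "A \<subseteq> {x. a < norm x}"
    and g: "g \<in> borel_measurable (restrict_space borel (directions E))"
    and "0 \<le> p" "0 \<le> \<alpha>" "0 < t" "t \<le> a"
  shows "emeasure (ssgen_tail E t p \<alpha> g) A = ennreal (p * (t / a) powr \<alpha>) * emeasure (ssgen_tail E a 1 \<alpha> g) A"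
proof -
  let ?m = "\<lambda>r. emeasure (density (surface_measure E) (\<lambda>\<phi>. ennreal (g \<phi>))) {\<phi> \<in> directions E. r *\<^sub>R \<phi> \<in> A}"
  \<comment> \<open>Radii between t and \<open>a\<close> do carry weight for the tail started at t,
    but their rays miss A.\<close>
  have empty: "{\<phi> \<in> directions E. r *\<^sub>R \<phi> \<in> A} = {}" if "t < r" "r \<le> a" for r
  proof -
    have "norm (r *\<^sub>R \<phi>) = r" if "\<phi> \<in> directions E" for \<phi>
      using that \<open>t < r\<close> \<open>0 < t\<close> by (simp add: directions_def)
    then show ?thesis using A(2) that by fastforce
  qed
  have coef: "p * \<alpha> * t powr \<alpha> * x = p * (t / a) powr \<alpha> * (\<alpha> * a powr \<alpha> * x)" for x
    using assms by (simp add: powr_divide)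
  have [measurable]: "?m \<in> borel_measurable borel"
    by (rule measurable_ray_section_emeasure[OF A(1) g])
  have "emeasure (ssgen_tail E t p \<alpha> g) A
    = (\<integral>\<^sup>+r. ennreal (p * (t / a) powr \<alpha>) * (ennreal (1 * \<alpha> * a powr \<alpha> * r powr (- (\<alpha> + 1))) * indicator {a<..} r * ?m r) \<partial>lborel)"
    unfolding emeasure_ssgen_tail[OF A(1) g assms(4,5)]
  proof (rule nn_integral_cong)
    fix r :: real
    consider "r \<le> t" | "t < r" "r \<le> a" | "a < r" by linarith
    then show "ennreal (p * \<alpha> * t powr \<alpha> * r powr (- (\<alpha> + 1))) * indicator {t<..} r * ?m r
      = ennreal (p * (t / a) powr \<alpha>) * (ennreal (1 * \<alpha> * a powr \<alpha> * r powr (- (\<alpha> + 1))) * indicator {a<..} r * ?m r)"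
    proof cases
      case 3
      then show ?thesis
        using assms unfolding coef by (simp add: ennreal_mult' mult.assoc)
    next
      case 2
      show ?thesis by (simp add: empty[OF 2])
    qed (use assms in auto)
  qed
  also have "\<dots> = ennreal (p * (t / a) powr \<alpha>) * emeasure (ssgen_tail E a 1 \<alpha> g) A"
    unfolding emeasure_ssgen_tail[OF A(1) g zero_le_one assms(5)]
    by (rule nn_integral_cmult) measurable
  finally show ?thesis .
qed

text \<open>Domination of the densities, integrated. A lower bound by a fraction of another
  probability measure is all that \<open>measure_diff_le_domination\<close> needs, so no difference
  of densities is ever integrated.\<close>

lemma ssgen_tail_index_mono:
  assumes A: "A \<in> sets borel"
    and g: "g \<in> borel_measurable (restrict_space borel (directions E))"
    and "0 < \<alpha>" "\<alpha> \<le> \<beta>" "0 < a"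
  shows "ennreal (\<alpha> / \<beta>) * emeasure (ssgen_tail E a 1 \<beta> g) A \<le> emeasure (ssgen_tail E a 1 \<alpha> g) A"
proof -
  let ?m = "\<lambda>r. emeasure (density (surface_measure E) (\<lambda>\<phi>. ennreal (g \<phi>))) {\<phi> \<in> directions E. r *\<^sub>R \<phi> \<in> A}"
  have [measurable]: "?m \<in> borel_measurable borel"
    by (rule measurable_ray_section_emeasure[OF A g])
  have a0: "0 \<le> \<alpha>" and b0: "0 \<le> \<beta>" using assms by auto
  have "ennreal (\<alpha> / \<beta>) * emeasure (ssgen_tail E a 1 \<beta> g) A
    = (\<integral>\<^sup>+r. ennreal (\<alpha> / \<beta>) * (ennreal (1 * \<beta> * a powr \<beta> * r powr (- (\<beta> + 1))) * indicator {a<..} r * ?m r) \<partial>lborel)"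
    unfolding emeasure_ssgen_tail[OF A g zero_le_one b0]
    by (rule nn_integral_cmult[symmetric]) measurable
  also have "\<dots> \<le> (\<integral>\<^sup>+r. ennreal (1 * \<alpha> * a powr \<alpha> * r powr (- (\<alpha> + 1))) * indicator {a<..} r * ?m r \<partial>lborel)"
  proof (rule nn_integral_mono)
    fix r :: real
    have "ennreal (\<alpha> / \<beta>) * ennreal (1 * \<beta> * a powr \<beta> * r powr (- (\<beta> + 1))) \<le> ennreal (1 * \<alpha> * a powr \<alpha> * r powr (- (\<alpha> + 1)))" if "a < r"
      using Pareto_density_mono[of a r \<alpha> \<beta>] that assms
      by (subst ennreal_mult'[symmetric]) (auto intro!: ennreal_leI)
    then show "ennreal (\<alpha> / \<beta>) * (ennreal (1 * \<beta> * a powr \<beta> * r powr (- (\<beta> + 1))) * indicator {a<..} r * ?m r)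
      \<le> ennreal (1 * \<alpha> * a powr \<alpha> * r powr (- (\<alpha> + 1))) * indicator {a<..} r * ?m r"
      by (auto simp: mult.assoc[symmetric] split: split_indicator intro!: mult_right_mono)
  qed
  also have "\<dots> = emeasure (ssgen_tail E a 1 \<alpha> g) A"
    by (rule emeasure_ssgen_tail[OF A g zero_le_one a0, symmetric])
  finally show ?thesis .
qed

end

text \<open>If \<open>P\<close> dominates the fraction \<open>\<theta>\<close> of \<open>Q\<close>, complements bound the difference from the other side.\<close>
lemma measure_diff_le_domination:
  assumes "prob_space P" "prob_space Q" "sets P = sets Q" "0 \<le> \<theta>"
    and dom: "\<And>A. A \<in> sets Q \<Longrightarrow> ennreal \<theta> * emeasure Q A \<le> emeasure P A"
    and A: "A \<in> sets Q"
  shows "\<bar>measure P A - measure Q A\<bar> \<le> 1 - \<theta>"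
proof -
  interpret P: prob_space P by fact
  interpret Q: prob_space Q by fact
  have sp: "space P = space Q" using assms(3) by (rule sets_eq_imp_space_eq)
  have le: "\<theta> * measure Q B \<le> measure P B" if "B \<in> sets Q" for B
    using dom[OF that] \<open>0 \<le> \<theta>\<close>
    by (simp add: P.emeasure_eq_measure Q.emeasure_eq_measure ennreal_mult'[symmetric])
  have \<theta>: "\<theta> \<le> 1"
    using le[OF sets.top] P.prob_space by (simp add: Q.prob_space sp)
  have "\<theta> * measure Q (space Q - A) \<le> measure P (space P - A)"
    using le[of "space Q - A"] A by (simp add: sp)
  then have "\<theta> * (1 - measure Q A) \<le> 1 - measure P A"
    using A assms(3) by (simp add: P.prob_compl Q.prob_compl)
  moreover have "(1 - \<theta>) * measure Q A \<le> (1 - \<theta>) * 1" "(1 - \<theta>) * (1 - measure Q A) \<le> (1 - \<theta>) * 1"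
    using \<theta> by (intro mult_left_mono; simp)+
  ultimately show ?thesis
    using le[OF A] by (simp add: algebra_simps abs_le_iff)
qed

lemma tv_dist_ge:
  assumes "prob_space P" "prob_space Q" "B \<in> sets P"
  shows "\<bar>measure P B - measure Q B\<bar> \<le> tv_dist P Q"
  unfolding tv_dist_def
proof (rule cSUP_upper[OF assms(3)])
  show "bdd_above ((\<lambda>B. \<bar>measure P B - measure Q B\<bar>) ` sets P)"
  proof (rule bdd_aboveI2)
    fix B
    show "\<bar>measure P B - measure Q B\<bar> \<le> 1"
      using prob_space.prob_le_1[OF assms(1), of B] prob_space.prob_le_1[OF assms(2), of B]
        measure_nonneg[of P B] measure_nonneg[of Q B] by linarith
  qed
qed

lemma tv_dist_le:
  assumes "\<And>B. B \<in> sets P \<Longrightarrow> \<bar>measure P B - measure Q B\<bar> \<le> e"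
  shows "tv_dist P Q \<le> e"
  unfolding tv_dist_def by (rule cSUP_least) (use assms in auto)

lemma tv_dist_nonneg:
  assumes "prob_space P" "prob_space Q"
  shows "0 \<le> tv_dist P Q"
  using tv_dist_ge[OF assms sets.empty_sets] by simp

section \<open>Effect of errors in the index and in the angular law\<close>

context closed_cone
begin

text \<open>The tail with the smaller index dominates the fraction (smaller index / larger index) of
  the other one. The bound is free of \<open>a\<close>, so nothing is lost as the stress level
  grows.\<close>

lemma ssgen_tail_index_diff:
  assumes A: "A \<in> sets borel"
    and g: "g \<in> borel_measurable (restrict_space borel (directions E))"
      "prob_space (density (surface_measure E) (\<lambda>\<phi>. ennreal (g \<phi>)))"
    and pos: "0 < \<alpha>" "0 < \<beta>" "0 < a"
  shows "\<bar>measure (ssgen_tail E a 1 \<alpha> g) A - measure (ssgen_tail E a 1 \<beta> g) A\<bar> \<le> \<bar>\<alpha> - \<beta>\<bar> / \<beta>"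
proof -
  have pr: "prob_space (ssgen_tail E a 1 x g)" if "0 < x" for x
    using prob_space_ssgen_tail[OF g that pos(3)] .
  have *: "\<bar>measure (ssgen_tail E a 1 x g) A - measure (ssgen_tail E a 1 y g) A\<bar> \<le> 1 - x / y" if "0 < x" "x \<le> y" for x y
    using that A pos ssgen_tail_index_mono[OF _ g(1) that pos(3)]
    by (intro measure_diff_le_domination pr) (auto simp: sets_ssgen_tail)
  show ?thesis
  proof (cases "\<alpha> \<le> \<beta>")
    case True
    then have "1 - \<alpha> / \<beta> = \<bar>\<alpha> - \<beta>\<bar> / \<beta>"
      using pos by (simp add: diff_divide_distrib)
    then show ?thesis using *[of \<alpha> \<beta>] pos True by linarith
  next
    case False
    \<comment> \<open>The denominator is moved to \<beta>, which will be the true index s, whereas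
      \<alpha> will be the random estimate.\<close>
    then have "(\<alpha> - \<beta>) / \<alpha> \<le> (\<alpha> - \<beta>) / \<beta>"
      using pos by (intro divide_left_mono) auto
    then have "1 - \<beta> / \<alpha> \<le> (\<alpha> - \<beta>) / \<beta>"
      using pos by (simp add: diff_divide_distrib)
    moreover have "\<bar>\<alpha> - \<beta>\<bar> = \<alpha> - \<beta>" using False by simp
    ultimately show ?thesis using *[of \<beta> \<alpha>] pos False by linarith
  qed
qed

text \<open>The radial weight is a probability density, so an angular error averages to itself. The
  section changes with r, hence the bound e has to hold for all angular sets at once.\<close>

lemma ssgen_tail_angle_le:
  assumes A: "A \<in> sets borel"
    and g: "g \<in> borel_measurable (restrict_space borel (directions E))"
      "prob_space (density (surface_measure E) (\<lambda>\<phi>. ennreal (g \<phi>)))"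
    and h: "h \<in> borel_measurable (restrict_space borel (directions E))"
      "prob_space (density (surface_measure E) (\<lambda>\<phi>. ennreal (h \<phi>)))"
    and pos: "0 < \<alpha>" "0 < a"
    and e: "\<And>B. B \<in> sets (surface_measure E) \<Longrightarrow>
        measure (density (surface_measure E) (\<lambda>\<phi>. ennreal (g \<phi>))) B \<le> measure (density (surface_measure E) (\<lambda>\<phi>. ennreal (h \<phi>))) B + e"
  shows "measure (ssgen_tail E a 1 \<alpha> g) A \<le> measure (ssgen_tail E a 1 \<alpha> h) A + e"
proof -
  interpret G: prob_space "density (surface_measure E) (\<lambda>\<phi>. ennreal (g \<phi>))" by fact
  interpret H: prob_space "density (surface_measure E) (\<lambda>\<phi>. ennreal (h \<phi>))" by fact
  interpret g: prob_space "ssgen_tail E a 1 \<alpha> g" by (rule prob_space_ssgen_tail) fact+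
  interpret h: prob_space "ssgen_tail E a 1 \<alpha> h" by (rule prob_space_ssgen_tail) fact+
  have e0: "0 \<le> e" using e[of "{}"] by simp
  let ?m = "\<lambda>g r. emeasure (density (surface_measure E) (\<lambda>\<phi>. ennreal (g \<phi>))) {\<phi> \<in> directions E. r *\<^sub>R \<phi> \<in> A}"
  let ?p = "\<lambda>r. ennreal (1 * \<alpha> * a powr \<alpha> * r powr (- (\<alpha> + 1))) * indicator {a<..} r"
  have [measurable]: "?m g \<in> borel_measurable borel" "?m h \<in> borel_measurable borel"
    using g(1) h(1) by (auto intro!: measurable_ray_section_emeasure[OF A])
  have "emeasure (ssgen_tail E a 1 \<alpha> g) A = (\<integral>\<^sup>+r. ?p r * ?m g r \<partial>lborel)"
    using pos by (intro emeasure_ssgen_tail A g) auto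
  also have "\<dots> \<le> (\<integral>\<^sup>+r. ?p r * ?m h r + ?p r * ennreal e \<partial>lborel)"
  proof (rule nn_integral_mono)
    fix r :: real
    have "?m g r \<le> ?m h r + ennreal e"
      using e[OF ray_section_sets[OF A]] e0
      by (simp add: G.emeasure_eq_measure H.emeasure_eq_measure flip: ennreal_plus)
    then show "?p r * ?m g r \<le> ?p r * ?m h r + ?p r * ennreal e"
      unfolding distrib_left[symmetric] by (rule mult_left_mono) simp
  qed
  also have "\<dots> = (\<integral>\<^sup>+r. ?p r * ?m h r \<partial>lborel) + (\<integral>\<^sup>+r. ?p r * ennreal e \<partial>lborel)"
    by (rule nn_integral_add) measurable
  also have "(\<integral>\<^sup>+r. ?p r * ?m h r \<partial>lborel) = emeasure (ssgen_tail E a 1 \<alpha> h) A"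
    using pos by (intro emeasure_ssgen_tail[symmetric] A h) auto
  also have "(\<integral>\<^sup>+r. ?p r * ennreal e \<partial>lborel) = ennreal e"
    using nn_integral_Pareto[OF pos(2,1)] by (subst nn_integral_multc) auto
  finally show ?thesis
    using e0 by (simp add: g.emeasure_eq_measure h.emeasure_eq_measure flip: ennreal_plus)
qed

lemma ssgen_tail_angle_diff:
  assumes A: "A \<in> sets borel"
    and g: "g \<in> borel_measurable (restrict_space borel (directions E))"
      "prob_space (density (surface_measure E) (\<lambda>\<phi>. ennreal (g \<phi>)))"
    and h: "h \<in> borel_measurable (restrict_space borel (directions E))"
      "prob_space (density (surface_measure E) (\<lambda>\<phi>. ennreal (h \<phi>)))"
    and pos: "0 < \<alpha>" "0 < a"
    and e: "\<And>B. B \<in> sets (surface_measure E) \<Longrightarrow>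
        \<bar>measure (density (surface_measure E) (\<lambda>\<phi>. ennreal (g \<phi>))) B - measure (density (surface_measure E) (\<lambda>\<phi>. ennreal (h \<phi>))) B\<bar> \<le> e"
  shows "\<bar>measure (ssgen_tail E a 1 \<alpha> g) A - measure (ssgen_tail E a 1 \<alpha> h) A\<bar> \<le> e"
proof -
  let ?d = "\<lambda>g B. measure (density (surface_measure E) (\<lambda>\<phi>. ennreal (g \<phi>))) B"
  have "?d g B \<le> ?d h B + e" "?d h B \<le> ?d g B + e" if "B \<in> sets (surface_measure E)" for B
    using e[OF that] by linarith+
  then have "measure (ssgen_tail E a 1 \<alpha> g) A \<le> measure (ssgen_tail E a 1 \<alpha> h) A + e"
    "measure (ssgen_tail E a 1 \<alpha> h) A \<le> measure (ssgen_tail E a 1 \<alpha> g) A + e"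
    using ssgen_tail_angle_le[OF A g h pos] ssgen_tail_angle_le[OF A h g pos] by blast+
  then show ?thesis by (simp add: abs_le_iff)
qed

end

subsection \<open>Second-order regular variation\<close>

locale second_order_tail = closed_cone E
  for E :: "'a::euclidean_space set" +
  fixes f \<phi>s :: "'a \<Rightarrow> real" and P :: "'a measure" and s \<gamma> :: real
  assumes f_measurable [measurable]: "f \<in> borel_measurable borel"
    and f_nonneg: "\<And>z. 0 \<le> f z"
    and f_outside: "\<And>z. z \<notin> E \<Longrightarrow> f z = 0"
    and P_density: "P = density lborel (\<lambda>z. ennreal (f z))"
    and prob_P: "prob_space P"
    and RV: "density_regularly_varying E f s \<phi>s"
    and second_order: "second_order E f s \<phi>s \<gamma>"
begin

sublocale P: prob_space P by (rule prob_P)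

lemma sets_P [simp, measurable_cong]: "sets P = sets borel"
  by (simp add: P_density)

lemma space_P [simp]: "space P = UNIV"
  by (simp add: P_density)

lemma s_pos: "0 < s" and \<phi>s_pos: "\<And>z. z \<in> E \<Longrightarrow> z \<noteq> 0 \<Longrightarrow> 0 < \<phi>s z"
  using RV by (auto simp: density_regularly_varying_def)

lemma \<gamma>_pos: "0 < \<gamma>"
  using second_order by (auto simp: second_order_def)

lemma \<phi>s_directions_pos: "\<phi> \<in> directions E \<Longrightarrow> 0 < \<phi>s \<phi>"
  by (auto simp: directions_def intro!: \<phi>s_pos)

lemma scaled_density_tendsto:
  assumes "z \<in> E" "z \<noteq> 0"
  shows "((\<lambda>t. t powr (s + real DIM('a)) * f (t *\<^sub>R z)) \<longlongrightarrow> \<phi>s z) at_top"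
proof -
  have "uniform_limit {z} (\<lambda>t z. t powr (s + real DIM('a)) * f (t *\<^sub>R z)) \<phi>s at_top"
    using RV[unfolded density_regularly_varying_def, THEN conjunct2, THEN conjunct2, THEN conjunct2, rule_format, of "{z}"]
      assms by simp
  then show ?thesis by (rule tendsto_uniform_limitI) simp
qed

text \<open>Regular variation as defined does not mention measurability of the limit; it is
  inherited from f as a pointwise limit along integer scales.\<close>

lemma \<phi>s_measurable: "\<phi>s \<in> borel_measurable (restrict_space borel (directions E))"
proof (rule borel_measurable_LIMSEQ_real)
  fix i :: nat
  have "(\<lambda>\<phi>. real i *\<^sub>R \<phi>) \<in> borel_measurable (restrict_space borel (directions E))"
    by (rule measurable_restrict_space1) simp
  then show "(\<lambda>\<phi>. real i powr (s + real DIM('a)) * f (real i *\<^sub>R \<phi>)) \<in> borel_measurable (restrict_space borel (directions E))"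
    by measurable
next
  fix \<phi> assume "\<phi> \<in> space (restrict_space borel (directions E))"
  then have "\<phi> \<in> E" "\<phi> \<noteq> 0" by (auto simp: space_restrict_space directions_def)
  from filterlim_compose[OF scaled_density_tendsto[OF this] filterlim_real_sequentially]
  show "(\<lambda>i. real i powr (s + real DIM('a)) * f (real i *\<^sub>R \<phi>)) \<longlonglongrightarrow> \<phi>s \<phi>" .
qed

lemma \<phi>s_measurable' [measurable]: "\<phi>s \<in> borel_measurable (surface_measure E)"
  using \<phi>s_measurable by (simp add: sets_surface_measure cong: measurable_cong_sets)

lemma second_order_bound:
  obtains T C where "0 < T" "0 \<le> C"
    "\<And>a r \<phi>. T \<le> a \<Longrightarrow> a < r \<Longrightarrow> \<phi> \<in> directions E \<Longrightarrow> \<bar>r powr (s + real DIM('a)) * f (r *\<^sub>R \<phi>) - \<phi>s \<phi>\<bar> \<le> C * a powr (- \<gamma>)"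
proof -
  obtain C where "\<forall>\<^sub>F t in at_top. (SUP (r, \<phi>) \<in> {t<..} \<times> directions E. ereal \<bar>r powr (s + real DIM('a)) * f (r *\<^sub>R \<phi>) - \<phi>s \<phi>\<bar>) \<le> ereal (C * t powr (- \<gamma>))"
    using second_order by (auto simp: second_order_def)
  then obtain T where T: "\<And>t. T \<le> t \<Longrightarrow> (SUP (r, \<phi>) \<in> {t<..} \<times> directions E. ereal \<bar>r powr (s + real DIM('a)) * f (r *\<^sub>R \<phi>) - \<phi>s \<phi>\<bar>) \<le> ereal (C * t powr (- \<gamma>))"
    by (auto simp: eventually_at_top_linorder)
  show ?thesis
  \<comment> \<open>The eventual bound may start at a nonpositive level and may come with a negative
    constant; the maxima repair both.\<close>
  proof (rule that[of "max T 1" "max C 0"])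
    fix a r :: real and \<phi>
    assume a: "max T 1 \<le> a" "a < r" "\<phi> \<in> directions E"
    have "ereal \<bar>r powr (s + real DIM('a)) * f (r *\<^sub>R \<phi>) - \<phi>s \<phi>\<bar> \<le> (SUP (r, \<phi>) \<in> {a<..} \<times> directions E. ereal \<bar>r powr (s + real DIM('a)) * f (r *\<^sub>R \<phi>) - \<phi>s \<phi>\<bar>)"
      by (rule SUP_upper2[of "(r, \<phi>)"]) (use a in auto)
    also have "\<dots> \<le> ereal (C * a powr (- \<gamma>))" using T a by simp
    also have "\<dots> \<le> ereal (max C 0 * a powr (- \<gamma>))" by (simp add: mult_right_mono)
    finally show "\<bar>r powr (s + real DIM('a)) * f (r *\<^sub>R \<phi>) - \<phi>s \<phi>\<bar> \<le> max C 0 * a powr (- \<gamma>)" by simp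
  qed auto
qed

text \<open>The radial Jacobian times f is split into \<open>r powr (- (s + 1))\<close> and
  \<open>r powr (s + d) * f\<close>, with d the dimension. With the prefactor
  \<open>s * a powr s\<close> the first factor is the Pareto density from \<open>a\<close>; the
  second is the quantity that the second-order condition compares with \<open>\<phi>s\<close>. The
  \<open>1 *\<close> matches the shape of a tail with mass 1.\<close>

lemma emeasure_P_polar:
  assumes A [measurable]: "A \<in> sets borel" and "A \<subseteq> {x. a < norm x}" "0 < a"
  shows "ennreal (s * a powr s) * emeasure P A
    = (\<integral>\<^sup>+r. ennreal (1 * s * a powr s * r powr (- (s + 1))) * indicator {a<..} r
        * (\<integral>\<^sup>+\<phi>. ennreal (r powr (s + real DIM('a)) * f (r *\<^sub>R \<phi>)) * indicator {\<phi> \<in> directions E. r *\<^sub>R \<phi> \<in> A} \<phi> \<partial>surface_measure E) \<partial>lborel)"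
proof -
  let ?S = "\<lambda>r. {\<phi> \<in> directions E. r *\<^sub>R \<phi> \<in> A}"
  let ?N = "lborel \<Otimes>\<^sub>M surface_measure E"
  have m [measurable]: "(\<lambda>x. fst x *\<^sub>R snd x) \<in> borel_measurable ?N"
    using measurable_polar_surface by (simp add: case_prod_unfold)
  have nrm: "norm (r *\<^sub>R \<phi>) = r" if "\<phi> \<in> directions E" "0 < r" for r \<phi>
    using that by (simp add: directions_def)
  have "0 \<notin> A" using assms by auto
  then have "emeasure P A = (\<integral>\<^sup>+z. (ennreal (f z) * indicator A z) * indicator (E - {0}) z \<partial>lborel)"
    unfolding P_density using assms f_outside
    by (subst emeasure_density) (auto intro!: nn_integral_cong simp: indicator_def)
  also have "\<dots> = (\<integral>\<^sup>+(r, \<phi>). ennreal (r ^ (DIM('a) - 1)) * indicator {0<..} r * (ennreal (f (r *\<^sub>R \<phi>)) * indicator A (r *\<^sub>R \<phi>)) \<partial>?N)"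
    by (rule nn_integral_polar) measurable
  finally have eq: "emeasure P A = \<dots>" .
  have "ennreal (s * a powr s) * emeasure P A
    = (\<integral>\<^sup>+x. ennreal (s * a powr s) * (ennreal (fst x ^ (DIM('a) - 1)) * indicator {0<..} (fst x) * (ennreal (f (fst x *\<^sub>R snd x)) * indicator A (fst x *\<^sub>R snd x))) \<partial>?N)"
    unfolding eq case_prod_unfold by (rule nn_integral_cmult[symmetric]) measurable
  also have "\<dots> = (\<integral>\<^sup>+r. \<integral>\<^sup>+\<phi>. ennreal (s * a powr s) * (ennreal (r ^ (DIM('a) - 1)) * indicator {0<..} r * (ennreal (f (r *\<^sub>R \<phi>)) * indicator A (r *\<^sub>R \<phi>))) \<partial>surface_measure E \<partial>lborel)"
    using S.nn_integral_fst[of "\<lambda>x. ennreal (s * a powr s) * (ennreal (fst x ^ (DIM('a) - 1)) * indicator {0<..} (fst x) * (ennreal (f (fst x *\<^sub>R snd x)) * indicator A (fst x *\<^sub>R snd x)))" lborel]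
    by simp
  also have "\<dots> = (\<integral>\<^sup>+r. ennreal (1 * s * a powr s * r powr (- (s + 1))) * indicator {a<..} r
        * (\<integral>\<^sup>+\<phi>. ennreal (r powr (s + real DIM('a)) * f (r *\<^sub>R \<phi>)) * indicator (?S r) \<phi> \<partial>surface_measure E) \<partial>lborel)"
  proof (rule nn_integral_cong)
    fix r :: real
    have [measurable]: "(\<lambda>\<phi>. r *\<^sub>R \<phi>) \<in> borel_measurable (surface_measure E)"
      using measurable_Pair2[OF m, of r] by simp
    show "(\<integral>\<^sup>+\<phi>. ennreal (s * a powr s) * (ennreal (r ^ (DIM('a) - 1)) * indicator {0<..} r * (ennreal (f (r *\<^sub>R \<phi>)) * indicator A (r *\<^sub>R \<phi>))) \<partial>surface_measure E)
      = ennreal (1 * s * a powr s * r powr (- (s + 1))) * indicator {a<..} r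
        * (\<integral>\<^sup>+\<phi>. ennreal (r powr (s + real DIM('a)) * f (r *\<^sub>R \<phi>)) * indicator (?S r) \<phi> \<partial>surface_measure E)"
    proof (cases "a < r")
      case True
      then have r: "0 < r" using assms by simp
      have pw: "r powr (- (s + 1)) * r powr (s + real DIM('a)) = r ^ (DIM('a) - 1)"
        using r by (simp add: powr_add[symmetric] powr_realpow[symmetric] of_nat_diff DIM_positive Suc_leI)
      have "ennreal (s * a powr s) * (ennreal (r ^ (DIM('a) - 1)) * indicator {0<..} r * (ennreal (f (r *\<^sub>R \<phi>)) * indicator A (r *\<^sub>R \<phi>)))
        = ennreal (1 * s * a powr s * r powr (- (s + 1))) * (ennreal (r powr (s + real DIM('a)) * f (r *\<^sub>R \<phi>)) * indicator (?S r) \<phi>)"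
        if "\<phi> \<in> directions E" for \<phi>
      proof (cases "r *\<^sub>R \<phi> \<in> A")
        case True
        have "ennreal (s * a powr s) * (ennreal (r ^ (DIM('a) - 1)) * ennreal (f (r *\<^sub>R \<phi>)))
          = ennreal (s * a powr s * (r ^ (DIM('a) - 1) * f (r *\<^sub>R \<phi>)))"
          using s_pos assms r f_nonneg by (simp add: ennreal_mult)
        also have "\<dots> = ennreal (1 * s * a powr s * r powr (- (s + 1)) * (r powr (s + real DIM('a)) * f (r *\<^sub>R \<phi>)))"
          unfolding pw[symmetric] by (simp add: mult_ac)
        also have "\<dots> = ennreal (1 * s * a powr s * r powr (- (s + 1))) * ennreal (r powr (s + real DIM('a)) * f (r *\<^sub>R \<phi>))"
          using s_pos f_nonneg by (subst ennreal_mult) auto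
        finally show ?thesis using True r that by simp
      qed simp
      then have "(\<integral>\<^sup>+\<phi>. ennreal (s * a powr s) * (ennreal (r ^ (DIM('a) - 1)) * indicator {0<..} r * (ennreal (f (r *\<^sub>R \<phi>)) * indicator A (r *\<^sub>R \<phi>))) \<partial>surface_measure E)
        = (\<integral>\<^sup>+\<phi>. ennreal (1 * s * a powr s * r powr (- (s + 1))) * (ennreal (r powr (s + real DIM('a)) * f (r *\<^sub>R \<phi>)) * indicator (?S r) \<phi>) \<partial>surface_measure E)"
        by (intro nn_integral_cong) (simp only: space_surface_measure)
      also have "\<dots> = ennreal (1 * s * a powr s * r powr (- (s + 1))) * (\<integral>\<^sup>+\<phi>. ennreal (r powr (s + real DIM('a)) * f (r *\<^sub>R \<phi>)) * indicator (?S r) \<phi> \<partial>surface_measure E)"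
        by (rule nn_integral_cmult) (use ray_section_sets[OF A, of r] in measurable)
      finally show ?thesis using True by simp
    next
      case False
      have "indicator {0<..} r * (ennreal (f (r *\<^sub>R \<phi>)) * indicator A (r *\<^sub>R \<phi>)) = (0::ennreal)" if "\<phi> \<in> directions E" for \<phi>
        using False nrm[OF that, of r] assms(2) by (auto simp: indicator_def)
      then have "(\<integral>\<^sup>+\<phi>. ennreal (s * a powr s) * (ennreal (r ^ (DIM('a) - 1)) * indicator {0<..} r * (ennreal (f (r *\<^sub>R \<phi>)) * indicator A (r *\<^sub>R \<phi>))) \<partial>surface_measure E) = 0"
        by (intro nn_integral_zero' AE_I2) (simp only: space_surface_measure mult.assoc mult_zero_right)
      then show ?thesis using False by simp
    qed
  qed
  finally show ?thesis .
qed

text \<open>An error e in the angular integrand costs at most e times the total surface, and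
  averaging over the Pareto weight leaves that unchanged. The two directions are stated in
  \<open>ennreal\<close> with the unnormalised \<open>\<phi>s\<close>, because finiteness of the
  angular integral of \<open>\<phi>s\<close> is itself deduced from the second one.\<close>

lemma
  assumes A [measurable]: "A \<in> sets borel" and A_far: "A \<subseteq> {x. a < norm x}" and a: "0 < a"
    and dev: "\<And>r \<phi>. a < r \<Longrightarrow> \<phi> \<in> directions E \<Longrightarrow> \<bar>r powr (s + real DIM('a)) * f (r *\<^sub>R \<phi>) - \<phi>s \<phi>\<bar> \<le> e"
    and e: "0 \<le> e"
  shows P_le_limit_tail: "ennreal (s * a powr s) * emeasure P A
      \<le> emeasure (ssgen_tail E a 1 s \<phi>s) A + ennreal e * emeasure (surface_measure E) (directions E)" (is ?thesis1)
    and limit_tail_le_P: "emeasure (ssgen_tail E a 1 s \<phi>s) A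
      \<le> ennreal (s * a powr s) * emeasure P A + ennreal e * emeasure (surface_measure E) (directions E)" (is ?thesis2)
proof -
  let ?S = "\<lambda>r. {\<phi> \<in> directions E. r *\<^sub>R \<phi> \<in> A}"
  let ?p = "\<lambda>r. ennreal (1 * s * a powr s * r powr (- (s + 1))) * indicator {a<..} r"
  let ?F = "\<lambda>r. \<integral>\<^sup>+\<phi>. ennreal (r powr (s + real DIM('a)) * f (r *\<^sub>R \<phi>)) * indicator (?S r) \<phi> \<partial>surface_measure E"
  let ?L = "\<lambda>r. \<integral>\<^sup>+\<phi>. ennreal (\<phi>s \<phi>) * indicator (?S r) \<phi> \<partial>surface_measure E"
  let ?c = "ennreal e * emeasure (surface_measure E) (directions E)"
  have m [measurable]: "(\<lambda>x. fst x *\<^sub>R snd x) \<in> borel_measurable (lborel \<Otimes>\<^sub>M surface_measure E)"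
    using measurable_polar_surface by (simp add: case_prod_unfold)
  have [measurable]: "(\<lambda>\<phi>. r *\<^sub>R \<phi>) \<in> borel_measurable (surface_measure E)" for r
    using measurable_Pair2[OF m, of r] by simp
  have L: "?L r = emeasure (density (surface_measure E) (\<lambda>\<phi>. ennreal (\<phi>s \<phi>))) (?S r)" for r
    using ray_section_sets[OF A, of r] by (subst emeasure_density) auto
  have mL [measurable]: "?L \<in> borel_measurable borel"
    unfolding L by (rule measurable_ray_section_emeasure[OF A \<phi>s_measurable])
  have "(\<lambda>r. \<integral>\<^sup>+\<phi>. ennreal (r powr (s + real DIM('a)) * f (r *\<^sub>R \<phi>)) * indicator A (r *\<^sub>R \<phi>) \<partial>surface_measure E) \<in> borel_measurable borel"
    using m by (intro S.borel_measurable_nn_integral) (simp add: case_prod_unfold cong: measurable_cong_sets sets_pair_measure_cong)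
  also have "(\<lambda>r. \<integral>\<^sup>+\<phi>. ennreal (r powr (s + real DIM('a)) * f (r *\<^sub>R \<phi>)) * indicator A (r *\<^sub>R \<phi>) \<partial>surface_measure E) = ?F"
    by (intro ext nn_integral_cong) (auto simp: space_surface_measure indicator_def)
  finally have mF [measurable]: "?F \<in> borel_measurable borel" .
  have Pp: "ennreal (s * a powr s) * emeasure P A = (\<integral>\<^sup>+r. ?p r * ?F r \<partial>lborel)"
    by (rule emeasure_P_polar[OF A A_far a])
  have Xp: "emeasure (ssgen_tail E a 1 s \<phi>s) A = (\<integral>\<^sup>+r. ?p r * ?L r \<partial>lborel)"
    using s_pos unfolding L by (intro emeasure_ssgen_tail[OF A \<phi>s_measurable]) auto
  have c: "(\<integral>\<^sup>+\<phi>. ennreal e \<partial>surface_measure E) = ?c"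
    by (simp add: space_surface_measure)
  have int_c: "(\<integral>\<^sup>+r. ?p r * ?c \<partial>lborel) = ?c"
    using nn_integral_Pareto[OF a s_pos] by (subst nn_integral_multc) auto
  \<comment> \<open>One one-sided comparison serves twice, with the scaled density and its limit
    exchanging roles.\<close>
  have mono: "(\<integral>\<^sup>+\<phi>. ennreal (g \<phi>) * indicator (?S r) \<phi> \<partial>surface_measure E) \<le> (\<integral>\<^sup>+\<phi>. ennreal (h \<phi>) * indicator (?S r) \<phi> \<partial>surface_measure E) + ?c"
    if gh: "\<And>\<phi>. \<phi> \<in> directions E \<Longrightarrow> 0 \<le> h \<phi> \<and> g \<phi> \<le> h \<phi> + e"
      and [measurable]: "h \<in> borel_measurable (surface_measure E)" for g h r
  proof -
    have [measurable]: "?S r \<in> sets (surface_measure E)" by (rule ray_section_sets[OF A])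
    have "(\<integral>\<^sup>+\<phi>. ennreal (g \<phi>) * indicator (?S r) \<phi> \<partial>surface_measure E)
        \<le> (\<integral>\<^sup>+\<phi>. ennreal (h \<phi>) * indicator (?S r) \<phi> + ennreal e \<partial>surface_measure E)"
      using gh e by (intro nn_integral_mono)
        (auto simp: space_surface_measure indicator_def simp flip: ennreal_plus intro!: ennreal_leI)
    also have "\<dots> = (\<integral>\<^sup>+\<phi>. ennreal (h \<phi>) * indicator (?S r) \<phi> \<partial>surface_measure E) + ?c"
      unfolding c[symmetric] by (rule nn_integral_add) measurable
    finally show ?thesis .
  qed
  have FL: "?F r \<le> ?L r + ?c" and LF: "?L r \<le> ?F r + ?c" if "a < r" for r
  proof -
    show "?F r \<le> ?L r + ?c"
      using dev[OF that] \<phi>s_directions_pos by (intro mono) (fastforce simp: abs_le_iff)+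
    show "?L r \<le> ?F r + ?c"
      using dev[OF that] f_nonneg by (intro mono) (fastforce simp: abs_le_iff)+
  qed
  have comp: "(\<integral>\<^sup>+r. ?p r * U r \<partial>lborel) \<le> (\<integral>\<^sup>+r. ?p r * V r \<partial>lborel) + ?c"
    if [measurable]: "V \<in> borel_measurable borel" and UV: "\<And>r. a < r \<Longrightarrow> U r \<le> V r + ?c" for U V :: "real \<Rightarrow> ennreal"
  proof -
    have "(\<integral>\<^sup>+r. ?p r * U r \<partial>lborel) \<le> (\<integral>\<^sup>+r. ?p r * V r + ?p r * ?c \<partial>lborel)"
      unfolding distrib_left[symmetric]
      by (intro nn_integral_mono) (auto split: split_indicator intro!: mult_left_mono UV)
    also have "\<dots> = (\<integral>\<^sup>+r. ?p r * V r \<partial>lborel) + (\<integral>\<^sup>+r. ?p r * ?c \<partial>lborel)"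
      by (rule nn_integral_add) measurable
    finally show ?thesis unfolding int_c .
  qed
  show ?thesis1 unfolding Pp Xp by (rule comp[OF mL FL])
  show ?thesis2 unfolding Pp Xp by (rule comp[OF mF LF])
qed

text \<open>In polar coordinates a null set of directions would make the cone null, yet P has a
  density carried by the cone and total mass 1.\<close>

lemma emeasure_surface_pos: "emeasure (surface_measure E) (directions E) \<noteq> 0"
proof
  assume 0: "emeasure (surface_measure E) (directions E) = 0"
  have [measurable]: "(\<lambda>x. fst x *\<^sub>R snd x) \<in> borel_measurable (lborel \<Otimes>\<^sub>M surface_measure E)"
    using measurable_polar_surface by (simp add: case_prod_unfold)
  have z: "(\<integral>\<^sup>+\<phi>. h \<phi> \<partial>surface_measure E) = 0" for h
  proof -
    have "AE \<phi> in surface_measure E. False"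
      by (rule AE_I[of _ _ "directions E"]) (auto simp: space_surface_measure 0 sets_surface_measure sets_restrict_space_iff)
    then have "AE \<phi> in surface_measure E. h \<phi> = 0" by eventually_elim simp
    then show ?thesis by (simp add: nn_integral_cong_AE[of h "\<lambda>_. 0"])
  qed
  \<comment> \<open>The origin, which has no direction, may be removed because it is a Lebesgue null
    set.\<close>
  have "emeasure P UNIV = (\<integral>\<^sup>+z. ennreal (f z) * indicator (E - {0}) z \<partial>lborel)"
    unfolding P_density
    by (subst emeasure_density, simp, simp, rule nn_integral_cong_AE, rule AE_mp[OF AE_lborel_singleton[of 0]])
       (use f_outside in \<open>auto simp: indicator_def\<close>)
  also have "\<dots> = 0"
    by (subst nn_integral_polar, simp, unfold case_prod_unfold, subst S.nn_integral_fst[symmetric]) (auto simp: z)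
  finally show False using P.emeasure_space_1 by simp
qed

section \<open>The limiting angular law and the normalised tail estimate\<close>

definition angular_mass :: real where
  "angular_mass = enn2real (\<integral>\<^sup>+\<phi>. ennreal (\<phi>s \<phi>) \<partial>surface_measure E)"

definition limit_angle :: "'a \<Rightarrow> real" where
  "limit_angle \<phi> = \<phi>s \<phi> / angular_mass"

text \<open>Every ray section of a sector beyond \<open>a\<close> is the same angular set B, so the
  radial integral factors out as 1. This is the bridge from estimates for tails to estimates for
  angular laws.\<close>

lemma emeasure_ssgen_tail_far:
  assumes "0 < a" "0 < \<alpha>" "g \<in> borel_measurable (restrict_space borel (directions E))"
    and B: "B \<in> sets (restrict_space borel (directions E))"
  shows "emeasure (ssgen_tail E a 1 \<alpha> g) {x \<in> E - {0}. a < norm x \<and> x /\<^sub>R norm x \<in> B} = emeasure (density (surface_measure E) (\<lambda>\<phi>. ennreal (g \<phi>))) B"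
proof -
  have B': "B \<in> sets borel" "B \<subseteq> directions E" using B by (simp_all add: sets_restrict_space_iff)
  let ?A = "{x \<in> E - {0}. a < norm x \<and> x /\<^sub>R norm x \<in> B}"
  let ?G = "density (surface_measure E) (\<lambda>\<phi>. ennreal (g \<phi>))"
  have A: "?A \<in> sets borel" using B' by measurable
  have sec: "{\<phi> \<in> directions E. r *\<^sub>R \<phi> \<in> ?A} = B" if "a < r" for r
    using that B' \<open>0 < a\<close> by (auto simp: directions_def scale_mem_cone_iff)
  have "emeasure (ssgen_tail E a 1 \<alpha> g) ?A
    = (\<integral>\<^sup>+r. ennreal (1 * \<alpha> * a powr \<alpha> * r powr (- (\<alpha> + 1))) * indicator {a<..} r * emeasure (density (surface_measure E) (\<lambda>\<phi>. ennreal (g \<phi>))) B \<partial>lborel)"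
    unfolding emeasure_ssgen_tail[OF A assms(3) zero_le_one less_imp_le[OF assms(2)]]
  proof (rule nn_integral_cong)
    fix r :: real
    show "ennreal (1 * \<alpha> * a powr \<alpha> * r powr (- (\<alpha> + 1))) * indicator {a<..} r * emeasure ?G {\<phi> \<in> directions E. r *\<^sub>R \<phi> \<in> ?A}
      = ennreal (1 * \<alpha> * a powr \<alpha> * r powr (- (\<alpha> + 1))) * indicator {a<..} r * emeasure ?G B"
    proof (cases "a < r")
      case True
      show ?thesis by (simp only: sec[OF True])
    qed simp
  qed
  also have "\<dots> = emeasure (density (surface_measure E) (\<lambda>\<phi>. ennreal (g \<phi>))) B"
    using nn_integral_Pareto[OF assms(1,2)] by (subst nn_integral_multc) auto
  finally show ?thesis .
qed

text \<open>Finite, since the tail built from \<open>\<phi>s\<close> is at most a multiple of P plus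
  a multiple of the finite surface measure. Positive, since \<open>\<phi>s\<close> is positive on
  the directions and these are not a null set.\<close>

lemma nn_integral_\<phi>s: "(\<integral>\<^sup>+\<phi>. ennreal (\<phi>s \<phi>) \<partial>surface_measure E) = ennreal angular_mass" (is ?thesis1)
  and angular_mass_pos: "0 < angular_mass" (is ?thesis2)
proof -
  have D: "directions E \<in> sets (restrict_space borel (directions E))"
    by (simp add: sets_restrict_space_iff)
  obtain T C where TC: "0 < T" "0 \<le> C"
    "\<And>a r \<phi>. T \<le> a \<Longrightarrow> a < r \<Longrightarrow> \<phi> \<in> directions E \<Longrightarrow> \<bar>r powr (s + real DIM('a)) * f (r *\<^sub>R \<phi>) - \<phi>s \<phi>\<bar> \<le> C * a powr (- \<gamma>)"
    by (rule second_order_bound) (rule that)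
  let ?A = "{x \<in> E - {0}. T < norm x \<and> x /\<^sub>R norm x \<in> directions E}"
  have A: "?A \<in> sets borel" by measurable
  have "(\<integral>\<^sup>+\<phi>. ennreal (\<phi>s \<phi>) \<partial>surface_measure E) = emeasure (density (surface_measure E) (\<lambda>\<phi>. ennreal (\<phi>s \<phi>))) (space (surface_measure E))"
    by (subst emeasure_density) (auto intro!: nn_integral_cong)
  also have "\<dots> = emeasure (ssgen_tail E T 1 s \<phi>s) ?A"
    using emeasure_ssgen_tail_far[OF TC(1) s_pos \<phi>s_measurable D] by (simp add: space_surface_measure)
  also have "\<dots> \<le> ennreal (s * T powr s) * emeasure P ?A + ennreal (C * T powr (- \<gamma>)) * emeasure (surface_measure E) (directions E)"
    using TC by (intro limit_tail_le_P A) auto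
  also have "\<dots> < \<infinity>"
    using S.emeasure_finite[of "directions E"] P.emeasure_finite[of ?A]
    by (simp add: less_top[symmetric] ennreal_mult_eq_top_iff)
  finally have fin: "(\<integral>\<^sup>+\<phi>. ennreal (\<phi>s \<phi>) \<partial>surface_measure E) < top" by simp
  then show ?thesis1 by (simp add: angular_mass_def)
  have "(\<integral>\<^sup>+\<phi>. ennreal (\<phi>s \<phi>) \<partial>surface_measure E) \<noteq> 0"
  proof
    assume "(\<integral>\<^sup>+\<phi>. ennreal (\<phi>s \<phi>) \<partial>surface_measure E) = 0"
    then have "AE \<phi> in surface_measure E. ennreal (\<phi>s \<phi>) = 0"
      by (subst (asm) nn_integral_0_iff_AE) auto
    then have "AE \<phi> in surface_measure E. False"
      by (rule AE_mp) (use \<phi>s_directions_pos in \<open>auto simp: space_surface_measure ennreal_eq_0_iff not_le\<close>)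
    then show False using emeasure_surface_pos by (simp add: AE_iff_measurable[OF sets.top] space_surface_measure)
  qed
  then show ?thesis2
    using fin unfolding angular_mass_def by (simp add: enn2real_positive_iff zero_less_iff_neq_zero)
qed

lemma limit_angle_measurable: "limit_angle \<in> borel_measurable (restrict_space borel (directions E))"
  unfolding limit_angle_def using \<phi>s_measurable by measurable

lemma limit_angle_measurable' [measurable]: "limit_angle \<in> borel_measurable (surface_measure E)"
  unfolding limit_angle_def by measurable

lemma density_\<phi>s:
  "A \<in> sets (surface_measure E) \<Longrightarrow> emeasure (density (surface_measure E) (\<lambda>\<phi>. ennreal (\<phi>s \<phi>))) A
    = ennreal angular_mass * emeasure (density (surface_measure E) (\<lambda>\<phi>. ennreal (limit_angle \<phi>))) A"
  using angular_mass_pos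
  by (simp add: emeasure_density nn_integral_cmult[symmetric] mult.assoc[symmetric] ennreal_mult'[symmetric] limit_angle_def)

lemma prob_space_limit_angle: "prob_space (density (surface_measure E) (\<lambda>\<phi>. ennreal (limit_angle \<phi>)))"
proof
  have "emeasure (density (surface_measure E) (\<lambda>\<phi>. ennreal (\<phi>s \<phi>))) (space (surface_measure E)) = (\<integral>\<^sup>+\<phi>. ennreal (\<phi>s \<phi>) \<partial>surface_measure E)"
    by (subst emeasure_density) (auto intro!: nn_integral_cong)
  then have "ennreal angular_mass * emeasure (density (surface_measure E) (\<lambda>\<phi>. ennreal (limit_angle \<phi>))) (space (surface_measure E)) = ennreal angular_mass * 1"
    unfolding density_\<phi>s[OF sets.top] nn_integral_\<phi>s by simp
  then show "emeasure (density (surface_measure E) (\<lambda>\<phi>. ennreal (limit_angle \<phi>))) (space (density (surface_measure E) (\<lambda>\<phi>. ennreal (limit_angle \<phi>)))) = 1"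
    using angular_mass_pos by (subst (asm) ennreal_mult_cancel_left) auto
qed

lemma limit_tail_\<phi>s:
  assumes "A \<in> sets borel"
  shows "emeasure (ssgen_tail E a 1 s \<phi>s) A = ennreal angular_mass * emeasure (ssgen_tail E a 1 s limit_angle) A"
  using s_pos measurable_ray_section_emeasure[OF assms limit_angle_measurable]
  by (simp add: emeasure_ssgen_tail[OF assms \<phi>s_measurable] emeasure_ssgen_tail[OF assms limit_angle_measurable]
       density_\<phi>s[OF ray_section_sets[OF assms]] nn_integral_cmult[symmetric] mult_ac)

text \<open>The two one-sided estimates, divided by \<open>angular_mass\<close> so that the
  comparison measure becomes a probability. One constant serves all levels \<open>a\<close> and all
  Borel sets; every later use of the rate \<gamma> goes through this estimate.\<close>

lemma tail_approx:
  obtains T C where "0 < T" "0 \<le> C"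
    "\<And>a (A :: 'a set). T \<le> a \<Longrightarrow> A \<in> sets borel \<Longrightarrow> A \<subseteq> {x. a < norm x} \<Longrightarrow>
      \<bar>s * a powr s / angular_mass * measure P A - measure (ssgen_tail E a 1 s limit_angle) A\<bar> \<le> C * a powr (- \<gamma>)"
proof -
  obtain T C where TC: "0 < T" "0 \<le> C"
    "\<And>a r \<phi>. T \<le> a \<Longrightarrow> a < r \<Longrightarrow> \<phi> \<in> directions E \<Longrightarrow> \<bar>r powr (s + real DIM('a)) * f (r *\<^sub>R \<phi>) - \<phi>s \<phi>\<bar> \<le> C * a powr (- \<gamma>)"
    by (rule second_order_bound) (rule that)
  define \<sigma> where "\<sigma> = measure (surface_measure E) (directions E)"
  show ?thesis
  proof (rule that[of T "C * \<sigma> / angular_mass"])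
    show "0 \<le> C * \<sigma> / angular_mass" using TC angular_mass_pos by (simp add: \<sigma>_def)
    fix a and A :: "'a set" assume a: "T \<le> a" and A: "A \<in> sets borel" "A \<subseteq> {x. a < norm x}"
    define e where "e = C * a powr (- \<gamma>)"
    have e: "0 \<le> e" using TC by (simp add: e_def)
    have a0: "0 < a" using a TC by simp
    interpret X: prob_space "ssgen_tail E a 1 s limit_angle"
      by (rule prob_space_ssgen_tail[OF limit_angle_measurable prob_space_limit_angle s_pos a0])
    have dev: "\<bar>r powr (s + real DIM('a)) * f (r *\<^sub>R \<phi>) - \<phi>s \<phi>\<bar> \<le> e" if "a < r" "\<phi> \<in> directions E" for r \<phi>
      using TC(3)[OF a that] by (simp add: e_def)
    note P_le = P_le_limit_tail[OF A a0 _ e, OF dev] and le_P = limit_tail_le_P[OF A a0 _ e, OF dev]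
    have nn: "0 \<le> s * a powr s * measure P A" "0 \<le> angular_mass * X.prob A" "0 \<le> e * \<sigma>"
      using s_pos angular_mass_pos e by (auto simp: \<sigma>_def)
    have P: "ennreal (s * a powr s) * emeasure P A = ennreal (s * a powr s * measure P A)"
      using s_pos by (simp add: P.emeasure_eq_measure ennreal_mult)
    have X: "emeasure (ssgen_tail E a 1 s \<phi>s) A = ennreal (angular_mass * X.prob A)"
      using angular_mass_pos by (simp add: limit_tail_\<phi>s[OF A(1)] X.emeasure_eq_measure ennreal_mult)
    have c: "ennreal e * emeasure (surface_measure E) (directions E) = ennreal (e * \<sigma>)"
      using e by (simp add: S.emeasure_eq_measure \<sigma>_def ennreal_mult)
    have "s * a powr s * measure P A \<le> angular_mass * X.prob A + e * \<sigma>"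
      using P_le unfolding P X c ennreal_plus[OF nn(2,3), symmetric]
      using nn by (simp add: ennreal_le_iff del: ennreal_plus)
    moreover have "angular_mass * X.prob A \<le> s * a powr s * measure P A + e * \<sigma>"
      using le_P unfolding P X c ennreal_plus[OF nn(1,3), symmetric]
      using nn by (simp add: ennreal_le_iff del: ennreal_plus)
    ultimately have "\<bar>s * a powr s * measure P A - angular_mass * X.prob A\<bar> / angular_mass \<le> e * \<sigma> / angular_mass"
      using angular_mass_pos by (intro divide_right_mono) auto
    also have "\<bar>s * a powr s * measure P A - angular_mass * X.prob A\<bar> / angular_mass
      = \<bar>(s * a powr s * measure P A - angular_mass * X.prob A) / angular_mass\<bar>"
      using angular_mass_pos by simp
    also have "(s * a powr s * measure P A - angular_mass * X.prob A) / angular_mass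
      = s * a powr s / angular_mass * measure P A - X.prob A"
      using angular_mass_pos by (simp add: field_simps)
    finally show "\<bar>s * a powr s / angular_mass * measure P A - X.prob A\<bar> \<le> C * \<sigma> / angular_mass * a powr (- \<gamma>)"
      by (simp add: e_def mult_ac)
  qed (use TC in auto)
qed

end

subsection \<open>Conditional laws\<close>

text \<open>The comparison is divided by the mass of one of the two measures only, which keeps the bound valid
  when the other mass is small.\<close>
lemma ratio_diff_le:
  fixes X Y x y \<epsilon> \<kappa> :: real
  assumes "\<bar>X - Y\<bar> \<le> \<epsilon>" "\<bar>x - y\<bar> \<le> \<epsilon>" "0 \<le> y" "y \<le> Y" "0 < Y" "0 < \<kappa>" "\<kappa> \<le> X"
  shows "\<bar>y / Y - x / X\<bar> \<le> 2 * \<epsilon> / \<kappa>"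
proof -
  have X: "0 < X" using assms by simp
  \<comment> \<open>The error of the denominator is weighted by \<open>y / Y\<close>, which is at
    most 1, so Y never has to be bounded from below.\<close>
  have "y / Y - x / X = (y - x) / X + y / Y * ((X - Y) / X)"
    using assms X by (simp add: field_simps)
  then have "\<bar>y / Y - x / X\<bar> \<le> \<bar>y - x\<bar> / X + y / Y * (\<bar>X - Y\<bar> / X)"
    using assms X abs_triangle_ineq[of "(y - x) / X" "y / Y * ((X - Y) / X)"] by (simp add: abs_mult)
  also have "\<dots> \<le> \<epsilon> / \<kappa> + 1 * (\<epsilon> / \<kappa>)"
    using assms X by (intro add_mono frac_le mult_mono) (auto simp: abs_minus_commute)
  finally show ?thesis by simp
qed

context second_order_tail
begin

lemma P_inter_cone:
  assumes [measurable]: "A \<in> sets borel"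
  shows "measure P (A \<inter> (E - {0})) = measure P A"
proof -
  have "emeasure P (A \<inter> (E - {0})) = emeasure P A"
    unfolding P_density
    by (subst (1 2) emeasure_density, simp_all, rule nn_integral_cong_AE, rule AE_mp[OF AE_lborel_singleton[of 0]])
       (use f_outside in \<open>auto simp: indicator_def\<close>)
  then show ?thesis by (simp add: measure_def)
qed

lemma borel_norm_gt [measurable]: "{x::'a. a < norm x} \<in> sets borel"
  by measurable

lemma borel_angular_sector:
  assumes "B \<in> sets (restrict_space borel (directions E))"
  shows "{x \<in> E - {0}. a < norm x \<and> x /\<^sub>R norm x \<in> B} \<in> sets borel"
proof -
  have "B \<in> sets borel" using assms by (simp add: sets_restrict_space_iff)
  then show ?thesis by measurable
qed

lemma measure_angular_law:
  assumes t: "emeasure P {x. t < norm x} \<noteq> 0" and B: "B \<in> sets (restrict_space borel (directions E))"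
  shows "measure (angular_law E P t) B
    = measure P {x \<in> E - {0}. t < norm x \<and> x /\<^sub>R norm x \<in> B} / measure P {x. t < norm x}"
proof -
  let ?U = "uniform_measure P {x. t < norm x}"
  have sU: "sets ?U = sets borel" by simp
  have m: "(\<lambda>x. x /\<^sub>R norm x) \<in> measurable (restrict_space ?U (E - {0})) (restrict_space borel (directions E))"
    using measurable_direction[of "E - {0}"] sU
    by (simp cong: measurable_cong_sets sets_restrict_space_cong)
  have "measure (angular_law E P t) B = measure (restrict_space ?U (E - {0})) ((\<lambda>x. x /\<^sub>R norm x) -` B \<inter> (E - {0}))"
    unfolding angular_law_def using measure_distr[OF m B] by (simp add: space_restrict_space)
  also have "\<dots> = measure ?U ((\<lambda>x. x /\<^sub>R norm x) -` B \<inter> (E - {0}))"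
    by (rule measure_restrict_space) auto
  also have "(\<lambda>x. x /\<^sub>R norm x) -` B \<inter> (E - {0}) = {x \<in> E - {0}. x /\<^sub>R norm x \<in> B}"
    by auto
  also have "measure ?U \<dots> = measure P ({x. t < norm x} \<inter> {x \<in> E - {0}. x /\<^sub>R norm x \<in> B}) / measure P {x. t < norm x}"
  proof (rule measure_uniform_measure[OF t])
    have "B \<in> sets borel" using B by (simp add: sets_restrict_space_iff)
    then show "{x \<in> E - {0}. x /\<^sub>R norm x \<in> B} \<in> sets P" unfolding sets_P by measurable
  qed simp
  also have "{x. t < norm x} \<inter> {x \<in> E - {0}. x /\<^sub>R norm x \<in> B} = {x \<in> E - {0}. t < norm x \<and> x /\<^sub>R norm x \<in> B}"
    by auto
  finally show ?thesis .
qed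

lemma sets_angular_law: "sets (angular_law E P t) = sets (restrict_space borel (directions E))"
  by (simp add: angular_law_def)

lemma sector_directions: "{x \<in> E - {0}. a < norm x \<and> x /\<^sub>R norm x \<in> directions E} = {x. a < norm x} \<inter> (E - {0})"
  using direction_mem by auto

lemma directions_sets: "directions E \<in> sets (restrict_space borel (directions E))"
  by (simp add: sets_restrict_space_iff)

lemma prob_space_angular_law:
  assumes t: "emeasure P {x. t < norm x} \<noteq> 0"
  shows "prob_space (angular_law E P t)"
proof
  have "measure P {x. t < norm x} \<noteq> 0" using t by (simp add: P.emeasure_eq_measure)
  then have "measure (angular_law E P t) (directions E) = 1"
    unfolding measure_angular_law[OF t directions_sets] sector_directions
    by (subst P_inter_cone) auto
  \<comment> \<open>\<open>measure\<close> is 0 where \<open>emeasure\<close> is infinite, so the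
    value 1 determines \<open>emeasure\<close> before finiteness is known.\<close>
  then have "emeasure (angular_law E P t) (directions E) = 1"
    by (metis emeasure_eq_ennreal_measure ennreal_1 measure_def enn2real_top zero_neq_one)
  then show "emeasure (angular_law E P t) (space (angular_law E P t)) = 1"
    using sets_eq_imp_space_eq[OF sets_angular_law] by (simp add: space_restrict_space)
qed

lemma limit_tail_all:
  assumes "0 < a"
  shows "measure (ssgen_tail E a 1 s limit_angle) {x \<in> E - {0}. a < norm x \<and> x /\<^sub>R norm x \<in> directions E} = 1"
proof -
  interpret L: prob_space "density (surface_measure E) (\<lambda>\<phi>. ennreal (limit_angle \<phi>))"
    by (rule prob_space_limit_angle)
  show ?thesis
    using emeasure_ssgen_tail_far[OF assms s_pos limit_angle_measurable directions_sets] L.emeasure_space_1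
    by (simp add: measure_def space_surface_measure)
qed

lemma tail_mass_approx:
  assumes "0 < a"
    and dev: "\<And>A. A \<in> sets borel \<Longrightarrow> A \<subseteq> {x. a < norm x} \<Longrightarrow>
      \<bar>s * a powr s / angular_mass * measure P A - measure (ssgen_tail E a 1 s limit_angle) A\<bar> \<le> e"
  shows "\<bar>s * a powr s / angular_mass * measure P {x. a < norm x} - 1\<bar> \<le> e"
  using dev[OF borel_angular_sector[OF directions_sets, of a]] limit_tail_all[OF assms(1)]
  unfolding sector_directions P_inter_cone[OF borel_norm_gt] by auto

text \<open>The angular law is a ratio of two masses of P. After scaling by the same factor,
  numerator and denominator are within e of the limit value and of 1, and
  \<open>ratio_diff_le\<close> with lower bound 1 turns this into 2e. The condition e < 1 keeps the
  conditioning event from being null.\<close>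

lemma angular_law_approx:
  assumes a: "0 < a" and e: "e < 1"
    and dev: "\<And>A. A \<in> sets borel \<Longrightarrow> A \<subseteq> {x. a < norm x} \<Longrightarrow>
      \<bar>s * a powr s / angular_mass * measure P A - measure (ssgen_tail E a 1 s limit_angle) A\<bar> \<le> e"
  shows "emeasure P {x. a < norm x} \<noteq> 0"
    and "B \<in> sets (restrict_space borel (directions E)) \<Longrightarrow>
      \<bar>measure (angular_law E P a) B - measure (density (surface_measure E) (\<lambda>\<phi>. ennreal (limit_angle \<phi>))) B\<bar> \<le> 2 * e"
proof -
  define k where "k = s * a powr s / angular_mass"
  have k: "0 < k" using s_pos a angular_mass_pos by (simp add: k_def)
  let ?S = "{x. a < norm x}"
  have S: "\<bar>k * measure P ?S - 1\<bar> \<le> e"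
    using tail_mass_approx[OF a dev] by (simp add: k_def)
  then have "0 < k * measure P ?S" using e by linarith
  then have pos: "0 < measure P ?S" using k by (simp add: zero_less_mult_iff)
  then show nz: "emeasure P ?S \<noteq> 0" by (simp add: P.emeasure_eq_measure)
  assume B: "B \<in> sets (restrict_space borel (directions E))"
  let ?A = "{x \<in> E - {0}. a < norm x \<and> x /\<^sub>R norm x \<in> B}"
  let ?m = "measure (density (surface_measure E) (\<lambda>\<phi>. ennreal (limit_angle \<phi>))) B"
  have m: "measure (ssgen_tail E a 1 s limit_angle) ?A = ?m"
    using emeasure_ssgen_tail_far[OF a s_pos limit_angle_measurable B] by (simp add: measure_def)
  have A: "\<bar>k * measure P ?A - ?m\<bar> \<le> e"
    using dev[OF borel_angular_sector[OF B, of a]] unfolding m k_def by auto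
  have "measure P ?A \<le> measure P ?S"
    by (rule P.finite_measure_mono) auto
  then have "\<bar>(k * measure P ?A) / (k * measure P ?S) - ?m / 1\<bar> \<le> 2 * e / 1"
    using S A pos k by (intro ratio_diff_le) (simp_all add: abs_minus_commute)
  then have "\<bar>measure P ?A / measure P ?S - ?m\<bar> \<le> 2 * e"
    using k by simp
  then show "\<bar>measure (angular_law E P a) B - ?m\<bar> \<le> 2 * e"
    by (simp add: measure_angular_law[OF nz B])
qed

text \<open>The deterministic core. At level \<open>a\<close> the scaled P is compared with the
  limit tail, the limit tail with its version of index \<alpha>, and that one with the version of
  angular density g; Q beyond \<open>a\<close> is a multiple of the last. The null case has its own
  conclusion because a law Q that misses S can only occur when the total error \<epsilon> is at
  least \<kappa>.\<close>

lemma conditional_law_approx: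
  assumes T: "0 < t" "t \<le> a"
    and dev_a: "\<And>A. A \<in> sets borel \<Longrightarrow> A \<subseteq> {x. a < norm x} \<Longrightarrow>
      \<bar>s * a powr s / angular_mass * measure P A - measure (ssgen_tail E a 1 s limit_angle) A\<bar> \<le> e\<^sub>a"
    and dev_t: "\<And>A. A \<in> sets borel \<Longrightarrow> A \<subseteq> {x. t < norm x} \<Longrightarrow>
      \<bar>s * t powr s / angular_mass * measure P A - measure (ssgen_tail E t 1 s limit_angle) A\<bar> \<le> e\<^sub>t"
    and e\<^sub>t: "e\<^sub>t < 1"
    and S: "S \<in> sets borel" "S \<subseteq> {x. a < norm x}"
    and \<kappa>: "0 < \<kappa>" "\<kappa> \<le> s * a powr s / angular_mass * measure P S"
    and Q: "ssgen_law E t p \<alpha> g Q" and p: "0 < p" and \<alpha>: "0 < \<alpha>"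
    and g: "g \<in> borel_measurable (restrict_space borel (directions E))"
      "prob_space (density (surface_measure E) (\<lambda>\<phi>. ennreal (g \<phi>)))"
    and \<epsilon>: "\<epsilon> = e\<^sub>a + \<bar>\<alpha> - s\<bar> / s + 2 * e\<^sub>t
      + tv_dist (angular_law E P t) (density (surface_measure E) (\<lambda>\<phi>. ennreal (g \<phi>)))"
  shows "measure Q S = 0 \<Longrightarrow> \<kappa> \<le> \<epsilon>"
    and "measure Q S \<noteq> 0 \<Longrightarrow> B \<in> sets borel \<Longrightarrow> B \<subseteq> S \<Longrightarrow>
      \<bar>measure Q B / measure Q S - measure P B / measure P S\<bar> \<le> 2 * \<epsilon> / \<kappa>"
proof -
  have a: "0 < a" using T by simp
  define k where "k = s * a powr s / angular_mass"
  define w where "w = p * (t / a) powr \<alpha>"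
  have k: "0 < k" using s_pos a angular_mass_pos by (simp add: k_def)
  have w: "0 < w" using p T a by (simp add: w_def)
  let ?G = "density (surface_measure E) (\<lambda>\<phi>. ennreal (g \<phi>))"
  let ?L = "density (surface_measure E) (\<lambda>\<phi>. ennreal (limit_angle \<phi>))"
  let ?Y = "ssgen_tail E a 1 \<alpha> g"
  interpret Y: prob_space ?Y by (rule prob_space_ssgen_tail[OF g \<alpha> a])
  interpret Q: prob_space Q using Q by (simp add: ssgen_law_def)
  have nz: "emeasure P {x. t < norm x} \<noteq> 0"
    by (rule angular_law_approx(1)[OF T(1) e\<^sub>t dev_t])
  \<comment> \<open>The estimator targets the angular law at t, not the limit; the bias
    \<open>2 * e\<^sub>t\<close> is the price of passing between them.\<close>
  have ang2: "\<bar>measure ?L B - measure ?G B\<bar> \<le> 2 * e\<^sub>t + tv_dist (angular_law E P t) ?G"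
    if "B \<in> sets (surface_measure E)" for B
  proof -
    have "B \<in> sets (restrict_space borel (directions E))" "B \<in> sets (angular_law E P t)"
      using that by (simp_all add: sets_surface_measure sets_angular_law)
    then show ?thesis
      using angular_law_approx(2)[OF T(1) e\<^sub>t dev_t, of B] tv_dist_ge[OF prob_space_angular_law[OF nz] g(2), of B]
      by (smt (verit))
  qed
  \<comment> \<open>The index is changed first, with the limit angle kept, and then the angle, with
    the index \<alpha> kept.\<close>
  have XY: "\<bar>k * measure P A - measure ?Y A\<bar> \<le> \<epsilon>" if A: "A \<in> sets borel" "A \<subseteq> {x. a < norm x}" for A
    using dev_a[OF A] ssgen_tail_index_diff[OF A(1) limit_angle_measurable prob_space_limit_angle \<alpha> s_pos a]
      ssgen_tail_angle_diff[OF A(1) limit_angle_measurable prob_space_limit_angle g \<alpha> a ang2]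
    unfolding \<epsilon> k_def by linarith
  have QY: "measure Q A = w * measure ?Y A" if A: "A \<in> sets borel" "A \<subseteq> {x. a < norm x}" for A
  proof -
    have "emeasure Q A = emeasure (ssgen_tail E t p \<alpha> g) A"
    proof -
      have "A \<subseteq> {x. t < norm x}" using A(2) T by force
      then show ?thesis using Q A(1) by (simp add: ssgen_law_def)
    qed
    also have "\<dots> = ennreal w * emeasure ?Y A"
      unfolding w_def using A g(1) p \<alpha> T by (intro ssgen_tail_rescale) auto
    also have "\<dots> = ennreal (w * measure ?Y A)"
      using w by (simp add: Y.emeasure_eq_measure ennreal_mult)
    finally show ?thesis using w by (simp add: Q.emeasure_eq_measure)
  qed
  \<comment> \<open>If \<open>?Y\<close> misses S, the scaled mass of S under P, at least \<kappa>,
    is itself part of the error.\<close>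
  have "measure ?Y S = 0 \<Longrightarrow> \<kappa> \<le> \<epsilon>"
    using XY[OF S] \<kappa> unfolding k_def by linarith
  then show "measure Q S = 0 \<Longrightarrow> \<kappa> \<le> \<epsilon>"
    using w by (simp add: QY[OF S])
  assume nz: "measure Q S \<noteq> 0" and B: "B \<in> sets borel" "B \<subseteq> S"
  have B': "B \<subseteq> {x. a < norm x}" using B(2) S(2) by simp
  have YS: "0 < measure ?Y S" using nz w by (simp add: QY[OF S] zero_less_measure_iff)
  \<comment> \<open>The lower bound \<kappa> is known for P only, so P takes the part of the
    denominator X in \<open>ratio_diff_le\<close>; k and w cancel afterwards.\<close>
  have "\<bar>measure ?Y B / measure ?Y S - (k * measure P B) / (k * measure P S)\<bar> \<le> 2 * \<epsilon> / \<kappa>"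
  proof (rule ratio_diff_le)
    show "measure ?Y B \<le> measure ?Y S"
      using B S by (intro Y.finite_measure_mono) (auto simp: sets_ssgen_tail)
  qed (use XY S B(1) B' YS \<kappa> in \<open>auto simp: k_def\<close>)
  then show "\<bar>measure Q B / measure Q S - measure P B / measure P S\<bar> \<le> 2 * \<epsilon> / \<kappa>"
    using k w by (simp add: QY[OF S] QY[OF B(1) B'])
qed

end

section \<open>Stressed laws and their push-forwards\<close>

context closed_cone
begin

lemma sets_stressed_law:
  "sets N = sets (restrict_space borel E) \<Longrightarrow> sets (stressed_law E Q u S N) = sets (restrict_space borel E)"
  by (simp add: stressed_law_def)

lemma measure_stressed_law:
  assumes Q: "prob_space Q" "sets Q = sets borel" and S: "S \<in> sets borel" "S \<subseteq> E" "emeasure Q S \<noteq> 0"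
    and u: "0 < u" and A: "A \<in> sets (restrict_space borel E)"
  shows "measure (stressed_law E Q u S N) A = measure Q (S \<inter> {x \<in> E. x /\<^sub>R u \<in> A}) / measure Q S"
proof -
  interpret Q: prob_space Q by fact
  let ?U = "uniform_measure Q S"
  have sU: "sets ?U = sets borel" using Q by simp
  have A': "A \<in> sets borel" using A by (simp add: sets_restrict_space_iff)
  have m: "(\<lambda>x. x /\<^sub>R u) \<in> measurable (restrict_space ?U E) (restrict_space borel E)"
  proof -
    have "(\<lambda>x. x /\<^sub>R u) \<in> measurable (restrict_space borel E) (restrict_space borel E)"
      using u by (intro measurable_restrict_space3) (auto intro!: scale_mem_cone)
    then show ?thesis using sU by (simp cong: measurable_cong_sets sets_restrict_space_cong)
  qed
  have "measure (stressed_law E Q u S N) A = measure (restrict_space ?U E) ((\<lambda>x. x /\<^sub>R u) -` A \<inter> E)"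
    using S measure_distr[OF m A] sets_eq_imp_space_eq[OF Q(2)] by (simp add: stressed_law_def space_restrict_space)
  also have "\<dots> = measure ?U ((\<lambda>x. x /\<^sub>R u) -` A \<inter> E)"
    using sU Q(2) sets_eq_imp_space_eq[OF Q(2)] by (intro measure_restrict_space) auto
  also have "(\<lambda>x. x /\<^sub>R u) -` A \<inter> E = {x \<in> E. x /\<^sub>R u \<in> A}" by auto
  also have "measure ?U \<dots> = measure Q (S \<inter> {x \<in> E. x /\<^sub>R u \<in> A}) / measure Q S"
  proof (rule measure_uniform_measure[OF S(3)])
    show "{x \<in> E. x /\<^sub>R u \<in> A} \<in> sets Q" unfolding Q(2) using A' by measurable
  qed simp
  finally show ?thesis .
qed

lemma prob_space_stressed_law:
  assumes Q: "prob_space Q" "sets Q = sets borel" and S: "S \<in> sets borel" "S \<subseteq> E"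
    and u: "0 < u" and N: "prob_space N" "sets N = sets (restrict_space borel E)"
  shows "prob_space (stressed_law E Q u S N)"
proof (cases "emeasure Q S = 0")
  case True
  then show ?thesis using N by (simp add: stressed_law_def)
next
  case False
  interpret Q: prob_space Q by fact
  have EE: "E \<in> sets (restrict_space borel E)" by (simp add: sets_restrict_space_iff)
  have "S \<inter> {x \<in> E. x /\<^sub>R u \<in> E} = S" using S(2) u by (auto intro!: scale_mem_cone)
  then have "measure (stressed_law E Q u S N) E = 1"
    using False by (simp add: measure_stressed_law[OF Q S False u EE] Q.emeasure_eq_measure)
  then have "emeasure (stressed_law E Q u S N) E = 1"
    by (metis emeasure_eq_ennreal_measure ennreal_1 measure_def enn2real_top zero_neq_one)
  then show ?thesis
    using sets_eq_imp_space_eq[OF sets_stressed_law[OF N(2), of Q u S]]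
    by (intro prob_spaceI) (simp add: space_restrict_space)
qed

text \<open>A set in the target pulls back to a Borel subset of S, so a bound uniform over such
  subsets survives every measurable map. If Q misses S, the stressed law is the arbitrary
  \<open>N'\<close> and only the trivial bound 1 is left, which \<open>null\<close> absorbs into
  b.\<close>

lemma tv_dist_stressed_law_le:
  assumes P: "prob_space P" "sets P = sets borel" and Q: "prob_space Q" "sets Q = sets borel"
    and S: "S \<in> sets borel" "S \<subseteq> E" "emeasure P S \<noteq> 0" and u: "0 < u"
    and N: "prob_space N" "sets N = sets (restrict_space borel E)"
    and N': "prob_space N'" "sets N' = sets (restrict_space borel E)"
    and w: "w \<in> measurable (restrict_space borel E) K"
    and null: "measure Q S = 0 \<Longrightarrow> 1 \<le> b"
    and ratio: "\<And>B. measure Q S \<noteq> 0 \<Longrightarrow> B \<in> sets borel \<Longrightarrow> B \<subseteq> S \<Longrightarrow>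
      \<bar>measure Q B / measure Q S - measure P B / measure P S\<bar> \<le> b"
  shows "\<bar>tv_dist (distr (stressed_law E Q u S N') K w) (distr (stressed_law E P u S N) K w)\<bar> \<le> b"
proof -
  interpret Q: prob_space Q by fact
  let ?Q = "stressed_law E Q u S N'" and ?P = "stressed_law E P u S N"
  interpret sQ: prob_space ?Q by (rule prob_space_stressed_law[OF Q S(1,2) u N'])
  interpret sP: prob_space ?P by (rule prob_space_stressed_law[OF P S(1,2) u N])
  have sets: "sets ?Q = sets (restrict_space borel E)" "sets ?P = sets (restrict_space borel E)"
    using sets_stressed_law N(2) N'(2) by auto
  have w': "w \<in> measurable ?Q K" "w \<in> measurable ?P K"
    using w sets by (simp_all cong: measurable_cong_sets)
  have sp: "space ?Q = E" "space ?P = E"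
    using sets_eq_imp_space_eq[OF sets(1)] sets_eq_imp_space_eq[OF sets(2)] by (simp_all add: space_restrict_space)
  have "\<bar>measure (distr ?Q K w) C - measure (distr ?P K w) C\<bar> \<le> b" if C: "C \<in> sets K" for C
  proof -
    let ?A = "w -` C \<inter> E"
    have A: "?A \<in> sets (restrict_space borel E)"
      using measurable_sets[OF w C] by (simp add: space_restrict_space)
    have eq: "measure (distr ?Q K w) C = measure ?Q ?A" "measure (distr ?P K w) C = measure ?P ?A"
      using measure_distr[OF w'(1) C] measure_distr[OF w'(2) C] by (simp_all add: sp)
    show ?thesis
    proof (cases "measure Q S = 0")
      case True
      have "\<bar>measure ?Q ?A - measure ?P ?A\<bar> \<le> 1"
        using sQ.prob_le_1[of ?A] sP.prob_le_1[of ?A] measure_nonneg[of ?Q ?A] measure_nonneg[of ?P ?A] by linarith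
      then show ?thesis using null[OF True] unfolding eq by linarith
    next
      case False
      then have nz: "emeasure Q S \<noteq> 0" by (simp add: Q.emeasure_eq_measure)
      have A': "?A \<in> sets borel" using A by (simp add: sets_restrict_space_iff)
      let ?B = "S \<inter> {x \<in> E. x /\<^sub>R u \<in> ?A}"
      have B: "?B \<in> sets borel"
        using A' S(1) by measurable
      show ?thesis
        using ratio[OF False B] unfolding eq measure_stressed_law[OF Q S(1,2) nz u A] measure_stressed_law[OF P S u A]
        by auto
    qed
  qed
  then have "tv_dist (distr ?Q K w) (distr ?P K w) \<le> b"
    by (intro tv_dist_le) auto
  moreover have "0 \<le> tv_dist (distr ?Q K w) (distr ?P K w)"
    by (intro tv_dist_nonneg sQ.prob_space_distr sP.prob_space_distr w')
  ultimately show ?thesis by simp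
qed

end

subsection \<open>Stress sets\<close>

lemma asymp_homogeneous_limit:
  assumes "asymp_homogeneous E L Ls" "z \<in> E"
  shows "((\<lambda>t. L j (t *\<^sub>R z) / t) \<longlongrightarrow> Ls j z) at_top"
  using assms unfolding asymp_homogeneous_def by (auto dest!: spec[of _ j] bspec[of _ _ z] spec[of _ "\<lambda>_. z"])

lemma stress_set_measurable:
  fixes L :: "'k::finite \<Rightarrow> 'a::euclidean_space \<Rightarrow> real"
  assumes "asymp_homogeneous E L Ls" "closed E"
  shows "stress_set E L u J \<in> sets borel"
proof -
  have L: "L j \<in> borel_measurable (restrict_space borel E)" for j
    using assms by (auto simp: asymp_homogeneous_def)
  have "{z \<in> space (restrict_space borel E). \<forall>j\<in>J. u \<le> L j z} \<in> sets (restrict_space borel E)"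
    using L by measurable
  then show ?thesis
    using borel_closed[OF assms(2)] by (simp add: stress_set_def space_restrict_space sets_restrict_space_iff)
qed

context closed_cone
begin

context
  fixes L Ls :: "'k::finite \<Rightarrow> 'a \<Rightarrow> real"
  assumes losses: "asymp_homogeneous E L Ls"
begin

text \<open>The predicate \<open>cone\<close> admits the empty set; a point of E comes from the
  requirement that a limit loss be positive somewhere.\<close>

lemma zero_mem_cone: "0 \<in> E"
proof -
  obtain z where "z \<in> E" using losses by (auto simp: asymp_homogeneous_def)
  then show ?thesis using scale_mem_cone[of 0 z] by simp
qed

text \<open>Along the constant curve 0 the scaled loss is a fixed number divided by t.\<close>

lemma limit_loss_zero: "Ls j 0 = 0"
proof (rule tendsto_unique)
  show "((\<lambda>t. L j (t *\<^sub>R 0) / t) \<longlongrightarrow> Ls j 0) at_top"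
    by (rule asymp_homogeneous_limit[OF losses zero_mem_cone])
  show "((\<lambda>t. L j (t *\<^sub>R 0) / t) \<longlongrightarrow> 0) at_top"
    by (auto intro!: tendsto_divide_0 filterlim_at_top_imp_at_infinity filterlim_ident)
qed simp

text \<open>Replacing the scale t by 2t in the defining limit gives homogeneity for the factor 2,
  which is what turns a weak exceedance of 1 into a strict one.\<close>

lemma limit_loss_double:
  assumes "z \<in> E" shows "Ls j (2 *\<^sub>R z) = 2 * Ls j z"
proof (rule tendsto_unique)
  show "((\<lambda>t. L j (t *\<^sub>R (2 *\<^sub>R z)) / t) \<longlongrightarrow> Ls j (2 *\<^sub>R z)) at_top"
    using assms by (intro asymp_homogeneous_limit[OF losses] scale_mem_cone) auto
  have "filterlim (\<lambda>t::real. 2 * t) at_top at_top"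
    by (rule filterlim_tendsto_pos_mult_at_top[OF tendsto_const]) (auto intro: filterlim_ident)
  from tendsto_mult[OF tendsto_const[of 2] filterlim_compose[OF asymp_homogeneous_limit[OF losses assms] this]]
  show "((\<lambda>t. L j (t *\<^sub>R (2 *\<^sub>R z)) / t) \<longlongrightarrow> 2 * Ls j z) at_top"
    by (simp add: mult.commute)
qed simp

text \<open>A violating sequence of scales would give a curve tending to \<open>0\<close> along which the scaled loss stays
  at least \<open>1\<close>, against the limit loss vanishing at \<open>0\<close>.\<close>
lemma stress_set_far:
  assumes "J \<noteq> {}"
  obtains \<delta> where "0 < \<delta>" "\<forall>\<^sub>F u in at_top. stress_set E L u J \<subseteq> {x. \<delta> * u < norm x}"
proof -
  obtain j where j: "j \<in> J" using assms by auto
  have "\<exists>\<delta>>0. \<forall>\<^sub>F u in at_top. stress_set E L u J \<subseteq> {x. \<delta> * u < norm x}"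
  proof (rule ccontr)
    assume neg: "\<not> ?thesis"
    have "\<exists>u z. real n + 1 \<le> u \<and> z \<in> E \<and> norm z \<le> 1 / (real n + 1) \<and> u \<le> L j (u *\<^sub>R z)" for n :: nat
    proof -
      have "0 < 1 / (real n + 1)" by simp
      then have "\<not> (\<forall>\<^sub>F u in at_top. stress_set E L u J \<subseteq> {x. 1 / (real n + 1) * u < norm x})"
        using neg by blast
      then obtain u where u: "real n + 1 \<le> u" "\<not> stress_set E L u J \<subseteq> {x. 1 / (real n + 1) * u < norm x}"
        unfolding eventually_at_top_linorder by blast
      then obtain x where "x \<in> stress_set E L u J" and nx: "\<not> 1 / (real n + 1) * u < norm x"
        by blast
      then have x: "x \<in> E" "\<forall>j\<in>J. u \<le> L j x" "norm x \<le> 1 / (real n + 1) * u"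
        by (auto simp only: stress_set_def not_less mem_Collect_eq)
      have u0: "0 < u" using u by linarith
      show ?thesis
      proof (intro exI conjI)
        show "real n + 1 \<le> u" by fact
        show "x /\<^sub>R u \<in> E" using x u0 by (intro scale_mem_cone) auto
        show "norm (x /\<^sub>R u) \<le> 1 / (real n + 1)" using x(3) u0 by (simp add: field_simps)
        show "u \<le> L j (u *\<^sub>R (x /\<^sub>R u))" using x(2) j u0 by simp
      qed
    qed
    then have "\<forall>n. \<exists>u z. real n + 1 \<le> u \<and> z \<in> E \<and> norm z \<le> 1 / (real n + 1) \<and> u \<le> L j (u *\<^sub>R z)"
      by blast
    from choice[OF this] obtain u where
      "\<forall>n. \<exists>z. real n + 1 \<le> u n \<and> z \<in> E \<and> norm z \<le> 1 / (real n + 1) \<and> u n \<le> L j (u n *\<^sub>R z)" ..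
    from choice[OF this] obtain z where
      "\<forall>n. real n + 1 \<le> u n \<and> z n \<in> E \<and> norm (z n) \<le> 1 / (real n + 1) \<and> u n \<le> L j (u n *\<^sub>R z n)" ..
    then have uz: "\<And>n. real n + 1 \<le> u n" "\<And>n. z n \<in> E" "\<And>n. norm (z n) \<le> 1 / (real n + 1)"
      "\<And>n. u n \<le> L j (u n *\<^sub>R z n)" by blast+
    \<comment> \<open>The convergence hypothesis speaks of curves in a real scale, so the sequence
      is interpolated: at a scale t hit by u, some index with that scale is chosen, since u need not
      be injective; elsewhere the curve sits at 0, which lies in E.\<close>
    define \<zeta> where "\<zeta> t = (if t \<in> range u then z (SOME n. u n = t) else 0)" for t
    have \<zeta>u: "\<exists>m. u m = t \<and> \<zeta> t = z m" if "t \<in> range u" for t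
    proof -
      have "\<exists>n. u n = t" using that by auto
      then have "u (SOME n. u n = t) = t" by (rule someI_ex)
      then show ?thesis using that by (auto simp: \<zeta>_def)
    qed
    have mem: "\<zeta> t \<in> E" for t
      using uz(2) zero_mem_cone by (auto simp: \<zeta>_def)
    have "(\<zeta> \<longlongrightarrow> 0) at_top"
      unfolding tendsto_iff
    proof (intro allI impI)
      fix e :: real assume e: "0 < e"
      obtain N :: nat where N: "1 / e < real N" using reals_Archimedean2 by blast
      \<comment> \<open>A scale above the first N + 1 values of u can only be represented by an
        index beyond N, whichever one the choice picks.\<close>
      have "norm (\<zeta> t) < e" if t: "Max (u ` {..N}) < t" for t
      proof (cases "t \<in> range u")
        case True
        then obtain m where m: "u m = t" "\<zeta> t = z m" using \<zeta>u by blast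
        have "N < m"
        proof (rule ccontr)
          assume "\<not> N < m"
          then have "u m \<le> Max (u ` {..N})" by (intro Max_ge) auto
          then show False using t m by simp
        qed
        then have "1 / e < real m + 1" using N by linarith
        then have "1 / (real m + 1) < e" using e by (simp add: field_simps)
        then show ?thesis using uz(3)[of m] m by simp
      qed (use e in \<open>simp add: \<zeta>_def\<close>)
      then show "\<forall>\<^sub>F t in at_top. dist (\<zeta> t) 0 < e"
        using eventually_gt_at_top[of "Max (u ` {..N})"] by (auto elim: eventually_mono)
    qed
    then have "((\<lambda>t. L j (t *\<^sub>R \<zeta> t) / t) \<longlongrightarrow> Ls j 0) at_top"
      using losses mem zero_mem_cone unfolding asymp_homogeneous_def by blast
    then have "\<forall>\<^sub>F t in at_top. L j (t *\<^sub>R \<zeta> t) / t < 1"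
      unfolding limit_loss_zero by (rule order_tendstoD) simp
    then obtain T where T: "\<And>t. T \<le> t \<Longrightarrow> L j (t *\<^sub>R \<zeta> t) / t < 1"
      unfolding eventually_at_top_linorder by auto
    obtain n :: nat where n: "T \<le> real n" using real_arch_simple by blast
    obtain m where m: "u m = u n" "\<zeta> (u n) = z m" using \<zeta>u[of "u n"] by auto
    have "0 < u n" using uz(1)[of n] by linarith
    moreover have "u n \<le> L j (u n *\<^sub>R \<zeta> (u n))" using uz(4)[of m] m by simp
    ultimately show False using T[of "u n"] uz(1)[of n] n by simp
  qed
  then show ?thesis using that by blast
qed

text \<open>Strict inequality in the limit is decided by pointwise convergence; on the boundary
  \<open>Ls j z = 1\<close> membership could fail at every scale.\<close>

lemma limit_stress_interior:
  assumes "z \<in> E" "\<forall>j\<in>J. 1 < Ls j z"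
  shows "\<forall>\<^sub>F t in at_top. t *\<^sub>R z \<in> stress_set E L t J"
proof -
  have "\<forall>\<^sub>F t in at_top. \<forall>j\<in>J. 1 < L j (t *\<^sub>R z) / t"
    using assms(2) order_tendstoD(1)[OF asymp_homogeneous_limit[OF losses assms(1)]]
    by (intro eventually_ball_finite) auto
  then show ?thesis
    using eventually_gt_at_top[of 0]
    by eventually_elim (use assms in \<open>auto simp: stress_set_def less_divide_eq intro!: scale_mem_cone less_imp_le\<close>)
qed

text \<open>Doubling maps the limiting stress set into the set of strict exceedances.\<close>
lemma limit_stress_strict_nonnull:
  assumes reg: "emeasure lebesgue (stress_set E Ls 1 J) \<noteq> 0"
    and Z: "Z \<in> null_sets lborel" "{z \<in> E. \<forall>j\<in>J. 1 < Ls j z} \<subseteq> Z"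
  shows False
proof -
  have "(\<integral>\<^sup>+z. indicator Z z \<partial>lborel) = ennreal (2 ^ DIM('a)) * (\<integral>\<^sup>+z. indicator Z (2 *\<^sub>R z) \<partial>lborel)"
    by (rule nn_integral_lborel_scaleR) (use Z in auto)
  moreover have "(\<integral>\<^sup>+z. indicator Z z \<partial>lborel) = 0"
    using Z(1) by (subst nn_integral_indicator) auto
  moreover have pow: "ennreal (2 ^ DIM('a)) \<noteq> 0"
    by (simp add: ennreal_eq_0_iff not_le)
  ultimately have "ennreal (2 ^ DIM('a)) * (\<integral>\<^sup>+z. indicator Z (2 *\<^sub>R z) \<partial>lborel) = 0"
    by simp
  then have 0: "(\<integral>\<^sup>+z. indicator Z (2 *\<^sub>R z) \<partial>lborel) = 0"
    using pow by (metis mult_eq_0_iff)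
  let ?Z = "{z::'a. 2 *\<^sub>R z \<in> Z}"
  have Zb: "Z \<in> sets borel" using Z by auto
  have Z': "?Z \<in> sets borel" using Zb by measurable
  have "emeasure lborel ?Z = (\<integral>\<^sup>+z. indicator ?Z z \<partial>lborel)"
    using Z' by (simp only: nn_integral_indicator sets_lborel)
  also have "\<dots> = 0" using 0 by (simp add: indicator_def)
  finally have "?Z \<in> null_sets lebesgue"
    using Z' by (intro null_sets_completionI) auto
  moreover have "stress_set E Ls 1 J \<subseteq> ?Z"
  proof
    fix z assume z: "z \<in> stress_set E Ls 1 J"
    then have "2 *\<^sub>R z \<in> E" "\<forall>j\<in>J. 1 < Ls j (2 *\<^sub>R z)"
      using limit_loss_double[of z] by (auto simp: stress_set_def intro!: scale_mem_cone)
    then show "z \<in> ?Z" using Z(2) by auto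
  qed
  \<comment> \<open>The limit stress set need only be contained in a Borel null set; completeness of
    \<open>lebesgue\<close> makes it measurable and null.\<close>
  ultimately have "stress_set E Ls 1 J \<in> null_sets lebesgue"
    by (rule null_sets_completion_subset[rotated])
  then show False using reg by auto
qed

end
end

context second_order_tail
begin

text \<open>After the substitution x = u z the scaled probability is the integral of
  \<open>F n\<close>. At a point of strict exceedance the indicator is eventually 1 and the scaled
  density tends to \<open>\<phi>s z > 0\<close>; such points do not fit in a null set. Only a lower
  bound is sought, so Fatou suffices and no dominating function is required.\<close>

lemma stress_probability_lower:
  fixes L Ls :: "'k::finite \<Rightarrow> 'a \<Rightarrow> real" and u :: "nat \<Rightarrow> real"
  assumes losses: "asymp_homogeneous E L Ls" and "J \<noteq> {}"
    and reg: "emeasure lebesgue (stress_set E Ls 1 J) \<noteq> 0"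
    and u: "filterlim u at_top sequentially"
  obtains \<kappa> where "0 < \<kappa>" "\<forall>\<^sub>F n in sequentially. \<kappa> \<le> u n powr s * measure P (stress_set E L (u n) J)"
proof -
  define S where "S n = stress_set E L (u n) J" for n
  have S [measurable]: "S n \<in> sets borel" for n
    unfolding S_def by (rule stress_set_measurable[OF losses closed_E])
  define F where "F n z = ennreal (u n powr (s + real DIM('a)) * f (u n *\<^sub>R z)) * indicator (S n) (u n *\<^sub>R z)" for n z
  have [measurable]: "F n \<in> borel_measurable borel" for n
    unfolding F_def by measurable
  have F: "(\<integral>\<^sup>+z. F n z \<partial>lborel) = ennreal (u n powr s * measure P (S n))" if un: "0 < u n" for n
  proof -
    have "emeasure P (S n) = (\<integral>\<^sup>+z. ennreal (f z) * indicator (S n) z \<partial>lborel)"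
      unfolding P_density by (rule emeasure_density) auto
    also have "\<dots> = ennreal (u n ^ DIM('a)) * (\<integral>\<^sup>+z. ennreal (f (u n *\<^sub>R z)) * indicator (S n) (u n *\<^sub>R z) \<partial>lborel)"
      by (rule nn_integral_lborel_scaleR) (use un in auto)
    finally have "ennreal (u n powr s) * emeasure P (S n)
      = ennreal (u n powr s) * ennreal (u n ^ DIM('a)) * (\<integral>\<^sup>+z. ennreal (f (u n *\<^sub>R z)) * indicator (S n) (u n *\<^sub>R z) \<partial>lborel)"
      by (simp add: mult.assoc)
    also have "ennreal (u n powr s) * ennreal (u n ^ DIM('a)) = ennreal (u n powr (s + real DIM('a)))"
      using un by (simp add: ennreal_mult[symmetric] powr_add powr_realpow)
    also have "\<dots> * (\<integral>\<^sup>+z. ennreal (f (u n *\<^sub>R z)) * indicator (S n) (u n *\<^sub>R z) \<partial>lborel) = (\<integral>\<^sup>+z. F n z \<partial>lborel)"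
      unfolding F_def
      by (subst nn_integral_cmult[symmetric]) (auto simp: ennreal_mult' mult.assoc)
    finally show ?thesis by (simp add: P.emeasure_eq_measure ennreal_mult)
  qed
  have lim: "liminf (\<lambda>n. F n z) \<noteq> 0" if z: "z \<in> E" "\<forall>j\<in>J. 1 < Ls j z" for z
  proof -
    obtain j where "j \<in> J" using \<open>J \<noteq> {}\<close> by auto
    then have z0: "z \<noteq> 0" using z(2) limit_loss_zero[OF losses, of j] by auto
    have "\<forall>\<^sub>F n in sequentially. u n *\<^sub>R z \<in> S n"
      unfolding S_def using filterlim_iff[THEN iffD1, OF u] limit_stress_interior[OF losses z] by blast
    then have "\<forall>\<^sub>F n in sequentially. ennreal (u n powr (s + real DIM('a)) * f (u n *\<^sub>R z)) = F n z"
      by eventually_elim (simp add: F_def)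
    moreover have "(\<lambda>n. ennreal (u n powr (s + real DIM('a)) * f (u n *\<^sub>R z))) \<longlonglongrightarrow> ennreal (\<phi>s z)"
      using filterlim_compose[OF scaled_density_tendsto[OF z(1) z0] u] by (rule tendsto_ennrealI)
    ultimately have "(\<lambda>n. F n z) \<longlonglongrightarrow> ennreal (\<phi>s z)"
      by (rule Lim_transform_eventually[rotated])
    then have "liminf (\<lambda>n. F n z) = ennreal (\<phi>s z)"
      by (intro lim_imp_Liminf) auto
    then show ?thesis using \<phi>s_pos[OF z(1) z0] by (simp add: ennreal_eq_0_iff not_le)
  qed
  have "(\<integral>\<^sup>+z. liminf (\<lambda>n. F n z) \<partial>lborel) \<noteq> 0"
  proof
    assume "(\<integral>\<^sup>+z. liminf (\<lambda>n. F n z) \<partial>lborel) = 0"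
    then have "AE z in lborel. liminf (\<lambda>n. F n z) = 0"
      by (subst (asm) nn_integral_0_iff_AE) auto
    \<comment> \<open>A vanishing integral of the lower limit would enclose all strict exceedances
      in the null set Z.\<close>
    then obtain Z where Z: "Z \<in> null_sets lborel" "{z. liminf (\<lambda>n. F n z) \<noteq> 0} \<subseteq> Z"
      by (auto simp: eventually_ae_filter)
    show False
      by (rule limit_stress_strict_nonnull[OF losses reg Z(1)]) (use Z(2) lim in auto)
  qed
  moreover have "(\<integral>\<^sup>+z. liminf (\<lambda>n. F n z) \<partial>lborel) \<le> liminf (\<lambda>n. \<integral>\<^sup>+z. F n z \<partial>lborel)"
    by (rule nn_integral_liminf) auto
  ultimately have "0 < liminf (\<lambda>n. \<integral>\<^sup>+z. F n z \<partial>lborel)"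
    by (auto simp: zero_less_iff_neq_zero)
  then obtain c where c: "0 < c" "c < liminf (\<lambda>n. \<integral>\<^sup>+z. F n z \<partial>lborel)"
    using dense by blast
  have "\<forall>\<^sub>F n in sequentially. c < (\<integral>\<^sup>+z. F n z \<partial>lborel)"
    using c(2) by (rule less_LiminfD)
  moreover have "\<forall>\<^sub>F n in sequentially. 0 < u n"
    using u by (simp add: filterlim_at_top_dense)
  ultimately have ev: "\<forall>\<^sub>F n in sequentially. c < ennreal (u n powr s * measure P (S n))"
    by eventually_elim (simp add: F)
  have ctop: "c < top" using c(2) by (rule less_le_trans) simp
  show ?thesis
  proof (rule that[of "enn2real c"])
    show "0 < enn2real c" using c ctop by (simp add: enn2real_positive_iff)
    show "\<forall>\<^sub>F n in sequentially. enn2real c \<le> u n powr s * measure P (stress_set E L (u n) J)"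
      using ev
    proof eventually_elim
      case (elim n)
      then have "enn2real c \<le> enn2real (ennreal (u n powr s * measure P (S n)))"
        by (intro enn2real_mono) auto
      then show ?case by (simp add: S_def)
    qed
  qed
qed

lemma tail_mass_bounds:
  obtains b T where "0 < b" "0 < T"
    "\<And>a. T \<le> a \<Longrightarrow> b / 2 * a powr (- s) \<le> measure P {x. a < norm x}"
    "\<And>a. T \<le> a \<Longrightarrow> measure P {x. a < norm x} \<le> 2 * b * a powr (- s)"
proof -
  obtain T C where TC: "0 < T" "0 \<le> C"
    "\<And>a (A :: 'a set). T \<le> a \<Longrightarrow> A \<in> sets borel \<Longrightarrow> A \<subseteq> {x. a < norm x} \<Longrightarrow>
      \<bar>s * a powr s / angular_mass * measure P A - measure (ssgen_tail E a 1 s limit_angle) A\<bar> \<le> C * a powr (- \<gamma>)"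
    using tail_approx by metis
  have "((\<lambda>a. C * a powr (- \<gamma>)) \<longlongrightarrow> C * 0) at_top"
    using \<gamma>_pos by (intro tendsto_mult tendsto_const tendsto_neg_powr filterlim_ident) auto
  then have "\<forall>\<^sub>F a in at_top. C * a powr (- \<gamma>) < 1 / 2" by (rule order_tendstoD) simp
  then obtain T' where T': "\<And>a. T' \<le> a \<Longrightarrow> C * a powr (- \<gamma>) < 1 / 2"
    unfolding eventually_at_top_linorder by auto
  have *: "\<bar>s / angular_mass * a powr s * measure P {x. a < norm x} - 1\<bar> \<le> 1 / 2" if "max T T' \<le> a" for a
  proof -
    have a: "0 < a" "T \<le> a" "T' \<le> a" using that TC(1) by auto
    have "\<bar>s * a powr s / angular_mass * measure P {x. a < norm x} - 1\<bar> \<le> C * a powr (- \<gamma>)"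
      by (rule tail_mass_approx[OF a(1) TC(3)[OF a(2)]])
    then show ?thesis using T'[OF a(3)] by (simp add: mult_ac)
  qed
  \<comment> \<open>The limit of \<open>a powr s * measure P {x. a < norm x}\<close>. A relative
    deviation of at most 1/2 keeps the mass between \<open>b / 2\<close> and \<open>2 * b\<close>
    times \<open>a powr (- s)\<close>.\<close>
  define b where "b = angular_mass / s"
  have b: "0 < b" using angular_mass_pos s_pos by (simp add: b_def)
  have eq: "measure P {x. a < norm x} = b * a powr (- s) * (s / angular_mass * a powr s * measure P {x. a < norm x})"
    if "0 < a" for a
    using that s_pos angular_mass_pos by (simp add: b_def powr_minus field_simps)
  show ?thesis
  proof (rule that[OF b, of "max T T'"])
    show "0 < max T T'" using TC by simp
    fix a assume a: "max T T' \<le> a"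
    define v where "v = s / angular_mass * a powr s * measure P {x. a < norm x}"
    have "\<bar>v - 1\<bar> \<le> 1 / 2" using *[OF a] by (simp only: v_def)
    then have v: "1 / 2 \<le> v" "v \<le> 2" by linarith+
    have a0: "0 < a" using a TC by simp
    have w: "0 \<le> b * a powr (- s)" using b by simp
    have m: "measure P {x. a < norm x} = b * a powr (- s) * v"
      unfolding v_def by (rule eq[OF a0])
    show "b / 2 * a powr (- s) \<le> measure P {x. a < norm x}"
      using mult_left_mono[OF v(1) w] unfolding m by simp
    show "measure P {x. a < norm x} \<le> 2 * b * a powr (- s)"
      using mult_left_mono[OF v(2) w] unfolding m by simp
  qed
qed

end

subsection \<open>Order statistics and quantiles\<close>

lemma length_filter_rev_sort: "length (filter Q (rev (sort xs))) = length (filter Q xs)"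
  by (metis length_rev mset_filter mset_rev mset_sort size_mset)

text \<open>The kth largest value is the last of the first k entries of the descending list, so all
  k of them reach the level. With the next lemma this turns events about the threshold into events
  about a count.\<close>

lemma kth_largest_geD:
  assumes "1 \<le> k" "k \<le> length xs" "a \<le> kth_largest k xs"
  shows "k \<le> length (filter (\<lambda>x. a \<le> x) xs)"
proof -
  let ?ys = "rev (sort xs)"
  have "a \<le> y" if y: "y \<in> set (take k ?ys)" for y
  proof -
    from y obtain i where i: "i < k" "y = ?ys ! i" using assms(2) by (auto simp: in_set_conv_nth)
    have "?ys ! (k - 1) \<le> ?ys ! i"
      using i assms by (intro sorted_rev_nth_mono) auto
    then show ?thesis using assms i by (simp add: kth_largest_def)
  qed
  then have "filter (\<lambda>x. a \<le> x) (take k ?ys) = take k ?ys" by (simp add: filter_id_conv)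
  then have "k \<le> length (filter (\<lambda>x. a \<le> x) (take k ?ys @ drop k ?ys))"
    using assms(2) unfolding filter_append by simp
  then show ?thesis by (simp add: length_filter_rev_sort)
qed

lemma kth_largest_lessD:
  assumes "1 \<le> k" "k \<le> length xs" "kth_largest k xs < a"
  shows "length (filter (\<lambda>x. a \<le> x) xs) < k"
proof -
  let ?ys = "rev (sort xs)"
  \<comment> \<open>Position k - 1 holds the kth largest value itself, so at most the k - 1 entries
    before it can reach the level.\<close>
  have "y < a" if y: "y \<in> set (drop (k - 1) ?ys)" for y
  proof -
    from y obtain i where "i < length xs - (k - 1)" "y = ?ys ! (k - 1 + i)"
      using assms by (auto simp: in_set_conv_nth)
    then have i: "k - 1 + i < length xs" "y = ?ys ! (k - 1 + i)" by auto
    have "?ys ! (k - 1 + i) \<le> ?ys ! (k - 1)"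
      using i assms by (intro sorted_rev_nth_mono) auto
    then show ?thesis using assms i by (simp add: kth_largest_def)
  qed
  then have "filter (\<lambda>x. a \<le> x) (drop (k - 1) ?ys) = []"
    by (auto simp: filter_empty_conv not_le)
  then have "length (filter (\<lambda>x. a \<le> x) (take (k - 1) ?ys @ drop (k - 1) ?ys)) \<le> k - 1"
    unfolding filter_append by (simp add: le_trans[OF length_filter_le])
  then have "length (filter (\<lambda>x. a \<le> x) ?ys) \<le> k - 1" by (simp only: append_take_drop_id)
  then show ?thesis using assms(1) by (simp add: length_filter_rev_sort)
qed

definition exceedance_count :: "(nat \<Rightarrow> 'w \<Rightarrow> 'a::real_normed_vector) \<Rightarrow> nat \<Rightarrow> real \<Rightarrow> 'w \<Rightarrow> nat" where
  "exceedance_count \<xi> n a \<omega> = length (filter (\<lambda>x. a \<le> x) (map norm (sample \<xi> n \<omega>)))"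

lemma exceedance_count_eq_card: "exceedance_count \<xi> n a \<omega> = card {i \<in> {1..n}. a \<le> norm (\<xi> i \<omega>)}"
proof -
  have "exceedance_count \<xi> n a \<omega> = length (filter (\<lambda>i. a \<le> norm (\<xi> i \<omega>)) [1..<Suc n])"
    by (simp add: exceedance_count_def sample_def filter_map o_def del: upt_Suc)
  also have "\<dots> = card (set (filter (\<lambda>i. a \<le> norm (\<xi> i \<omega>)) [1..<Suc n]))"
    by (rule distinct_card[symmetric]) simp
  also have "set (filter (\<lambda>i. a \<le> norm (\<xi> i \<omega>)) [1..<Suc n]) = {i \<in> {1..n}. a \<le> norm (\<xi> i \<omega>)}"
    by auto
  finally show ?thesis .
qed

lemma length_sample [simp]: "length (sample \<xi> n \<omega>) = n"
  by (simp add: sample_def)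

lemma le_quantile:
  assumes "real_distribution N" "cdf N x < p" "p < 1"
  shows "x \<le> quantile N p"
proof -
  interpret real_distribution N by fact
  \<comment> \<open>As p < 1, the set under \<open>Inf\<close> is nonempty; the infimum of the empty
    set of reals is an unspecified value.\<close>
  have "\<forall>\<^sub>F y in at_top. p < cdf N y"
    using cdf_lim_at_top_prob assms(3) by (rule order_tendstoD)
  then obtain y where "p < cdf N y" using eventually_happens[of _ "at_top::real filter"] by auto
  then have ne: "{y. p \<le> cdf N y} \<noteq> {}" by (auto intro: less_imp_le)
  show ?thesis
    unfolding quantile_def
  proof (rule cInf_greatest[OF ne])
    fix y assume "y \<in> {y. p \<le> cdf N y}"
    then have "cdf N x < cdf N y" using assms(2) by simp
    then show "x \<le> y" using cdf_nondecreasing[of y x] by (meson leD le_cases)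
  qed
qed

lemma cdf_distr_norm:
  fixes P :: "'a::euclidean_space measure"
  assumes "prob_space P" "sets P = sets borel"
  shows "cdf (distr P borel norm) x = 1 - measure P {y. x < norm y}"
proof -
  interpret P: prob_space P by fact
  have sp: "space P = UNIV" using sets_eq_imp_space_eq[OF assms(2)] by simp
  have m: "norm \<in> borel_measurable P" using assms(2) by (simp cong: measurable_cong_sets)
  have S: "{y. x < norm y} \<in> sets P" unfolding assms(2) by measurable
  have "cdf (distr P borel norm) x = measure P (space P - {y. x < norm y})"
    unfolding cdf_def by (subst measure_distr[OF m]) (auto simp: sp intro!: arg_cong[of _ _ "measure P"])
  then show ?thesis using P.prob_compl[OF S] by simp
qed

section \<open>Exceedance counts of an i.i.d. sample\<close>

locale iid_sample = M: prob_space M for M :: "'w measure" +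
  fixes \<xi> :: "nat \<Rightarrow> 'w \<Rightarrow> 'a::euclidean_space" and P :: "'a measure"
  assumes indep: "M.indep_vars (\<lambda>_. borel) \<xi> {1..}"
    and law: "\<And>i. 1 \<le> i \<Longrightarrow> distr M borel (\<xi> i) = P"
begin

lemma \<xi>_measurable: "1 \<le> i \<Longrightarrow> \<xi> i \<in> borel_measurable M"
  using indep unfolding M.indep_vars_def by auto

lemma event_exceed: "1 \<le> i \<Longrightarrow> {\<omega> \<in> space M. a \<le> norm (\<xi> i \<omega>)} \<in> sets M"
  using \<xi>_measurable by measurable

lemma prob_exceed:
  assumes "1 \<le> i" shows "measure M {\<omega> \<in> space M. a \<le> norm (\<xi> i \<omega>)} = measure P {x. a \<le> norm x}"
proof -
  have "{x::'a. a \<le> norm x} \<in> sets borel" by measurable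
  then have "measure P {x. a \<le> norm x} = measure M (\<xi> i -` {x. a \<le> norm x} \<inter> space M)"
    unfolding law[OF assms, symmetric] using \<xi>_measurable[OF assms] by (intro measure_distr)
  also have "\<xi> i -` {x. a \<le> norm x} \<inter> space M = {\<omega> \<in> space M. a \<le> norm (\<xi> i \<omega>)}" by auto
  finally show ?thesis by simp
qed

lemma count_eq_sum: "exceedance_count \<xi> n a \<omega> = (\<Sum>i\<in>{1..n}. if a \<le> norm (\<xi> i \<omega>) then 1 else 0)"
proof -
  have "{1..n} \<inter> {i. a \<le> norm (\<xi> i \<omega>)} = {i \<in> {1..n}. a \<le> norm (\<xi> i \<omega>)}" by auto
  then show ?thesis unfolding exceedance_count_eq_card by (subst sum.If_cases) auto
qed

lemma count_measurable: "(\<lambda>\<omega>. real (exceedance_count \<xi> n a \<omega>)) \<in> borel_measurable M"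
  unfolding count_eq_sum of_nat_sum
proof (rule borel_measurable_sum)
  fix i assume "i \<in> {1..n}"
  then have [measurable]: "\<xi> i \<in> borel_measurable M" using \<xi>_measurable by simp
  show "(\<lambda>\<omega>. real (if a \<le> norm (\<xi> i \<omega>) then 1 else 0)) \<in> borel_measurable M" by measurable
qed

text \<open>Markov's inequality for the count, whose mean is n times the exceedance probability by
  linearity.\<close>

lemma prob_count_ge:
  assumes "0 < k"
  shows "{\<omega> \<in> space M. k \<le> exceedance_count \<xi> n a \<omega>} \<in> sets M"
    and "measure M {\<omega> \<in> space M. k \<le> exceedance_count \<xi> n a \<omega>} \<le> real n * measure P {x. a \<le> norm x} / real k"
proof -
  let ?S = "{\<omega> \<in> space M. k \<le> exceedance_count \<xi> n a \<omega>}"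
  have eq: "?S = {\<omega> \<in> space M. real k \<le> real (exceedance_count \<xi> n a \<omega>)}" by simp
  show "?S \<in> sets M" unfolding eq using count_measurable by measurable
  have int: "integrable M (\<lambda>\<omega>. indicator {\<omega> \<in> space M. a \<le> norm (\<xi> i \<omega>)} \<omega> :: real)" if "i \<in> {1..n}" for i
    using that event_exceed[of i a] by (intro integrable_real_indicator) (auto simp: M.emeasure_eq_measure)
  have sum: "real (exceedance_count \<xi> n a \<omega>) = (\<Sum>i\<in>{1..n}. indicator {\<omega> \<in> space M. a \<le> norm (\<xi> i \<omega>)} \<omega>)"
    if "\<omega> \<in> space M" for \<omega>
    unfolding count_eq_sum of_nat_sum using that by (intro sum.cong) (auto simp: indicator_def)
  have "M.expectation (\<lambda>\<omega>. real (exceedance_count \<xi> n a \<omega>))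
      = M.expectation (\<lambda>\<omega>. \<Sum>i\<in>{1..n}. indicator {\<omega> \<in> space M. a \<le> norm (\<xi> i \<omega>)} \<omega>)"
    using sum by (intro Bochner_Integration.integral_cong) auto
  also have "\<dots> = (\<Sum>i\<in>{1..n}. M.expectation (indicator {\<omega> \<in> space M. a \<le> norm (\<xi> i \<omega>)}))"
    using int by (intro Bochner_Integration.integral_sum) auto
  also have "\<dots> = (\<Sum>i\<in>{1..n}. measure P {x. a \<le> norm x})"
  proof (rule sum.cong[OF refl])
    fix i assume i: "i \<in> {1..n}"
    have "{\<omega> \<in> space M. a \<le> norm (\<xi> i \<omega>)} \<inter> space M = {\<omega> \<in> space M. a \<le> norm (\<xi> i \<omega>)}" by auto
    then show "M.expectation (indicator {\<omega> \<in> space M. a \<le> norm (\<xi> i \<omega>)}) = measure P {x. a \<le> norm x}"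
      using i prob_exceed[of i a] by simp
  qed
  also have "\<dots> = real n * measure P {x. a \<le> norm x}" by simp
  finally have E: "M.expectation (\<lambda>\<omega>. real (exceedance_count \<xi> n a \<omega>)) = real n * measure P {x. a \<le> norm x}" .
  have "integrable M (\<lambda>\<omega>. \<Sum>i\<in>{1..n}. indicator {\<omega> \<in> space M. a \<le> norm (\<xi> i \<omega>)} \<omega> :: real)"
    using int by (intro Bochner_Integration.integrable_sum) auto
  then have "integrable M (\<lambda>\<omega>. real (exceedance_count \<xi> n a \<omega>))"
    by (subst Bochner_Integration.integrable_cong[OF refl sum]) auto
  then have "measure M {\<omega> \<in> space M. real k \<le> real (exceedance_count \<xi> n a \<omega>)}
      \<le> M.expectation (\<lambda>\<omega>. real (exceedance_count \<xi> n a \<omega>)) / real k"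
    using assms by (intro integral_Markov_inequality_measure[where A="{}"]) auto
  then show "measure M ?S \<le> real n * measure P {x. a \<le> norm x} / real k"
    unfolding E eq .
qed

text \<open>Chernoff bound at the point \<open>1/2\<close> of the generating function of the count.\<close>
lemma prob_count_less:
  shows "{\<omega> \<in> space M. exceedance_count \<xi> n a \<omega> < k} \<in> sets M"
    and "measure M {\<omega> \<in> space M. exceedance_count \<xi> n a \<omega> < k}
      \<le> 2 ^ k * exp (- (real n * measure P {x. a \<le> norm x} / 2))"
proof -
  let ?S = "{\<omega> \<in> space M. exceedance_count \<xi> n a \<omega> < k}"
  define p where "p = measure P {x. a \<le> norm x}"
  have eq: "?S = {\<omega> \<in> space M. real (exceedance_count \<xi> n a \<omega>) < real k}" by simp
  show S: "?S \<in> sets M" unfolding eq using count_measurable by measurable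
  \<comment> \<open>\<open>Y i\<close> is 1/2 to the power of the exceedance indicator, so the
    product over i is 1/2 to the power of the count, and independence gives its mean.\<close>
  define Y where "Y i \<omega> = (if a \<le> norm (\<xi> i \<omega>) then 1 / 2 else 1 :: real)" for i \<omega>
  have Yle: "0 \<le> Y i \<omega>" "Y i \<omega> \<le> 1" for i \<omega> by (auto simp: Y_def)
  have Ym: "Y i \<in> borel_measurable M" if "1 \<le> i" for i
    using \<xi>_measurable[OF that] unfolding Y_def by measurable
  have ind: "M.indep_vars (\<lambda>_. borel) Y {1..n}"
  proof -
    have "M.indep_vars (\<lambda>_. borel) (\<lambda>i \<omega>. (\<lambda>x. if a \<le> norm x then 1 / 2 else 1 :: real) (\<xi> i \<omega>)) {1..n}"
      using M.indep_vars_subset[OF indep, of "{1..n}"] by (rule M.indep_vars_compose2) auto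
    then show ?thesis by (simp only: Y_def[abs_def])
  qed
  have int: "integrable M (Y i)" if "i \<in> {1..n}" for i
    using that Ym Yle by (intro M.integrable_const_bound[of _ 1]) auto
  have EY: "M.expectation (Y i) = 1 - p / 2" if i: "i \<in> {1..n}" for i
  proof -
    let ?A = "{\<omega> \<in> space M. a \<le> norm (\<xi> i \<omega>)}"
    have A: "?A \<in> sets M" using i by (intro event_exceed) auto
    have Int: "?A \<inter> space M = ?A" by auto
    have "M.expectation (Y i) = M.expectation (\<lambda>\<omega>. 1 - indicator ?A \<omega> / 2)"
      by (intro Bochner_Integration.integral_cong) (auto simp: Y_def indicator_def)
    also have "\<dots> = 1 - measure M ?A / 2"
      using A by (subst Bochner_Integration.integral_diff) (auto simp: M.prob_space Int M.emeasure_eq_measure)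
    finally show ?thesis using prob_exceed[of i a] i by (simp add: p_def)
  qed
  have Eprod: "M.expectation (\<lambda>\<omega>. \<Prod>i\<in>{1..n}. Y i \<omega>) = (1 - p / 2) ^ n"
    using M.indep_vars_lebesgue_integral[OF _ ind int] EY by simp
  have iprod: "integrable M (\<lambda>\<omega>. \<Prod>i\<in>{1..n}. Y i \<omega>)"
    using M.indep_vars_integrable[OF _ ind int] by simp
  have prod: "(\<Prod>i\<in>{1..n}. Y i \<omega>) = (1 / 2) ^ exceedance_count \<xi> n a \<omega>" for \<omega>
  proof -
    have "{1..n} \<inter> {i. a \<le> norm (\<xi> i \<omega>)} = {i \<in> {1..n}. a \<le> norm (\<xi> i \<omega>)}" by auto
    then show ?thesis unfolding exceedance_count_eq_card Y_def by (subst prod.If_cases) auto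
  qed
  have "measure M ?S \<le> measure M {\<omega> \<in> space M. (1 / 2) ^ k \<le> (\<Prod>i\<in>{1..n}. Y i \<omega>)}"
  proof (rule M.finite_measure_mono)
    show "?S \<subseteq> {\<omega> \<in> space M. (1 / 2) ^ k \<le> (\<Prod>i\<in>{1..n}. Y i \<omega>)}"
      unfolding prod by (auto intro!: power_decreasing)
    show "{\<omega> \<in> space M. (1 / 2) ^ k \<le> (\<Prod>i\<in>{1..n}. Y i \<omega>)} \<in> sets M"
      using borel_measurable_integrable[OF iprod] by measurable
  qed
  also have "\<dots> \<le> (1 - p / 2) ^ n / (1 / 2) ^ k"
    unfolding Eprod[symmetric]
    by (rule integral_Markov_inequality_measure[where A="{}"]) (use iprod Yle in \<open>auto intro!: prod_nonneg\<close>)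
  also have "\<dots> = 2 ^ k * (1 - p / 2) ^ n"
    by (simp add: power_one_over)
  \<comment> \<open>Uses 1 - x <= exp (- x); raising it to the power n needs a nonnegative base, and
    p <= 1 is read off the event for \<open>\<xi> 1\<close>.\<close>
  also have "(1 - p / 2) ^ n \<le> exp (- (p / 2)) ^ n"
  proof (rule power_mono)
    show "1 - p / 2 \<le> exp (- (p / 2))" using exp_ge_add_one_self[of "- (p / 2)"] by simp
    have "p \<le> 1" if "1 \<le> n"
      unfolding p_def prob_exceed[OF order_refl, symmetric] by simp
    then show "0 \<le> 1 - p / 2"
    proof (cases "1 \<le> n")
      case False
      have "p \<le> 1" unfolding p_def prob_exceed[OF order_refl, symmetric] by simp
      then show ?thesis by simp
    qed simp
  qed
  also have "exp (- (p / 2)) ^ n = exp (- (real n * p / 2))"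
    by (simp add: exp_of_nat_mult[symmetric])
  finally show "measure M ?S \<le> 2 ^ k * exp (- (real n * measure P {x. a \<le> norm x} / 2))"
    by (simp add: p_def)
qed

end

subsection \<open>Rates\<close>

context closed_cone
begin

lemma stress_summary_measurable:
  fixes L Ls :: "'k::finite \<Rightarrow> 'a \<Rightarrow> real"
  assumes losses: "asymp_homogeneous E L Ls" and W: "W \<in> measurable borel K" and u: "0 < u"
  shows "stress_summary W L u \<in> measurable (restrict_space borel E) K"
proof -
  have sc: "(\<lambda>z. u *\<^sub>R z) \<in> measurable (restrict_space borel E) (restrict_space borel E)"
    using u by (intro measurable_restrict_space3) (auto intro!: scale_mem_cone)
  have L: "(\<lambda>z. L j (u *\<^sub>R z) / u) \<in> borel_measurable (restrict_space borel E)" for j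
    using losses measurable_compose[OF sc, of "L j" borel] by (auto simp: asymp_homogeneous_def)
  have "(\<lambda>z. \<chi> j. L j (u *\<^sub>R z) / u) \<in> borel_measurable (restrict_space borel E)"
    by (subst borel_measurable_euclidean_space) (use L in \<open>auto simp: Basis_vec_def inner_axis\<close>)
  from measurable_compose[OF this W] show ?thesis
    by (simp add: stress_summary_def[abs_def])
qed

end

definition tail_count :: "real \<Rightarrow> nat \<Rightarrow> nat" where
  "tail_count q n = nat \<lfloor>real n powr (1 - q)\<rfloor>"

lemma powr_at_top:
  assumes "0 < (a::real)" shows "filterlim (\<lambda>n. real n powr a) at_top sequentially"
proof (rule filterlim_at_top_mono)
  show "filterlim (\<lambda>n. exp (a * ln (real n))) at_top sequentially"
    using assms by (intro filterlim_compose[OF exp_at_top] filterlim_tendsto_pos_mult_at_top[OF tendsto_const]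
      filterlim_compose[OF ln_at_top filterlim_real_sequentially])
  show "\<forall>\<^sub>F n in sequentially. exp (a * ln (real n)) \<le> real n powr a"
    using eventually_gt_at_top[of 0] by eventually_elim (simp add: powr_def)
qed

context
  fixes q :: real
  assumes q: "0 < q" "q < 1"
begin

lemma tail_count_le: "real (tail_count q n) \<le> real n powr (1 - q)"
  by (simp add: tail_count_def)

lemma tail_count_ge: "real n powr (1 - q) - 1 \<le> real (tail_count q n)"
proof -
  have "real n powr (1 - q) - 1 \<le> real_of_int \<lfloor>real n powr (1 - q)\<rfloor>" by linarith
  then show ?thesis by (simp add: tail_count_def)
qed

lemma tail_count_at_top: "filterlim (\<lambda>n. real (tail_count q n)) at_top sequentially"
proof (rule filterlim_at_top_mono)
  show "filterlim (\<lambda>n. real n powr (1 - q) - 1) at_top sequentially"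
    using filterlim_tendsto_add_at_top[OF tendsto_const powr_at_top[of "1 - q"], of "- 1"] q by simp
qed (simp add: tail_count_ge)

lemma tail_count_half: "\<forall>\<^sub>F n in sequentially. real n powr (1 - q) / 2 \<le> real (tail_count q n)"
proof -
  \<comment> \<open>From x = 2 on, x - 1 >= x / 2, so rounding down costs at most a factor
    2.\<close>
  have "\<forall>\<^sub>F n in sequentially. 2 \<le> real n powr (1 - q)"
    using powr_at_top[of "1 - q"] q by (simp add: filterlim_at_top)
  then show ?thesis
    by eventually_elim (use tail_count_ge in \<open>smt (verit) field_sum_of_halves\<close>)
qed

lemma tail_count_le_n: "1 \<le> n \<Longrightarrow> tail_count q n \<le> n"
proof -
  assume "1 \<le> n"
  then have "real n powr (1 - q) \<le> real n powr 1" using q by (intro powr_mono) auto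
  then have "real (tail_count q n) \<le> real n" using tail_count_le[of n] \<open>1 \<le> n\<close> by simp
  then show ?thesis by simp
qed

text \<open>The exponent \<open>m'\<close> will be \<open>min m l\<close>, which brings both
  estimation rates to a common form. The constant 2 bounds \<open>2 powr m\<close>, the trace of
  rounding down.\<close>

lemma tail_count_rate:
  assumes "0 \<le> m'" "m' \<le> m" "m \<le> 1 / 2"
  shows "\<forall>\<^sub>F n in sequentially. real (tail_count q n) powr (- m) \<le> 2 * real n powr (- ((1 - q) * m'))"
  using tail_count_half eventually_ge_at_top[of 1]
proof eventually_elim
  case (elim n)
  have "real (tail_count q n) powr (- m) \<le> (real n powr (1 - q) / 2) powr (- m)"
    using elim assms by (intro powr_mono2') auto
  also have "\<dots> = 2 powr m * real n powr (- ((1 - q) * m))"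
  proof -
    have "x / 2 powr (- m) = 2 powr m * x" for x :: real by (simp add: powr_minus field_simps)
    moreover have "(real n powr (1 - q) / 2) powr (- m) = real n powr (- ((1 - q) * m)) / 2 powr (- m)"
      by (simp add: powr_divide powr_powr)
    ultimately show ?thesis by simp
  qed
  also have "\<dots> \<le> 2 powr 1 * real n powr (- ((1 - q) * m'))"
    using elim assms q by (intro mult_mono powr_mono) (auto intro!: mult_left_mono)
  finally show ?case by simp
qed

end

text \<open>Turns a lower bound on a level into an upper bound on the bias there: \<rho> = q for the
  threshold and \<rho> = r for the stress level, both brought to the exponent q.\<close>

lemma powr_rate:
  fixes K v s \<gamma> \<rho> q :: real
  assumes "0 < K" "K * real n powr (\<rho> / s) \<le> v" "q \<le> \<rho>" "1 \<le> n" "0 < s" "0 < \<gamma>"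
  shows "v powr (- \<gamma>) \<le> K powr (- \<gamma>) * real n powr (- (q * \<gamma> / s))"
proof -
  have "v powr (- \<gamma>) \<le> (K * real n powr (\<rho> / s)) powr (- \<gamma>)"
    using assms by (intro powr_mono2') auto
  also have "\<dots> = K powr (- \<gamma>) * real n powr (- (\<rho> * \<gamma> / s))"
    using assms by (simp add: powr_mult powr_powr)
  also have "\<dots> \<le> K powr (- \<gamma>) * real n powr (- (q * \<gamma> / s))"
    using assms by (intro mult_left_mono powr_mono) (auto intro!: divide_right_mono mult_right_mono)
  finally show ?thesis .
qed

context second_order_tail
begin

lemma quantile_rate:
  assumes r: "0 < r" and u: "\<And>n. u n = quantile (distr P borel norm) (1 - real n powr (- r))"
  obtains K where "0 < K" "\<forall>\<^sub>F n in sequentially. K * real n powr (r / s) \<le> u n"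
proof -
  obtain b T where b: "0 < b" "0 < T"
    "\<And>a. T \<le> a \<Longrightarrow> b / 2 * a powr (- s) \<le> measure P {x. a < norm x}"
    using tail_mass_bounds by metis
  \<comment> \<open>Chosen so that \<open>b / 2 * K powr (- s) = 2\<close>: the tail mass at the
    claimed radius is then at least twice the level \<open>n powr (- r)\<close> of the
    quantile.\<close>
  define K where "K = (b / 4) powr (1 / s)"
  have K: "0 < K" using b by (simp add: K_def)
  have Ks: "K powr (- s) = 4 / b"
    using b s_pos by (simp add: K_def powr_powr powr_minus)
  have rd: "real_distribution (distr P borel norm)"
    by (intro real_distribution.intro real_distribution_axioms.intro P.prob_space_distr) auto
  have "filterlim (\<lambda>n. K * real n powr (r / s)) at_top sequentially"
    using K r s_pos by (intro filterlim_tendsto_pos_mult_at_top[OF tendsto_const] powr_at_top) auto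
  then have "\<forall>\<^sub>F n in sequentially. T \<le> K * real n powr (r / s)"
    by (simp add: filterlim_at_top)
  then have "\<forall>\<^sub>F n in sequentially. K * real n powr (r / s) \<le> u n"
    using eventually_ge_at_top[of 1]
  proof eventually_elim
    case (elim n)
    have pos: "0 < real n powr (- r)" using elim by simp
    let ?x = "K * real n powr (r / s)"
    have "?x powr (- s) = 4 / b * real n powr (- r)"
      using K s_pos elim by (simp add: powr_mult powr_powr Ks)
    then have "b / 2 * ?x powr (- s) = 2 * real n powr (- r)" using b by simp
    then have "real n powr (- r) < measure P {x. ?x < norm x}"
      using b(3)[OF elim(1)] pos by linarith
    then have "cdf (distr P borel norm) ?x < 1 - real n powr (- r)"
      by (simp add: cdf_distr_norm[OF prob_P])
    then show ?case unfolding u by (rule le_quantile[OF rd]) (use pos in simp)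
  qed
  with K show ?thesis by (rule that)
qed

end

section \<open>Size of the random threshold\<close>

locale sampled_tail = second_order_tail E f \<phi>s P s \<gamma> + iid_sample M \<xi> P
  for E :: "'a::euclidean_space set" and f \<phi>s P s \<gamma> and M :: "'w measure" and \<xi> +
  fixes q :: real
  assumes q: "0 < q" "q < 1"
begin

definition threshold :: "nat \<Rightarrow> 'w \<Rightarrow> real" where
  "threshold n \<omega> = kth_largest (tail_count q n) (map norm (sample \<xi> n \<omega>))"

lemma threshold_lower:
  obtains K where "0 < K"
    "\<And>\<epsilon>. 0 < \<epsilon> \<Longrightarrow> \<forall>\<^sub>F n in sequentially. \<exists>B\<in>sets M.
      {\<omega> \<in> space M. threshold n \<omega> < K * real n powr (q / s)} \<subseteq> B \<and> measure M B \<le> \<epsilon>"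
proof -
  obtain b T where b: "0 < b" "0 < T"
    "\<And>a. T \<le> a \<Longrightarrow> b / 2 * a powr (- s) \<le> measure P {x. a < norm x}"
    using tail_mass_bounds by metis
  \<comment> \<open>Chosen so that \<open>b / 2 * K powr (- s) = 4\<close>: the expected number of
    exceedances of the claimed radius is then at least four times the number k of retained
    points.\<close>
  define K where "K = (b / 8) powr (1 / s)"
  have K: "0 < K" using b by (simp add: K_def)
  have Ks: "K powr (- s) = 8 / b"
    using b s_pos by (simp add: K_def powr_powr powr_minus)
  have "filterlim (\<lambda>n. K * real n powr (q / s)) at_top sequentially"
    using K q s_pos by (intro filterlim_tendsto_pos_mult_at_top[OF tendsto_const] powr_at_top) auto
  then have evT: "\<forall>\<^sub>F n in sequentially. T \<le> K * real n powr (q / s)"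
    by (simp add: filterlim_at_top)
  have ev1: "\<forall>\<^sub>F n in sequentially. 1 \<le> real (tail_count q n)"
    using tail_count_at_top[OF q] unfolding filterlim_at_top by blast
  show ?thesis
  proof (rule that[OF K])
    fix \<epsilon> :: real assume \<epsilon>: "0 < \<epsilon>"
    have "((\<lambda>n. exp (- real (tail_count q n))) \<longlongrightarrow> 0) sequentially"
      by (intro filterlim_compose[OF exp_at_bot] filterlim_compose[OF filterlim_uminus_at_bot_at_top] tail_count_at_top[OF q])
    then have "\<forall>\<^sub>F n in sequentially. exp (- real (tail_count q n)) < \<epsilon>"
      using \<epsilon> by (rule order_tendstoD)
    then show "\<forall>\<^sub>F n in sequentially. \<exists>B\<in>sets M.
      {\<omega> \<in> space M. threshold n \<omega> < K * real n powr (q / s)} \<subseteq> B \<and> measure M B \<le> \<epsilon>"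
      using evT ev1 eventually_ge_at_top[of 1]
    proof eventually_elim
      case (elim n)
      let ?k = "tail_count q n" and ?a = "K * real n powr (q / s)"
      define p where "p = measure P {x. ?a \<le> norm x}"
      have "?a powr (- s) = 8 / b * real n powr (- q)"
        using K s_pos elim by (simp add: powr_mult powr_powr Ks)
      then have "b / 2 * ?a powr (- s) = 4 * real n powr (- q)" using b by simp
      moreover have "measure P {x. ?a < norm x} \<le> p"
        unfolding p_def by (intro P.finite_measure_mono) auto
      ultimately have "4 * real n powr (- q) \<le> p"
        using b(3)[OF elim(2)] by linarith
      then have "real n * (4 * real n powr (- q)) \<le> real n * p"
        by (intro mult_left_mono) auto
      moreover have "real n * real n powr (- q) = real n powr (1 - q)"
        using elim powr_add[of "real n" 1 "- q"] by simp
      ultimately have np: "4 * real ?k \<le> real n * p"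
        using tail_count_le[OF q, of n] by simp
      \<comment> \<open>A mean of at least 4k makes the Chernoff exponent at least 2k, and 2 <= exp
        1 pays for the factor \<open>2 ^ k\<close> with half of it.\<close>
      have "2 ^ ?k * exp (- (real n * p / 2)) \<le> exp 1 ^ ?k * exp (- (2 * real ?k))"
        using np exp_ge_add_one_self[of 1] by (intro mult_mono power_mono) auto
      also have "\<dots> = exp (- real ?k)"
        by (simp add: exp_of_nat_mult[symmetric] exp_add[symmetric])
      finally have "measure M {\<omega> \<in> space M. exceedance_count \<xi> n ?a \<omega> < ?k} \<le> exp (- real ?k)"
        using prob_count_less(2)[of n ?a ?k] unfolding p_def by linarith
      then have "measure M {\<omega> \<in> space M. exceedance_count \<xi> n ?a \<omega> < ?k} \<le> \<epsilon>"
        using elim by linarith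
      moreover have "exceedance_count \<xi> n ?a \<omega> < ?k" if "threshold n \<omega> < ?a" for \<omega>
        using kth_largest_lessD[of ?k "map norm (sample \<xi> n \<omega>)" ?a] that elim tail_count_le_n[OF q, of n]
        by (simp add: exceedance_count_def threshold_def)
      then have "{\<omega> \<in> space M. threshold n \<omega> < ?a} \<subseteq> {\<omega> \<in> space M. exceedance_count \<xi> n ?a \<omega> < ?k}"
        by blast
      ultimately show ?case using prob_count_less(1) by blast
    qed
  qed
qed

text \<open>For r >= 1 the expected number of points beyond a multiple of
  \<open>n powr (r / s)\<close> stays bounded, while k points have to lie there for the threshold to
  reach that level, and k tends to infinity.\<close>

lemma threshold_upper:
  assumes r: "1 \<le> r" and K: "0 < K" and v: "\<forall>\<^sub>F n in sequentially. K * real n powr (r / s) \<le> v n"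
    and \<epsilon>: "0 < \<epsilon>"
  shows "\<forall>\<^sub>F n in sequentially. \<exists>B\<in>sets M.
      {\<omega> \<in> space M. v n \<le> threshold n \<omega>} \<subseteq> B \<and> measure M B \<le> \<epsilon>"
proof -
  obtain b T where b: "0 < b" "0 < T"
    "\<And>a. T \<le> a \<Longrightarrow> measure P {x. a < norm x} \<le> 2 * b * a powr (- s)"
    using tail_mass_bounds by metis
  define c where "c = 2 * b * (K / 2) powr (- s)"
  have "filterlim (\<lambda>n. K / 2 * real n powr (r / s)) at_top sequentially"
    using K r s_pos by (intro filterlim_tendsto_pos_mult_at_top[OF tendsto_const] powr_at_top) auto
  then have evT: "\<forall>\<^sub>F n in sequentially. T \<le> K / 2 * real n powr (r / s)"
    by (simp add: filterlim_at_top)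
  have evk: "\<forall>\<^sub>F n in sequentially. max 1 (c / \<epsilon>) \<le> real (tail_count q n)"
    using tail_count_at_top[OF q] unfolding filterlim_at_top by blast
  show ?thesis
    using v evT evk eventually_ge_at_top[of 1]
  proof eventually_elim
    case (elim n)
    \<comment> \<open>Halving K turns the weak inequality \<open>v n \<le> norm x\<close> into the
      strict one of the tail bound.\<close>
    let ?k = "tail_count q n" and ?x = "K / 2 * real n powr (r / s)"
    define p where "p = measure P {x. v n \<le> norm x}"
    have k: "1 \<le> ?k" "c / \<epsilon> \<le> real ?k" using elim by auto
    have x: "0 < ?x" using b(2) elim(2) by linarith
    have "p \<le> measure P {x. ?x < norm x}"
      unfolding p_def using elim(1) x by (intro P.finite_measure_mono) auto
    also have "\<dots> \<le> 2 * b * ?x powr (- s)" by (rule b(3)[OF elim(2)])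
    also have "?x powr (- s) = (K / 2) powr (- s) * real n powr (- r)"
      using K s_pos elim by (simp only: powr_mult powr_powr) simp
    finally have "p \<le> c * real n powr (- r)" by (simp add: c_def mult.assoc)
    then have "real n * p \<le> real n * (c * real n powr (- r))"
      by (intro mult_left_mono) auto
    also have "\<dots> = c * real n powr (1 - r)"
      using elim powr_add[of "real n" 1 "- r"] by (simp add: mult_ac)
    also have "\<dots> \<le> c * real n powr 0"
      using elim r b by (intro mult_left_mono powr_mono) (auto simp: c_def)
    also have "\<dots> \<le> \<epsilon> * real ?k"
      using k(2) \<epsilon> elim by (simp add: field_simps)
    finally have "real n * p / real ?k \<le> \<epsilon>"
      using k by (simp add: divide_le_eq)
    then have "measure M {\<omega> \<in> space M. ?k \<le> exceedance_count \<xi> n (v n) \<omega>} \<le> \<epsilon>"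
      using prob_count_ge(2)[of ?k n "v n"] k unfolding p_def by linarith
    moreover have "?k \<le> exceedance_count \<xi> n (v n) \<omega>" if "v n \<le> threshold n \<omega>" for \<omega>
      using kth_largest_geD[of ?k "map norm (sample \<xi> n \<omega>)" "v n"] that k elim tail_count_le_n[OF q, of n]
      by (simp add: exceedance_count_def threshold_def)
    then have "{\<omega> \<in> space M. v n \<le> threshold n \<omega>} \<subseteq> {\<omega> \<in> space M. ?k \<le> exceedance_count \<xi> n (v n) \<omega>}"
      by blast
    ultimately show ?case using prob_count_ge(1)[of ?k n "v n"] k by auto
  qed
qed

end

section \<open>From the deterministic bound to a rate in probability\<close>

lemma big_OP_D:
  assumes "big_OP M X a" "0 < \<epsilon>" "\<And>n. 0 \<le> a n"
  obtains C where "0 \<le> C"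
    "\<forall>\<^sub>F n in sequentially. \<exists>B\<in>sets M. {\<omega> \<in> space M. \<bar>X n \<omega>\<bar> > C * a n} \<subseteq> B \<and> measure M B \<le> \<epsilon>"
proof -
  obtain C where C: "\<forall>\<^sub>F n in sequentially. \<exists>B\<in>sets M. {\<omega> \<in> space M. \<bar>X n \<omega>\<bar> > C * a n} \<subseteq> B \<and> measure M B \<le> \<epsilon>"
    using assms(1,2) unfolding big_OP_def by blast
  show ?thesis
  proof (rule that[of "max C 0"])
    show "\<forall>\<^sub>F n in sequentially. \<exists>B\<in>sets M. {\<omega> \<in> space M. \<bar>X n \<omega>\<bar> > max C 0 * a n} \<subseteq> B \<and> measure M B \<le> \<epsilon>"
      using C
    proof eventually_elim
      case (elim n)
      then obtain B where B: "B \<in> sets M" "{\<omega> \<in> space M. \<bar>X n \<omega>\<bar> > C * a n} \<subseteq> B" "measure M B \<le> \<epsilon>"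
        by blast
      have "C * a n \<le> max C 0 * a n" using assms(3) by (intro mult_right_mono) auto
      then have "{\<omega> \<in> space M. \<bar>X n \<omega>\<bar> > max C 0 * a n} \<subseteq> B" using B(2) by fastforce
      with B show ?case by blast
    qed
  qed simp
qed

theorem corollary3:
  fixes E :: "'a::euclidean_space set" and f \<phi>s :: "'a \<Rightarrow> real"
    and P :: "'a measure" and s \<gamma> q r m l :: real
    and L Ls :: "'k::finite \<Rightarrow> 'a \<Rightarrow> real" and JJ :: "'k set set" and J :: "'k set"
    and M :: "'w measure" and \<xi> :: "nat \<Rightarrow> 'w \<Rightarrow> 'a"
    and k :: "nat \<Rightarrow> nat" and t :: "nat \<Rightarrow> 'w \<Rightarrow> real" and u :: "nat \<Rightarrow> real"
    and D :: "nat \<Rightarrow> 'w \<Rightarrow> 'a list"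
    and s_hat :: "nat \<Rightarrow> 'a list \<Rightarrow> real" and \<phi>_hat :: "nat \<Rightarrow> 'a list \<Rightarrow> 'a \<Rightarrow> real"
    and P_hat :: "nat \<Rightarrow> 'w \<Rightarrow> 'a measure"
    and N :: "nat \<Rightarrow> 'a measure" and N_hat :: "nat \<Rightarrow> 'w \<Rightarrow> 'a measure"
    and \<pi> :: "nat \<Rightarrow> 'a measure" and \<pi>_hat :: "nat \<Rightarrow> 'w \<Rightarrow> 'a measure"
    and W :: "real ^ 'k \<Rightarrow> real ^ 'b::finite" and Y :: "(real ^ 'b) set"
    and G :: "nat \<Rightarrow> (real ^ 'b) measure" and G_hat :: "nat \<Rightarrow> 'w \<Rightarrow> (real ^ 'b) measure"
  assumes cone: "closed E" "cone E"
    and P: "f \<in> borel_measurable borel" "\<And>z. 0 \<le> f z" "\<And>z. z \<notin> E \<Longrightarrow> f z = 0"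
      "P = density lborel (\<lambda>z. ennreal (f z))" "prob_space P"
    and RV: "density_regularly_varying E f s \<phi>s"
    and second_order: "second_order E f s \<phi>s \<gamma>"
    and losses: "asymp_homogeneous E L Ls"
    and JJ: "{} \<notin> JJ" "regular_system E Ls JJ" "J \<in> JJ"
    and data: "prob_space M" "prob_space.indep_vars M (\<lambda>_. borel) \<xi> {1..}"
      "\<And>i. 1 \<le> i \<Longrightarrow> distr M borel (\<xi> i) = P"
    and q: "0 < q" "q < 1" and r: "1 \<le> r"
    and k: "\<And>n. k n = nat \<lfloor>real n powr (1 - q)\<rfloor>"
    and t: "\<And>n \<omega>. t n \<omega> = kth_largest (k n) (map norm (sample \<xi> n \<omega>))"
    and u: "\<And>n. u n = quantile (distr P borel norm) (1 - real n powr (- r))"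
    and D: "\<And>n \<omega>. D n \<omega> = exceedances (t n \<omega>) (sample \<xi> n \<omega>)"
    and s_hat: "\<And>n \<omega>. 1 \<le> n \<Longrightarrow> \<omega> \<in> space M \<Longrightarrow> 0 < s_hat n (D n \<omega>)"
    and \<phi>_hat: "\<And>n \<omega>. 1 \<le> n \<Longrightarrow> \<omega> \<in> space M \<Longrightarrow>
        \<phi>_hat n (D n \<omega>) \<in> borel_measurable (restrict_space borel (directions E))"
      "\<And>n \<omega> \<phi>. 1 \<le> n \<Longrightarrow> \<omega> \<in> space M \<Longrightarrow> \<phi> \<in> directions E \<Longrightarrow> 0 \<le> \<phi>_hat n (D n \<omega>) \<phi>"
      "\<And>n \<omega>. 1 \<le> n \<Longrightarrow> \<omega> \<in> space M \<Longrightarrow>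
        prob_space (density (surface_measure E) (\<lambda>\<phi>. ennreal (\<phi>_hat n (D n \<omega>) \<phi>)))"
    and ml: "0 < m" "m \<le> 1/2" "0 < l" "l \<le> 1/2"
    and s_hat_rate: "big_OP M (\<lambda>n \<omega>. \<bar>s_hat n (D n \<omega>) - s\<bar>) (\<lambda>n. real (k n) powr (- m))"
    and \<phi>_hat_rate: "big_OP M
        (\<lambda>n \<omega>. tv_dist (angular_law E P (t n \<omega>)) (density (surface_measure E) (\<lambda>\<phi>. ennreal (\<phi>_hat n (D n \<omega>) \<phi>))))
        (\<lambda>n. real (k n) powr (- l))"
    and P_hat: "\<And>n \<omega>. 1 \<le> n \<Longrightarrow> \<omega> \<in> space M \<Longrightarrow>
        ssgen_law E (t n \<omega>) (real (k n) / real n) (s_hat n (D n \<omega>)) (\<phi>_hat n (D n \<omega>)) (P_hat n \<omega>)"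
    and N: "\<And>n. prob_space (N n)" "\<And>n. sets (N n) = sets (restrict_space borel E)"
      "\<And>n \<omega>. \<omega> \<in> space M \<Longrightarrow> prob_space (N_hat n \<omega>)"
      "\<And>n \<omega>. \<omega> \<in> space M \<Longrightarrow> sets (N_hat n \<omega>) = sets (restrict_space borel E)"
    and \<pi>: "\<And>n. \<pi> n = stressed_law E P (u n) (stress_set E L (u n) J) (N n)"
    and \<pi>_hat: "\<And>n \<omega>. \<pi>_hat n \<omega> =
        stressed_law E (P_hat n \<omega>) (u n) (stress_set E L (u n) J) (N_hat n \<omega>)"
    and W: "W \<in> measurable borel (restrict_space borel Y)"
    and G: "\<And>n. G n = distr (\<pi> n) (restrict_space borel Y) (stress_summary W L (u n))"
    and G_hat: "\<And>n \<omega>. G_hat n \<omega> =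
        distr (\<pi>_hat n \<omega>) (restrict_space borel Y) (stress_summary W L (u n))"
  shows "big_OP M (\<lambda>n \<omega>. tv_dist (G_hat n \<omega>) (G n))
     (\<lambda>n. real n powr (- ((1 - q) * min m l)) + real n powr (- (q * \<gamma> / s)))"
proof -
  interpret second_order_tail E f \<phi>s P s \<gamma>
    by (intro second_order_tail.intro closed_cone.intro second_order_tail_axioms.intro) fact+
  interpret M: prob_space M by fact
  interpret sampled_tail E f \<phi>s P s \<gamma> M \<xi> q
    by (intro sampled_tail.intro iid_sample.intro iid_sample_axioms.intro sampled_tail_axioms.intro
      second_order_tail_axioms) fact+
  have J: "J \<noteq> {}" using JJ by auto
  have reg: "emeasure lebesgue (stress_set E Ls 1 J) \<noteq> 0" using JJ by (auto simp: regular_system_def)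
  have k': "k n = tail_count q n" for n by (simp add: k tail_count_def)
  have t': "t n \<omega> = threshold n \<omega>" for n \<omega> by (simp add: t k' threshold_def)
  obtain T C where TC: "0 < T" "0 \<le> C"
    "\<And>a (A :: 'a set). T \<le> a \<Longrightarrow> A \<in> sets borel \<Longrightarrow> A \<subseteq> {x. a < norm x} \<Longrightarrow>
      \<bar>s * a powr s / angular_mass * measure P A - measure (ssgen_tail E a 1 s limit_angle) A\<bar> \<le> C * a powr (- \<gamma>)"
    using tail_approx by metis
  have "((\<lambda>a. C * a powr (- \<gamma>)) \<longlongrightarrow> C * 0) at_top"
    using \<gamma>_pos by (intro tendsto_mult tendsto_const tendsto_neg_powr filterlim_ident) auto
  then have "\<forall>\<^sub>F a in at_top. C * a powr (- \<gamma>) < 1" by (rule order_tendstoD) simp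
  then obtain T' where T': "\<And>a. T' \<le> a \<Longrightarrow> C * a powr (- \<gamma>) < 1"
    unfolding eventually_at_top_linorder by auto
  obtain \<delta> where \<delta>: "0 < \<delta>" "\<forall>\<^sub>F u in at_top. stress_set E L u J \<subseteq> {x. \<delta> * u < norm x}"
    by (rule stress_set_far[OF losses J])
  obtain Ku where Ku: "0 < Ku" "\<forall>\<^sub>F n in sequentially. Ku * real n powr (r / s) \<le> u n"
    using quantile_rate[of r u] r u by auto
  have u_top: "filterlim u at_top sequentially"
  proof (rule filterlim_at_top_mono[OF _ Ku(2)])
    show "filterlim (\<lambda>n. Ku * real n powr (r / s)) at_top sequentially"
      using Ku r s_pos by (intro filterlim_tendsto_pos_mult_at_top[OF tendsto_const] powr_at_top) auto
  qed
  obtain \<kappa>0 where \<kappa>0: "0 < \<kappa>0" "\<forall>\<^sub>F n in sequentially. \<kappa>0 \<le> u n powr s * measure P (stress_set E L (u n) J)"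
    by (rule stress_probability_lower[OF losses J reg u_top])
  \<comment> \<open>The bound \<open>\<kappa>0\<close> rewritten for the level
    \<open>a = \<delta> * u n\<close> and the scaling \<open>s * a powr s / angular_mass\<close> of
    \<open>conditional_law_approx\<close>.\<close>
  define \<kappa> where "\<kappa> = s * \<delta> powr s / angular_mass * \<kappa>0"
  have \<kappa>: "0 < \<kappa>" using s_pos \<delta> angular_mass_pos \<kappa>0 by (simp add: \<kappa>_def)
  obtain Kt where Kt: "0 < Kt"
    "\<And>\<epsilon>. 0 < \<epsilon> \<Longrightarrow> \<forall>\<^sub>F n in sequentially. \<exists>B\<in>sets M.
      {\<omega> \<in> space M. threshold n \<omega> < Kt * real n powr (q / s)} \<subseteq> B \<and> measure M B \<le> \<epsilon>"
    by (rule threshold_lower) (rule that)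
  have "filterlim (\<lambda>n. Kt * real n powr (q / s)) at_top sequentially"
    using Kt q s_pos by (intro filterlim_tendsto_pos_mult_at_top[OF tendsto_const] powr_at_top) auto
  \<comment> \<open>Above T the tail estimate is available, above \<open>T'\<close> its error is
    below 1, as the angular law at the threshold requires.\<close>
  then have evT: "\<forall>\<^sub>F n in sequentially. max T T' \<le> Kt * real n powr (q / s)"
    unfolding filterlim_at_top by blast
  have ev\<delta>: "\<forall>\<^sub>F n in sequentially. \<delta> * Ku * real n powr (r / s) \<le> \<delta> * u n"
    using Ku(2) by eventually_elim (use \<delta> in \<open>simp add: mult.assoc\<close>)
  have ev_far: "\<forall>\<^sub>F n in sequentially. stress_set E L (u n) J \<subseteq> {x. \<delta> * u n < norm x}"
    using filterlim_iff[THEN iffD1, OF u_top] \<delta>(2) by blast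
  have ev_u: "\<forall>\<^sub>F n in sequentially. 0 < u n"
    using u_top by (simp add: filterlim_at_top_dense)
  have ev_k: "\<forall>\<^sub>F n in sequentially. 1 \<le> real (tail_count q n)"
    using tail_count_at_top[OF q] unfolding filterlim_at_top by blast
  let ?N1 = "\<lambda>n. real n powr (- ((1 - q) * min m l))" and ?N2 = "\<lambda>n. real n powr (- (q * \<gamma> / s))"
  have rate_m: "\<forall>\<^sub>F n in sequentially. real (k n) powr (- m) \<le> 2 * ?N1 n"
    and rate_l: "\<forall>\<^sub>F n in sequentially. real (k n) powr (- l) \<le> 2 * ?N1 n"
    unfolding k' using ml by (auto intro!: tail_count_rate q)
  let ?Ghat = "\<lambda>n \<omega>. density (surface_measure E) (\<lambda>\<phi>. ennreal (\<phi>_hat n (D n \<omega>) \<phi>))"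
  show ?thesis
    unfolding big_OP_def
  proof (intro allI impI)
    fix \<epsilon> :: real assume \<epsilon>: "0 < \<epsilon>"
    then have \<epsilon>4: "0 < \<epsilon> / 4" by simp
    obtain C1 where C1: "0 \<le> C1" "\<forall>\<^sub>F n in sequentially. \<exists>B\<in>sets M.
        {\<omega> \<in> space M. \<bar>\<bar>s_hat n (D n \<omega>) - s\<bar>\<bar> > C1 * real (k n) powr (- m)} \<subseteq> B \<and> measure M B \<le> \<epsilon> / 4"
      by (rule big_OP_D[OF s_hat_rate \<epsilon>4]) auto
    obtain C2 where C2: "0 \<le> C2" "\<forall>\<^sub>F n in sequentially. \<exists>B\<in>sets M.
        {\<omega> \<in> space M. \<bar>tv_dist (angular_law E P (t n \<omega>)) (?Ghat n \<omega>)\<bar> > C2 * real (k n) powr (- l)} \<subseteq> B \<and> measure M B \<le> \<epsilon> / 4"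
      by (rule big_OP_D[OF \<phi>_hat_rate \<epsilon>4]) auto
    \<comment> \<open>\<open>K1\<close> collects the bias, once at the stress level and twice at the
      threshold; \<open>K2\<close> collects the sampling errors, its factors 2 coming from
      \<open>tail_count_rate\<close>. The factor \<open>2 / \<kappa>\<close> in K is the cost of
      conditioning.\<close>
    define K1 where "K1 = C * (\<delta> * Ku) powr (- \<gamma>) + 2 * C * Kt powr (- \<gamma>)"
    define K2 where "K2 = 2 * C1 / s + 2 * C2"
    have K12: "0 \<le> K1" "0 \<le> K2" using TC(2) C1(1) C2(1) s_pos by (auto simp: K1_def K2_def)
    define K where "K = 2 / \<kappa> * (K1 + K2)"
    have upper: "\<forall>\<^sub>F n in sequentially. \<exists>B\<in>sets M. {\<omega> \<in> space M. \<delta> * u n \<le> threshold n \<omega>} \<subseteq> B \<and> measure M B \<le> \<epsilon> / 4"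
      by (rule threshold_upper[OF r _ ev\<delta> \<epsilon>4]) (use \<delta> Ku in simp)
    show "\<exists>C. \<forall>\<^sub>F n in sequentially. \<exists>B\<in>sets M.
        {\<omega> \<in> space M. \<bar>tv_dist (G_hat n \<omega>) (G n)\<bar> > C * (?N1 n + ?N2 n)} \<subseteq> B \<and> measure M B \<le> \<epsilon>"
    proof (rule exI[of _ K])
      show "\<forall>\<^sub>F n in sequentially. \<exists>B\<in>sets M.
        {\<omega> \<in> space M. \<bar>tv_dist (G_hat n \<omega>) (G n)\<bar> > K * (?N1 n + ?N2 n)} \<subseteq> B \<and> measure M B \<le> \<epsilon>"
        using C1(2) C2(2) upper Kt(2)[OF \<epsilon>4] evT ev\<delta> ev_far ev_u ev_k rate_m rate_l \<kappa>0(2) eventually_ge_at_top[of 1]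
      proof eventually_elim
        case (elim n)
        obtain B1 where B1: "B1 \<in> sets M" "measure M B1 \<le> \<epsilon> / 4"
          "{\<omega> \<in> space M. \<bar>\<bar>s_hat n (D n \<omega>) - s\<bar>\<bar> > C1 * real (k n) powr (- m)} \<subseteq> B1" using elim(1) by blast
        obtain B2 where B2: "B2 \<in> sets M" "measure M B2 \<le> \<epsilon> / 4"
          "{\<omega> \<in> space M. \<bar>tv_dist (angular_law E P (t n \<omega>)) (?Ghat n \<omega>)\<bar> > C2 * real (k n) powr (- l)} \<subseteq> B2" using elim(2) by blast
        obtain B3 where B3: "B3 \<in> sets M" "measure M B3 \<le> \<epsilon> / 4"
          "{\<omega> \<in> space M. \<delta> * u n \<le> threshold n \<omega>} \<subseteq> B3" using elim(3) by blast
        obtain B4 where B4: "B4 \<in> sets M" "measure M B4 \<le> \<epsilon> / 4"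
          "{\<omega> \<in> space M. threshold n \<omega> < Kt * real n powr (q / s)} \<subseteq> B4" using elim(4) by blast
        let ?B = "(B1 \<union> B2) \<union> (B3 \<union> B4)"
        have "measure M ?B \<le> (measure M B1 + measure M B2) + (measure M B3 + measure M B4)"
          using B1 B2 B3 B4
          by (intro order_trans[OF measure_Un_le] add_mono measure_Un_le sets.Un) auto
        then have mB: "measure M ?B \<le> \<epsilon>" using B1 B2 B3 B4 by linarith
        have n: "1 \<le> n" using elim by simp
        have "\<bar>tv_dist (G_hat n \<omega>) (G n)\<bar> \<le> K * (?N1 n + ?N2 n)" if \<omega>: "\<omega> \<in> space M" "\<omega> \<notin> ?B" for \<omega>
        proof -
          define \<tau> \<alpha> g where "\<tau> = t n \<omega>" and "\<alpha> = s_hat n (D n \<omega>)" and "g = \<phi>_hat n (D n \<omega>)"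
          define a S where "a = \<delta> * u n" and "S = stress_set E L (u n) J"
          \<comment> \<open>Outside B3 and B4 the threshold is large enough for the tail estimate
            and still below the radius beyond which the stress set lies.\<close>
          have \<tau>: "Kt * real n powr (q / s) \<le> \<tau>" "\<tau> \<le> a"
            using \<omega> B3(3) B4(3) by (auto simp: \<tau>_def t' a_def not_less not_le intro: less_imp_le)
          have \<tau>T: "T \<le> \<tau>" "T' \<le> \<tau>" "0 < \<tau>" using \<tau> elim(5) TC(1) by auto
          have u0: "0 < u n" using elim by simp
          have \<alpha>: "0 < \<alpha>" unfolding \<alpha>_def by (rule s_hat[OF n \<omega>(1)])
          have g: "g \<in> borel_measurable (restrict_space borel (directions E))"
            "prob_space (density (surface_measure E) (\<lambda>\<phi>. ennreal (g \<phi>)))"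
            unfolding g_def using \<phi>_hat(1)[OF n \<omega>(1)] \<phi>_hat(3)[OF n \<omega>(1)] by auto
          have Q: "ssgen_law E \<tau> (real (k n) / real n) \<alpha> g (P_hat n \<omega>)"
            unfolding \<tau>_def \<alpha>_def g_def by (rule P_hat[OF n \<omega>(1)])
          have p: "0 < real (k n) / real n" using elim n by (auto simp: k')
          have S: "S \<in> sets borel" "S \<subseteq> E" "S \<subseteq> {x. a < norm x}"
            using stress_set_measurable[OF losses closed_E] elim(7) by (auto simp: S_def a_def stress_set_def)
          have \<kappa>S: "\<kappa> \<le> s * a powr s / angular_mass * measure P S"
          proof -
            have "\<kappa> \<le> s * \<delta> powr s / angular_mass * (u n powr s * measure P S)"
              unfolding \<kappa>_def S_def using elim(12) s_pos angular_mass_pos by (intro mult_left_mono) auto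
            also have "\<dots> = s * a powr s / angular_mass * measure P S"
              using \<delta> u0 by (simp add: a_def powr_mult)
            finally show ?thesis .
          qed
          define e where "e = C * a powr (- \<gamma>) + \<bar>\<alpha> - s\<bar> / s + 2 * (C * \<tau> powr (- \<gamma>))
            + tv_dist (angular_law E P \<tau>) (density (surface_measure E) (\<lambda>\<phi>. ennreal (g \<phi>)))"
          have Ta: "T \<le> a" using \<tau> \<tau>T by linarith
          note approx = conditional_law_approx[OF \<tau>T(3) \<tau>(2) TC(3)[OF Ta] TC(3)[OF \<tau>T(1)] T'[OF \<tau>T(2)] S(1,3) \<kappa> \<kappa>S Q p \<alpha> g e_def]
          have null: "\<kappa> \<le> e" if "measure (P_hat n \<omega>) S = 0"
            by (rule approx(1)) (use that in auto)
          have PS: "emeasure P S \<noteq> 0"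
            using \<kappa> \<kappa>S by (auto simp: P.emeasure_eq_measure)
          have tv: "\<bar>tv_dist (G_hat n \<omega>) (G n)\<bar> \<le> 2 * e / \<kappa>"
            unfolding G G_hat \<pi> \<pi>_hat S_def[symmetric]
          proof (rule tv_dist_stressed_law_le)
            show "prob_space P" by (rule prob_P)
            show "prob_space (P_hat n \<omega>)" "sets (P_hat n \<omega>) = sets borel"
              using Q by (auto simp: ssgen_law_def)
            show "stress_summary W L (u n) \<in> measurable (restrict_space borel E) (restrict_space borel Y)"
              by (rule stress_summary_measurable[OF losses W u0])
            \<comment> \<open>When the generated law misses S, \<kappa> <= e makes the claimed bound
              at least 2, so the fallback law is harmless.\<close>
            show "1 \<le> 2 * e / \<kappa>" if "measure (P_hat n \<omega>) S = 0"
              using null[OF that] \<kappa> by (simp add: field_simps)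
            show "\<bar>measure (P_hat n \<omega>) B / measure (P_hat n \<omega>) S - measure P B / measure P S\<bar> \<le> 2 * e / \<kappa>"
              if "measure (P_hat n \<omega>) S \<noteq> 0" "B \<in> sets borel" "B \<subseteq> S" for B
              by (rule approx(2)) (use that in auto)
          qed (use S PS u0 N \<omega> in auto)
          \<comment> \<open>The bias at the stress level has the exponent r instead of q, and q < 1
            <= r lets the weaker rate cover it.\<close>
          have "C * a powr (- \<gamma>) \<le> C * ((\<delta> * Ku) powr (- \<gamma>) * ?N2 n)"
            using elim(6) \<delta> Ku q r n s_pos \<gamma>_pos TC(2)
            by (intro mult_left_mono powr_rate[where \<rho>=r]) (auto simp: a_def)
          moreover have "C * \<tau> powr (- \<gamma>) \<le> C * (Kt powr (- \<gamma>) * ?N2 n)"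
            using \<tau> Kt n s_pos \<gamma>_pos TC(2)
            by (intro mult_left_mono powr_rate[where \<rho>=q]) auto
          moreover have "\<bar>\<alpha> - s\<bar> / s \<le> C1 * (2 * ?N1 n) / s"
          proof (rule divide_right_mono)
            have "\<bar>\<alpha> - s\<bar> \<le> C1 * real (k n) powr (- m)"
              using \<omega> B1(3) by (auto simp: \<alpha>_def not_less)
            also have "\<dots> \<le> C1 * (2 * ?N1 n)" using elim(10) C1(1) by (rule mult_left_mono)
            finally show "\<bar>\<alpha> - s\<bar> \<le> C1 * (2 * ?N1 n)" .
          qed (use s_pos in simp)
          moreover have "tv_dist (angular_law E P \<tau>) (density (surface_measure E) (\<lambda>\<phi>. ennreal (g \<phi>))) \<le> C2 * (2 * ?N1 n)"
          proof -
            have "\<bar>tv_dist (angular_law E P \<tau>) (density (surface_measure E) (\<lambda>\<phi>. ennreal (g \<phi>)))\<bar> \<le> C2 * real (k n) powr (- l)"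
              using \<omega> B2(3) by (auto simp: \<tau>_def g_def not_less)
            also have "\<dots> \<le> C2 * (2 * ?N1 n)" using elim(11) C2(1) by (rule mult_left_mono)
            finally show ?thesis by simp
          qed
          ultimately have "e \<le> K1 * ?N2 n + K2 * ?N1 n"
            unfolding e_def K1_def K2_def by (simp add: algebra_simps)
          also have "\<dots> \<le> (K1 + K2) * (?N1 n + ?N2 n)"
            using K12 by (simp add: algebra_simps)
          finally have "e \<le> (K1 + K2) * (?N1 n + ?N2 n)" .
          then have "2 / \<kappa> * e \<le> K * (?N1 n + ?N2 n)"
            unfolding K_def mult.assoc[of "2 / \<kappa>"] using \<kappa> by (intro mult_left_mono) auto
          moreover have "2 * e / \<kappa> = 2 / \<kappa> * e" by simp
          ultimately show ?thesis by (metis order_trans tv)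
        qed
        then have "{\<omega> \<in> space M. \<bar>tv_dist (G_hat n \<omega>) (G n)\<bar> > K * (?N1 n + ?N2 n)} \<subseteq> ?B"
          by (auto simp: not_le[symmetric])
        then show ?case using mB B1(1) B2(1) B3(1) B4(1) by blast
      qed
    qed
  qed
qed

end
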